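(* Let $P$ be a polynomial of degree $\lambda\ge 1$ with $\mathrm{Re}\,P(ix)=0$ for all $x\in\mathbb{R}$, let $T>0$, and fix $0\le\sigma\le 1$ and $r\ge 0$ such that $r+1-2\sigma+2\lambda>1/2$. Then there is a function $K:[0,\infty)\to(0,\infty)$ (depending only on $r,\sigma,P,T$, and in particular not on $\varepsilon$, $\tau$, $n$) such that the following holds. Let $0<\varepsilon\le 1$ and assume that the exact solution $u$ of the equation $$\partial_t u+\mathcal{L}_{\varepsilon,\lambda}u+\varepsilon\mathcal{L}_\varepsilon(u^2)=0\quad\text{on }\mathbb{T}$$ satisfies $u\in\mathcal{C}([0,T],H^{r+1+2\lambda-2\sigma}(\mathbb{T}))$. Then there exists $\tau_0>0$ such that for all $0<\tau\le\tau_0$ and all $n$ with $t_n=n\tau\le T$, the Strang splitting approximation defined by $u^0=u(0)$ and $$u^{n+1}=e^{-\tau\mathcal{L}_{\varepsilon,\lambda}}u^n-\tau\varepsilon\, e^{-\frac{\tau}{2}\mathcal{L}_{\varepsilon,\lambda}}\mathcal{L}_\varepsilon\big((v^n)^2\big)+\tau^2\varepsilon^2\, e^{-\frac{\tau}{2}\mathcal{L}_{\varepsilon,\lambda}}\mathcal{L}_\varepsilon\Big(v^n\,\mathcal{L}_\varepsilon\big((v^n)^2\big)\Big),\qquad v^n:=e^{-\frac{\tau}{2}\mathcal{L}_{\varepsilon,\lambda}}u^n,$$ satisfies $$\|u(t_n)-u^n\|_r\le \tau^2\,\varepsilon^{1-\sigma}K\Big(\sup_{t\in[0,T]}\|u(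t)\|_{r+1+2\lambda-2\sigma}\Big).$$
   Context: $\mathbb{T}=[-\pi,\pi]$ with periodic boundary conditions. For $s\in\mathbb{R}$, $\|\cdot\|_s$ is the standard $H^s(\mathbb{T})$ norm, defined through Fourier coefficients. The operators are the Fourier multipliers $\mathcal{L}_\varepsilon=\frac{\partial_x}{1-\varepsilon\partial_x^2}$ with symbol $\frac{ik}{1+\varepsilon k^2}$, $\mathcal{L}_{\varepsilon,\lambda}=\frac{P(\partial_x)}{1-\varepsilon\partial_x^2}$ with symbol $\frac{P(ik)}{1+\varepsilon k^2}$, and $e^{t\mathcal{L}_{\varepsilon,\lambda}}$ with symbol $e^{tP(ik)/(1+\varepsilon k^2)}$, $k\in\mathbb{Z}$. Solutions of the (Benjamin--Bona--Mahony) equation are understood in the mild sense: $u(t)=e^{-t\mathcal{L}_{\varepsilon,\lambda}}u(0)-\varepsilon\mathcal{L}_\varepsilon\int_0^t e^{-(t-s)\mathcal{L}_{\varepsilon,\lambda}}u^2(s)\,ds$. *)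

theory Defs
  imports "HOL-Analysis.Analysis" "HOL-Computational_Algebra.Polynomial"
begin

text \<open>Functions on the torus are \<open>2\<pi>\<close>-periodic complex-valued functions on the real line.\<close>

definition fourier_coeff :: "(real \<Rightarrow> complex) \<Rightarrow> int \<Rightarrow> complex" where
  "fourier_coeff f k =
     (LINT x|lebesgue_on {-pi..pi}. f x * cis (- (of_int k * x))) / of_real (2 * pi)"

text \<open>\<open>sobolev s\<close> is used for \<open>s \<ge> 0\<close> only, where \<open>H\<^sup>s\<close> consists of functions. Both it and
  \<open>sobolev_norm\<close> are invariant under changing a periodic function on a null set, so they
  describe \<open>H\<^sup>s\<close> in terms of representatives. The value of \<open>sobolev_norm s f\<close> is meaningful
  only for \<open>f \<in> sobolev s\<close>.\<close>

definition sobolev :: "real \<Rightarrow> (real \<Rightarrow> complex) set" where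
  "sobolev s = {f. (\<forall>x. f (x + 2 * pi) = f x) \<and>
     f \<in> borel_measurable (lebesgue_on {-pi..pi}) \<and>
     integrable (lebesgue_on {-pi..pi}) (\<lambda>x. (cmod (f x))\<^sup>2) \<and>
     (\<lambda>k::int. (1 + (of_int k)\<^sup>2) powr s * (cmod (fourier_coeff f k))\<^sup>2) summable_on UNIV}"

definition sobolev_norm :: "real \<Rightarrow> (real \<Rightarrow> complex) \<Rightarrow> real" where
  "sobolev_norm s f =
     sqrt (\<Sum>\<^sub>\<infinity>k::int. (1 + (of_int k)\<^sup>2) powr s * (cmod (fourier_coeff f k))\<^sup>2)"

definition sobolev_continuous_on :: "real set \<Rightarrow> real \<Rightarrow> (real \<Rightarrow> real \<Rightarrow> complex) \<Rightarrow> bool" where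
  "sobolev_continuous_on I s u \<longleftrightarrow> (\<forall>t\<in>I. u t \<in> sobolev s) \<and>
     (\<forall>t\<in>I. ((\<lambda>t'. sobolev_norm s (\<lambda>x. u t' x - u t x)) \<longlongrightarrow> 0) (at t within I))"

text \<open>The series converges absolutely when \<open>m\<close> is bounded and \<open>f\<close> is in \<open>sobolev s\<close> with
  \<open>s > 1/2\<close>; the result is then the continuous representative.\<close>

definition fourier_multiplier :: "(int \<Rightarrow> complex) \<Rightarrow> (real \<Rightarrow> complex) \<Rightarrow> real \<Rightarrow> complex" where
  "fourier_multiplier m f x = (\<Sum>\<^sub>\<infinity>k. m k * fourier_coeff f k * cis (of_int k * x))"

definition L_eps :: "real \<Rightarrow> (real \<Rightarrow> complex) \<Rightarrow> real \<Rightarrow> complex" where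
  "L_eps \<epsilon> = fourier_multiplier (\<lambda>k. \<i> * of_int k / (1 + of_real \<epsilon> * (of_int k)\<^sup>2))"

text \<open>\<open>exp_L P \<epsilon> t\<close> is the operator \<open>exp (t P(\<partial>\<^sub>x) / (1 - \<epsilon> \<partial>\<^sub>x\<^sup>2))\<close>.\<close>

definition exp_L :: "complex poly \<Rightarrow> real \<Rightarrow> real \<Rightarrow> (real \<Rightarrow> complex) \<Rightarrow> real \<Rightarrow> complex" where
  "exp_L P \<epsilon> t = fourier_multiplier
     (\<lambda>k. exp (of_real t * poly P (\<i> * of_int k) / (1 + of_real \<epsilon> * (of_int k)\<^sup>2)))"

text \<open>The time integral is evaluated pointwise in space. For \<open>u\<close> continuous into \<open>H\<^sup>s\<close> with
  \<open>s > 1/2\<close> the integrand is continuous into the algebra \<open>H\<^sup>s\<close>, on which point evaluation is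
  a continuous functional, so this is the \<open>H\<^sup>s\<close>-valued integral. Equality in \<open>H\<^sup>s\<close> is equality
  almost everywhere.\<close>

definition mild_solution ::
    "complex poly \<Rightarrow> real \<Rightarrow> real \<Rightarrow> (real \<Rightarrow> real \<Rightarrow> complex) \<Rightarrow> bool" where
  "mild_solution P \<epsilon> T u \<longleftrightarrow> (\<forall>t\<in>{0..T}. AE x in lebesgue_on {-pi..pi}.
     u t x = exp_L P \<epsilon> (- t) (u 0) x
       - of_real \<epsilon> * L_eps \<epsilon>
           (\<lambda>y. integral {0..t} (\<lambda>s. exp_L P \<epsilon> (- (t - s)) (\<lambda>z. (u s z)\<^sup>2) y)) x)"

definition strang_step ::
    "complex poly \<Rightarrow> real \<Rightarrow> real \<Rightarrow> (real \<Rightarrow> complex) \<Rightarrow> real \<Rightarrow> complex" where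
  "strang_step P \<epsilon> \<tau> w =
     (let v = exp_L P \<epsilon> (- \<tau> / 2) w;
          b = L_eps \<epsilon> (\<lambda>y. (v y)\<^sup>2)
      in (\<lambda>x. exp_L P \<epsilon> (- \<tau>) w x
            - of_real (\<tau> * \<epsilon>) * exp_L P \<epsilon> (- \<tau> / 2) b x
            + of_real (\<tau>\<^sup>2 * \<epsilon>\<^sup>2) * exp_L P \<epsilon> (- \<tau> / 2) (L_eps \<epsilon> (\<lambda>y. v y * b y)) x))"

primrec strang ::
    "complex poly \<Rightarrow> real \<Rightarrow> real \<Rightarrow> (real \<Rightarrow> complex) \<Rightarrow> nat \<Rightarrow> real \<Rightarrow> complex" where
  "strang P \<epsilon> \<tau> u0 0 = u0"
| "strang P \<epsilon> \<tau> u0 (Suc n) = strang_step P \<epsilon> \<tau> (strang P \<epsilon> \<tau> u0 n)"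

end

theory Submission
  imports Defs
begin

text \<open>In the interaction picture \<open>W\<^sub>k(t) = exp (i t a\<^sub>k) \<cdot> u\<^sub>k(t)\<close>, where \<open>i a\<^sub>k\<close> is the symbol of the
  linear part, the equation reads \<open>W' = - \<beta> F(t; W, W)\<close> with \<open>\<beta>\<close> the symbol of \<open>\<epsilon> L\<^sub>\<epsilon>\<close> and \<open>F\<close> a
  convolution twisted by \<open>exp (i t \<phi>(k, j))\<close>, \<open>\<phi>(k, j) = a\<^sub>k - a\<^sub>j - a\<^bsub>k-j\<^esub>\<close>, and the Strang step is a second
  order explicit Taylor midpoint rule. Each power of \<open>\<phi>\<close> costs \<open>\<lambda> = degree P\<close> derivatives, uniformly in
  \<open>\<epsilon>\<close>, so the integrand of the local error is \<open>O(\<tau>\<^sup>2)\<close> in the Sobolev norm of order \<open>r + 1 - 2\<sigma>\<close>. The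
  multiplier \<open>\<beta>\<close> maps this space to order \<open>r\<close> with norm \<open>O(\<epsilon>\<^bsup>1-\<sigma>\<^esup>)\<close> and is a contraction on every
  Sobolev space, which gives stability uniformly in \<open>\<epsilon>\<close>. As the algebra property may fail in order
  \<open>r\<close>, the iterates are first bounded in order \<open>\<rho> = r + 3/4 + 2\<lambda> - 2\<sigma> > 1/2\<close>, where the local error
  is still \<open>O(\<tau>\<^bsup>1+\<theta>\<^esup>)\<close> with \<open>\<theta> = 1/(4\<lambda>)\<close>.\<close>

section \<open>Sobolev weights and twisted convolutions\<close>

text \<open>The Strang step is the second order Taylor polynomial of the flow of W' = - \<beta> F(m;
  W, W) with time frozen at the midpoint m; F is symmetric, so the second derivative carries a
  factor 2 that cancels the 1/2. Freezing at m makes the linear part of the phase error odd about m,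
  and the \<tau>^2 term of the scheme removes the linear part of the change of W. The order q = r +
  1 - 2\<sigma> can be as low as -1, so products are estimated by a weight inequality that also
  covers negative orders. In the order s = q + 2\<lambda> of u itself every power of \<phi>
  overdraws the regularity, and a local error without extra decay in \<tau> would not keep the
  iterates bounded. Hence \<rho> < s: the loss 1/4 pays for \<phi> to the power \<theta>, because
  \<lambda>\<theta> = 1/4, and as s >= 1 it leaves \<rho> >= 3/4. This bootstrap only restricts
  \<tau>0; the constant of the final bound comes from the local error in order r and the stability
  constant. All estimates run on the integral equation for the coefficients, so W is never
  differentiated in time.\<close>

definition bracket :: "real \<Rightarrow> int \<Rightarrow> real" where
  "bracket s k = (1 + (of_int k)\<^sup>2) powr (s / 2)"

lemma one_plus_square_ge_1: "1 \<le> 1 + (of_int k :: real)\<^sup>2"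
  by simp

lemma bracket_pos [simp]: "0 < bracket s k"
proof -
  have "1 + (of_int k :: real)\<^sup>2 \<noteq> 0" using one_plus_square_ge_1[of k] by linarith
  then show ?thesis by (simp add: bracket_def)
qed

lemma bracket_nonneg [simp]: "0 \<le> bracket s k"
  using bracket_pos[of s k] by linarith

lemma bracket_0 [simp]: "bracket 0 k = 1"
proof -
  have "1 + (of_int k :: real)\<^sup>2 \<noteq> 0" using one_plus_square_ge_1[of k] by linarith
  then show ?thesis by (simp add: bracket_def)
qed

lemma bracket_add: "bracket (s + t) k = bracket s k * bracket t k"
  by (simp add: bracket_def powr_add add_divide_distrib)

lemma bracket_minus_cancel: "bracket (- s) k * bracket s k = 1"
  using bracket_add[of "- s" s k] by simp

lemma bracket_square: "(bracket s k)\<^sup>2 = (1 + (of_int k)\<^sup>2) powr s"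
  by (simp add: bracket_def power2_eq_square flip: powr_add)

lemma bracket_mono: "s \<le> t \<Longrightarrow> bracket s k \<le> bracket t k"
  unfolding bracket_def by (intro powr_mono) auto

lemma bracket_ge_1: "0 \<le> s \<Longrightarrow> 1 \<le> bracket s k"
  using bracket_mono[of 0 s k] by simp

text \<open>Among three frequencies with \<open>k = j + i\<close> the two largest are comparable; the three cases
  of the proof are the three possible positions of the smallest one.\<close>

lemma powr_trilinear:
  fixes X I J p t :: real
  assumes ge: "1 \<le> X" "1 \<le> J" "1 \<le> I"
    and cmp: "X \<le> 4 * max J I" "J \<le> 4 * max X I" "I \<le> 4 * max X J"
    and p: "\<bar>p\<bar> \<le> t"
  shows "X powr p \<le> 4 powr t * (I powr (- t) + J powr (- t) + X powr (- t)) * J powr p * I powr t"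
proof -
  have t: "0 \<le> t" using p by linarith
  consider "I \<le> J" "I \<le> X" | "J \<le> I" "J \<le> X" | "X \<le> I" "X \<le> J" by linarith
  then have "\<exists>Y\<in>{I, J, X}. X powr p \<le> 4 powr t * Y powr (- t) * J powr p * I powr t"
  proof cases
    case 1
    have c: "X \<le> 4 * J" "J \<le> 4 * X" using 1 cmp by auto
    have "X powr p \<le> 4 powr t * J powr p"
    proof (cases "0 \<le> p")
      case True
      have "X powr p \<le> (4 * J) powr p" using c ge True by (intro powr_mono2) auto
      also have "\<dots> = 4 powr p * J powr p" using ge by (simp add: powr_mult)
      also have "\<dots> \<le> 4 powr t * J powr p" using p by (intro mult_right_mono powr_mono) auto
      finally show ?thesis .
    next
      case False
      have "X powr p \<le> (J / 4) powr p" using c ge False by (intro powr_mono2') auto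
      also have "\<dots> = 4 powr (- p) * J powr p"
        using ge by (simp add: powr_divide powr_minus field_simps)
      also have "\<dots> \<le> 4 powr t * J powr p" using p by (intro mult_right_mono powr_mono) auto
      finally show ?thesis .
    qed
    moreover have "4 powr t * I powr (- t) * J powr p * I powr t
        = 4 powr t * J powr p * (I powr (- t) * I powr t)" by (simp only: mult_ac)
    moreover have "I powr (- t) * I powr t = 1" using ge by (simp flip: powr_add)
    ultimately have "X powr p \<le> 4 powr t * I powr (- t) * J powr p * I powr t"
      by (simp only: mult_1_right)
    then show ?thesis by blast
  next
    case 2
    have c: "X \<le> 4 * I" using 2 cmp by auto
    \<comment> \<open>Shifting the exponent by t fixes its sign whatever the sign of p: p - t <= 0
      lets the smaller J replace X here, and p + t >= 0 lets the larger J replace X in the last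
      case.\<close>
    have "X powr p = X powr (p - t) * X powr t" by (simp flip: powr_add)
    also have "\<dots> \<le> J powr (p - t) * (4 * I) powr t"
      using 2 c ge p t by (intro mult_mono powr_mono2 powr_mono2') auto
    also have "\<dots> = 4 powr t * J powr (- t) * J powr p * I powr t"
      using ge by (simp add: powr_mult powr_diff powr_minus field_simps)
    finally show ?thesis by blast
  next
    case 3
    have c: "J \<le> 4 * I" using 3 cmp by auto
    have "X powr p = X powr (p + t) * X powr (- t)" by (simp flip: powr_add)
    also have "\<dots> \<le> J powr (p + t) * X powr (- t)"
      using 3 ge p t by (intro mult_right_mono powr_mono2) auto
    also have "\<dots> = J powr t * X powr (- t) * J powr p" by (simp add: powr_add)
    also have "\<dots> \<le> (4 * I) powr t * X powr (- t) * J powr p"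
      using c ge t by (intro mult_right_mono powr_mono2) auto
    also have "\<dots> = 4 powr t * X powr (- t) * J powr p * I powr t"
      using ge by (simp add: powr_mult)
    finally show ?thesis by blast
  qed
  moreover have "4 powr t * Y powr (- t) * J powr p * I powr t
      \<le> 4 powr t * (I powr (- t) + J powr (- t) + X powr (- t)) * J powr p * I powr t"
    if "Y \<in> {I, J, X}" for Y
    using that by (intro mult_right_mono mult_left_mono) auto
  ultimately show ?thesis by (meson order_trans)
qed

lemma one_plus_square_add_le:
  fixes x y z :: real
  assumes "x = y + z \<or> x = y - z"
  shows "1 + x\<^sup>2 \<le> 4 * max (1 + y\<^sup>2) (1 + z\<^sup>2)"
proof -
  have "x\<^sup>2 \<le> 2 * y\<^sup>2 + 2 * z\<^sup>2"
    using assms zero_le_power2[of "y - z"] zero_le_power2[of "y + z"]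
    by (auto simp: power2_eq_square algebra_simps)
  then show ?thesis by (simp add: max_def)
qed

lemma four_powr_half: "4 powr (s / 2) = 2 powr (s :: real)"
proof -
  have "4 powr (s / 2) = (2 powr 2) powr (s / 2)" by (simp add: powr_numeral)
  then show ?thesis by (simp only: powr_powr) simp
qed

text \<open>The factor \<open>bracket (- s)\<close>, square summable for s > 1/2, sits on whichever
  of the three frequencies is smallest. Each of its positions leads to one of three elementary
  convolution bounds.\<close>

lemma bracket_trilinear:
  assumes "\<bar>q\<bar> \<le> s"
  shows "bracket q k \<le> 2 powr s * (bracket (- s) (k - j) + bracket (- s) j + bracket (- s) k)
           * bracket q j * bracket s (k - j)"
proof -
  have "(1 + (of_int k)\<^sup>2) \<le> 4 * max (1 + (of_int j :: real)\<^sup>2) (1 + (of_int (k - j))\<^sup>2)"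
    "(1 + (of_int j)\<^sup>2) \<le> 4 * max (1 + (of_int k :: real)\<^sup>2) (1 + (of_int (k - j))\<^sup>2)"
    "(1 + (of_int (k - j))\<^sup>2) \<le> 4 * max (1 + (of_int k :: real)\<^sup>2) (1 + (of_int j)\<^sup>2)"
    by (intro one_plus_square_add_le; simp)+
  from powr_trilinear[OF one_plus_square_ge_1 one_plus_square_ge_1 one_plus_square_ge_1 this,
      of "q / 2" "s / 2"]
  show ?thesis using assms by (simp add: bracket_def four_powr_half)
qed

text \<open>Charges the growth of a symbol at the output frequency to the two input
  frequencies.\<close>

lemma bracket_quasi_triangle:
  assumes "0 \<le> s"
  shows "bracket s k \<le> 2 powr s * (bracket s j + bracket s (k - j))"
proof -
  let ?J = "1 + (of_int j :: real)\<^sup>2" and ?I = "1 + (of_int (k - j) :: real)\<^sup>2"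
  have "1 + (of_int k)\<^sup>2 \<le> 4 * max ?J ?I" by (rule one_plus_square_add_le) simp
  then have "bracket s k \<le> (4 * max ?J ?I) powr (s / 2)"
    unfolding bracket_def using assms by (intro powr_mono2) auto
  also have "\<dots> = 2 powr s * max ?J ?I powr (s / 2)"
    by (simp add: powr_mult four_powr_half)
  also have "max ?J ?I powr (s / 2) \<le> bracket s j + bracket s (k - j)"
    by (auto simp: bracket_def max_def)
  finally show ?thesis by simp
qed

section \<open>Square summability of the weights\<close>

lemma summable_on_int_from_nat:
  fixes f :: "nat \<Rightarrow> real"
  assumes "summable f" "\<And>n. 0 \<le> f n"
  shows "(\<lambda>k::int. f (nat \<bar>k\<bar>)) summable_on UNIV"
proof -
  have f: "f summable_on UNIV"
    using assms by (intro norm_summable_imp_summable_on) simp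
  have "(\<lambda>k::int. f (nat \<bar>k\<bar>)) summable_on (range int)"
    by (subst summable_on_reindex) (auto simp: o_def f)
  moreover have "(\<lambda>k::int. f (nat \<bar>k\<bar>)) summable_on (range (\<lambda>n. - int n))"
    by (subst summable_on_reindex) (auto simp: o_def f inj_on_def)
  ultimately have "(\<lambda>k::int. f (nat \<bar>k\<bar>)) summable_on (range int \<union> range (\<lambda>n. - int n))"
    by (rule summable_on_union)
  moreover have "range int \<union> range (\<lambda>n. - int n) = (UNIV :: int set)"
  proof -
    have "k \<in> range int \<union> range (\<lambda>n. - int n)" for k :: int
      by (cases k rule: int_cases2) auto
    then show ?thesis by blast
  qed
  ultimately show ?thesis by simp
qed

lemma bracket_square_summable:
  assumes "1 / 2 < s"
  shows "(\<lambda>k. (bracket (- s) k)\<^sup>2) summable_on UNIV"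
proof -
  define f where "f n = (1 + (real n)\<^sup>2) powr (- s)" for n
  have "summable (\<lambda>n. real n powr (- 2 * s))"
    using assms by (simp add: summable_real_powr_iff)
  then have "summable f"
  proof (rule summable_comparison_test_ev[rotated])
    show "\<forall>\<^sub>F n in sequentially. norm (f n) \<le> real n powr (- 2 * s)"
    \<comment> \<open>The comparison fails at n = 0, where \<open>f 0 = 1\<close> but
      \<open>0 powr _ = 0\<close>.\<close>
    proof (rule eventually_sequentiallyI[of 1])
      fix n :: nat assume n: "1 \<le> n"
      have "(1 + (real n)\<^sup>2) powr (- s) \<le> ((real n)\<^sup>2) powr (- s)"
        using assms n by (intro powr_mono2') auto
      also have "\<dots> = (real n powr 2) powr (- s)" using n by (simp add: powr_numeral)
      also have "\<dots> = real n powr (- 2 * s)" by (simp only: powr_powr) simp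
      finally show "norm (f n) \<le> real n powr (- 2 * s)" by (simp add: f_def)
    qed
  qed
  then have "(\<lambda>k::int. f (nat \<bar>k\<bar>)) summable_on UNIV"
    by (rule summable_on_int_from_nat) (simp add: f_def)
  then show ?thesis by (simp add: f_def bracket_square)
qed

lemma L2_set_le_sqrt_infsum:
  fixes f :: "'a \<Rightarrow> real"
  assumes "(\<lambda>k. (f k)\<^sup>2) summable_on UNIV" "finite F"
  shows "L2_set f F \<le> sqrt (\<Sum>\<^sub>\<infinity>k. (f k)\<^sup>2)"
  unfolding L2_set_def
  by (intro real_sqrt_le_mono finite_sum_le_infsum assms) auto

lemma bracket_L2_bound:
  assumes "1 / 2 < s"
  shows "\<exists>H\<ge>0. \<forall>F. finite F \<longrightarrow> L2_set (bracket (- s)) F \<le> H"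
proof (intro exI conjI allI impI)
  show "0 \<le> sqrt (\<Sum>\<^sub>\<infinity>k. (bracket (- s) k)\<^sup>2)" by (simp add: infsum_nonneg)
qed (rule L2_set_le_sqrt_infsum[OF bracket_square_summable[OF assms]])

text \<open>A norm bound tested on finite sections. Written with \<open>infsum\<close> it would hold
  for divergent series too, whose value defaults to 0; in this form the bound contains the
  summability.\<close>

definition hs_bounded :: "real \<Rightarrow> real \<Rightarrow> (int \<Rightarrow> complex) \<Rightarrow> bool" where
  "hs_bounded s M a \<longleftrightarrow> (\<forall>F. finite F \<longrightarrow> L2_set (\<lambda>k. bracket s k * cmod (a k)) F \<le> M)"

lemma hs_boundedI:
  "(\<And>F. finite F \<Longrightarrow> L2_set (\<lambda>k. bracket s k * cmod (a k)) F \<le> M) \<Longrightarrow> hs_bounded s M a"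
  by (simp add: hs_bounded_def)

lemma hs_boundedD:
  "hs_bounded s M a \<Longrightarrow> finite F \<Longrightarrow> L2_set (\<lambda>k. bracket s k * cmod (a k)) F \<le> M"
  by (simp add: hs_bounded_def)

lemma hs_bounded_nonneg: "hs_bounded s M a \<Longrightarrow> 0 \<le> M"
  using hs_boundedD[of s M a "{}"] by simp

lemma hs_bounded_mono: "hs_bounded s M a \<Longrightarrow> M \<le> N \<Longrightarrow> hs_bounded s N a"
  by (auto simp: hs_bounded_def intro: order_trans)

lemma hs_bounded_weaken: "hs_bounded s M a \<Longrightarrow> t \<le> s \<Longrightarrow> hs_bounded t M a"
  by (rule hs_boundedI, rule order_trans[OF L2_set_mono hs_boundedD])
     (auto intro!: mult_right_mono bracket_mono)

lemma hs_bounded_coeff: "hs_bounded s M a \<Longrightarrow> bracket s k * cmod (a k) \<le> M"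
  using hs_boundedD[of s M a "{k}"] by simp

lemma hs_bounded_coeff_le: "hs_bounded s M a \<Longrightarrow> 0 \<le> s \<Longrightarrow> cmod (a k) \<le> M"
  using hs_bounded_coeff[of s M a k] bracket_ge_1[of s k]
  by (smt (verit) mult_left_le_one_le mult_le_cancel_right1 norm_ge_zero)

lemma hs_bounded_zero: "hs_bounded s 0 (\<lambda>k. 0)"
  by (simp add: hs_bounded_def L2_set_def)

lemma hs_bounded_add:
  assumes "hs_bounded s M a" "hs_bounded s N b"
  shows "hs_bounded s (M + N) (\<lambda>k. a k + b k)"
proof (rule hs_boundedI)
  fix F :: "int set" assume F: "finite F"
  have "L2_set (\<lambda>k. bracket s k * cmod (a k + b k)) F
      \<le> L2_set (\<lambda>k. bracket s k * cmod (a k) + bracket s k * cmod (b k)) F"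
    by (intro L2_set_mono) (auto simp: norm_triangle_ineq simp flip: distrib_left)
  also have "\<dots> \<le> L2_set (\<lambda>k. bracket s k * cmod (a k)) F + L2_set (\<lambda>k. bracket s k * cmod (b k)) F"
    by (rule L2_set_triangle_ineq)
  also have "\<dots> \<le> M + N"
    by (intro add_mono hs_boundedD assms F)
  finally show "L2_set (\<lambda>k. bracket s k * cmod (a k + b k)) F \<le> M + N" .
qed

lemma hs_bounded_multiplier:
  assumes a: "hs_bounded s M a" and m: "\<And>k. cmod (m k) \<le> D * bracket \<mu> k"
  shows "hs_bounded (s - \<mu>) (D * M) (\<lambda>k. m k * a k)"
proof (rule hs_boundedI)
  fix F :: "int set" assume F: "finite F"
  have D: "0 \<le> D"
    using m[of 0] bracket_pos[of \<mu> 0] norm_ge_zero[of "m 0"]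
    by (meson dual_order.trans zero_le_mult_iff not_le)
  have "L2_set (\<lambda>k. bracket (s - \<mu>) k * cmod (m k * a k)) F
      \<le> L2_set (\<lambda>k. D * (bracket s k * cmod (a k))) F"
  proof (intro L2_set_mono)
    fix k
    have "bracket (s - \<mu>) k * cmod (m k * a k)
        \<le> bracket (s - \<mu>) k * (D * bracket \<mu> k * cmod (a k))"
      unfolding norm_mult by (intro mult_left_mono mult_right_mono m) auto
    also have "\<dots> = D * (bracket s k * cmod (a k))"
      using bracket_add[of "s - \<mu>" \<mu> k] by simp
    finally show "bracket (s - \<mu>) k * cmod (m k * a k) \<le> D * (bracket s k * cmod (a k))" .
  qed auto
  also have "\<dots> = D * L2_set (\<lambda>k. bracket s k * cmod (a k)) F"
    using D by (simp add: L2_set_right_distrib)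
  also have "\<dots> \<le> D * M" by (intro mult_left_mono hs_boundedD a F D)
  finally show "L2_set (\<lambda>k. bracket (s - \<mu>) k * cmod (m k * a k)) F \<le> D * M" .
qed

lemma hs_bounded_multiplier_le:
  assumes "hs_bounded s M a" "\<And>k. cmod (m k) \<le> D"
  shows "hs_bounded s (D * M) (\<lambda>k. m k * a k)"
  using hs_bounded_multiplier[OF assms(1), of m D 0] assms(2) by simp

lemma hs_bounded_scale:
  "hs_bounded s M a \<Longrightarrow> hs_bounded s (cmod c * M) (\<lambda>k. c * a k)"
  by (rule hs_bounded_multiplier_le) auto

lemma hs_bounded_uminus: "hs_bounded s M a \<Longrightarrow> hs_bounded s M (\<lambda>k. - a k)"
  using hs_bounded_scale[of s M a "-1"] by simp

lemma hs_bounded_diff: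
  "hs_bounded s M a \<Longrightarrow> hs_bounded s N b \<Longrightarrow> hs_bounded s (M + N) (\<lambda>k. a k - b k)"
  using hs_bounded_add[OF _ hs_bounded_uminus] by simp

text \<open>Cauchy-Schwarz against the constant 1, obtained by integrating (|f| - c)^2 >= 0 with c
  the mean value of |f|.\<close>

lemma integral_square_le:
  fixes f :: "real \<Rightarrow> complex"
  assumes "a \<le> b" "continuous_on {a..b} f"
  shows "(cmod (integral {a..b} f))\<^sup>2 \<le> (b - a) * integral {a..b} (\<lambda>x. (cmod (f x))\<^sup>2)"
proof -
  define J where "J = integral {a..b} (\<lambda>x. cmod (f x))"
  define S where "S = integral {a..b} (\<lambda>x. (cmod (f x))\<^sup>2)"
  have i1: "(\<lambda>x. cmod (f x)) integrable_on {a..b}"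
    and i2: "(\<lambda>x. (cmod (f x))\<^sup>2) integrable_on {a..b}" and i3: "f integrable_on {a..b}"
    using assms by (auto intro!: integrable_continuous_real continuous_intros)
  have n: "cmod (integral {a..b} f) \<le> J"
    unfolding J_def using integral_norm_bound_integral[OF i3 i1] by simp
  show ?thesis
  proof (cases "a = b")
    case True then show ?thesis by simp
  next
    case False
    then have ab: "0 < b - a" using assms by simp
    define c where "c = J / (b - a)"
    have "((\<lambda>x. (cmod (f x))\<^sup>2 - 2 * c * cmod (f x) + c\<^sup>2) has_integral
        (S - 2 * c * J + c\<^sup>2 * (b - a))) {a..b}"
      unfolding S_def J_def
      using has_integral_const_real[of "c\<^sup>2" a b] assms(1)
      by (intro has_integral_add has_integral_diff has_integral_mult_right integrable_integral i1 i2)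
         (simp add: mult.commute)
    moreover have "0 \<le> (cmod (f x))\<^sup>2 - 2 * c * cmod (f x) + c\<^sup>2" for x
      using zero_le_power2[of "cmod (f x) - c"] by (simp add: power2_eq_square algebra_simps)
    ultimately have "0 \<le> S - 2 * c * J + c\<^sup>2 * (b - a)"
      using has_integral_nonneg by blast
    also have "\<dots> = S - J\<^sup>2 / (b - a)"
    proof -
      have "c * (b - a) = J" using ab by (simp add: c_def)
      then have "c\<^sup>2 * (b - a) = c * J" by (metis mult.assoc power2_eq_square)
      then show ?thesis by (simp add: c_def power2_eq_square)
    qed
    finally have "J\<^sup>2 \<le> (b - a) * S" using ab by (simp add: pos_divide_le_eq mult.commute)
    moreover have "(cmod (integral {a..b} f))\<^sup>2 \<le> J\<^sup>2" using n by (intro power_mono) auto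
    ultimately show ?thesis by (simp add: S_def)
  qed
qed

text \<open>Minkowski's integral inequality. After squaring and Cauchy-Schwarz in x, only a finite
  sum has to be exchanged with the integral, so continuity of each single coefficient is
  enough.\<close>

lemma hs_bounded_integral:
  assumes ab: "a \<le> b" and cont: "\<And>k. continuous_on {a..b} (\<lambda>x. g x k)"
    and g: "\<And>x. x \<in> {a..b} \<Longrightarrow> hs_bounded s M (g x)"
  shows "hs_bounded s ((b - a) * M) (\<lambda>k. integral {a..b} (\<lambda>x. g x k))"
proof (rule hs_boundedI)
  fix F :: "int set" assume F: "finite F"
  have M: "0 \<le> M" using g[of a] ab hs_bounded_nonneg by auto
  have i: "(\<lambda>x. (bracket s k * cmod (g x k))\<^sup>2) integrable_on {a..b}" for k
    by (intro integrable_continuous_real continuous_intros cont)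
  have "(L2_set (\<lambda>k. bracket s k * cmod (integral {a..b} (\<lambda>x. g x k))) F)\<^sup>2
      = (\<Sum>k\<in>F. (bracket s k)\<^sup>2 * (cmod (integral {a..b} (\<lambda>x. g x k)))\<^sup>2)"
    by (simp add: L2_set_def power_mult_distrib sum_nonneg)
  also have "\<dots> \<le> (\<Sum>k\<in>F. (bracket s k)\<^sup>2 * ((b - a) * integral {a..b} (\<lambda>x. (cmod (g x k))\<^sup>2)))"
    by (intro sum_mono mult_left_mono integral_square_le ab cont) auto
  also have "\<dots> = (\<Sum>k\<in>F. (b - a) * integral {a..b} (\<lambda>x. (bracket s k * cmod (g x k))\<^sup>2))"
    by (simp add: power_mult_distrib mult_ac)
  also have "\<dots> = (b - a) * integral {a..b} (\<lambda>x. \<Sum>k\<in>F. (bracket s k * cmod (g x k))\<^sup>2)"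
    by (subst integral_sum[OF F i]) (simp add: sum_distrib_left)
  also have "\<dots> \<le> (b - a) * integral {a..b} (\<lambda>x. M\<^sup>2)"
  proof (intro mult_left_mono integral_le integrable_sum F i)
    fix x assume "x \<in> {a..b}"
    from hs_boundedD[OF g[OF this] F]
    have "(L2_set (\<lambda>k. bracket s k * cmod (g x k)) F)\<^sup>2 \<le> M\<^sup>2" by (intro power_mono) auto
    then show "(\<Sum>k\<in>F. (bracket s k * cmod (g x k))\<^sup>2) \<le> M\<^sup>2"
      by (simp add: L2_set_def sum_nonneg)
  qed (use ab in auto)
  also have "\<dots> = ((b - a) * M)\<^sup>2" using ab by (simp add: power2_eq_square)
  finally show "L2_set (\<lambda>k. bracket s k * cmod (integral {a..b} (\<lambda>x. g x k))) F \<le> (b - a) * M"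
    by (rule power2_le_imp_le) (use M ab in auto)
qed

text \<open>Cauchy-Schwarz with inverse weights. The weight factor stays tied to F, because it
  becomes small for F far out; the uniform tail estimate in \<open>uniform_limit_hs_series\<close>
  rests on that.\<close>

lemma hs_bounded_sum_le:
  assumes a: "hs_bounded s M a" and F: "finite F"
  shows "(\<Sum>k\<in>F. cmod (a k)) \<le> L2_set (bracket (- s)) F * M"
proof -
  have "(\<Sum>k\<in>F. cmod (a k)) = (\<Sum>k\<in>F. \<bar>bracket (- s) k\<bar> * \<bar>bracket s k * cmod (a k)\<bar>)"
    by (intro sum.cong refl) (simp add: abs_mult bracket_minus_cancel flip: mult.assoc)
  also have "\<dots> \<le> L2_set (bracket (- s)) F * L2_set (\<lambda>k. bracket s k * cmod (a k)) F"
    by (rule L2_set_mult_ineq)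
  also have "\<dots> \<le> L2_set (bracket (- s)) F * M"
    by (intro mult_left_mono hs_boundedD[OF a F] L2_set_nonneg)
  finally show ?thesis .
qed

lemma hs_bounded_abs_summable:
  assumes "1 / 2 < s" "hs_bounded s M a"
  shows "(\<lambda>k. cmod (a k)) summable_on UNIV"
proof -
  obtain H where H: "0 \<le> H" "\<And>F. finite F \<Longrightarrow> L2_set (bracket (- s)) F \<le> H"
    using bracket_L2_bound[OF assms(1)] by blast
  have "(\<Sum>k\<in>F. cmod (a k)) \<le> H * M" if "finite F" for F
    using hs_bounded_sum_le[OF assms(2) that] H(2)[OF that] hs_bounded_nonneg[OF assms(2)]
    by (meson mult_right_mono order_trans)
  then show ?thesis
    by (intro nonneg_bdd_above_summable_on bdd_aboveI2[where M="H * M"]) auto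
qed

text \<open>For c = 1 these are the Fourier coefficients of a product. Oscillating phases and their
  Taylor remainders enter through \<open>c k j\<close>.\<close>

definition twisted_conv ::
    "(int \<Rightarrow> int \<Rightarrow> complex) \<Rightarrow> (int \<Rightarrow> complex) \<Rightarrow> (int \<Rightarrow> complex) \<Rightarrow> int \<Rightarrow> complex" where
  "twisted_conv c a b k = (\<Sum>\<^sub>\<infinity>j. c k j * a j * b (k - j))"

text \<open>The side condition for linearity in each argument, which the default value 0 of
  \<open>infsum\<close> would otherwise break.\<close>

definition twisted_summable ::
    "(int \<Rightarrow> int \<Rightarrow> complex) \<Rightarrow> (int \<Rightarrow> complex) \<Rightarrow> (int \<Rightarrow> complex) \<Rightarrow> bool" where
  "twisted_summable c a b \<longleftrightarrow> (\<forall>k. (\<lambda>j. c k j * a j * b (k - j)) summable_on UNIV)"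

section \<open>Weighted convolution estimates\<close>

lemma L2_set_sum_le:
  "finite G \<Longrightarrow> L2_set (\<lambda>k. \<Sum>j\<in>G. f j k) F \<le> (\<Sum>j\<in>G. L2_set (f j) F)"
proof (induction G rule: finite_induct)
  case empty
  then show ?case by (simp add: L2_set_def)
next
  case (insert j G)
  have "L2_set (\<lambda>k. \<Sum>j\<in>insert j G. f j k) F = L2_set (\<lambda>k. f j k + (\<Sum>j\<in>G. f j k)) F"
    using insert by simp
  also have "\<dots> \<le> L2_set (f j) F + L2_set (\<lambda>k. \<Sum>j\<in>G. f j k) F" by (rule L2_set_triangle_ineq)
  also have "\<dots> \<le> (\<Sum>j\<in>insert j G. L2_set (f j) F)" using insert by simp
  finally show ?case .
qed

lemma L2_set_reindex:
  "inj_on h F \<Longrightarrow> L2_set (\<lambda>k. f (h k)) F = L2_set f (h ` F)"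
  by (simp add: L2_set_def sum.reindex)

text \<open>Young's inequality \<open>\<ell>\<^sup>1 * \<ell>\<^sup>2 \<subseteq> \<ell>\<^sup>2\<close> with the \<open>\<ell>\<^sup>1\<close> factor split into two \<open>\<ell>\<^sup>2\<close> factors.\<close>

lemma L2_set_conv_le:
  fixes h x y :: "int \<Rightarrow> real"
  assumes nn: "\<And>k. 0 \<le> h k" "\<And>k. 0 \<le> x k" "\<And>k. 0 \<le> y k"
    and H: "\<And>F. finite F \<Longrightarrow> L2_set h F \<le> H"
    and A: "\<And>F. finite F \<Longrightarrow> L2_set x F \<le> A"
    and B: "\<And>F. finite F \<Longrightarrow> L2_set y F \<le> B"
    and F: "finite F" and G: "finite G"
  shows "L2_set (\<lambda>k. \<Sum>j\<in>G. h j * x j * y (k - j)) F \<le> H * A * B"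
proof -
  have pos: "0 \<le> H" "0 \<le> A" "0 \<le> B" using H[of "{}"] A[of "{}"] B[of "{}"] by auto
  have "L2_set (\<lambda>k. \<Sum>j\<in>G. h j * x j * y (k - j)) F
      \<le> (\<Sum>j\<in>G. L2_set (\<lambda>k. h j * x j * y (k - j)) F)"
    by (rule L2_set_sum_le[OF G])
  also have "\<dots> = (\<Sum>j\<in>G. h j * x j * L2_set (\<lambda>k. y (k - j)) F)"
    using nn by (simp add: L2_set_right_distrib)
  also have "\<dots> \<le> (\<Sum>j\<in>G. h j * x j * B)"
  proof (intro sum_mono mult_left_mono)
    fix j
    have "L2_set (\<lambda>k. y (k - j)) F = L2_set y ((\<lambda>k. k - j) ` F)"
      by (rule L2_set_reindex) (auto simp: inj_on_def)
    also have "\<dots> \<le> B" by (intro B finite_imageI F)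
    finally show "L2_set (\<lambda>k. y (k - j)) F \<le> B" .
  qed (use nn in auto)
  also have "\<dots> = (\<Sum>j\<in>G. \<bar>h j\<bar> * \<bar>x j\<bar>) * B"
    using nn by (simp add: sum_distrib_right)
  also have "\<dots> \<le> (L2_set h G * L2_set x G) * B"
    using pos by (intro mult_right_mono L2_set_mult_ineq)
  also have "\<dots> \<le> (H * A) * B"
    using pos by (intro mult_right_mono mult_mono H A G) auto
  finally show ?thesis .
qed

text \<open>Substituting i = k - j leads back to \<open>L2_set_conv_le\<close>, except that the
  image of G moves with k; nonnegativity allows enlarging it to the fixed set of all
  differences.\<close>

lemma L2_set_conv_le_swap:
  fixes h x y :: "int \<Rightarrow> real"
  assumes nn: "\<And>k. 0 \<le> h k" "\<And>k. 0 \<le> x k" "\<And>k. 0 \<le> y k"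
    and H: "\<And>F. finite F \<Longrightarrow> L2_set h F \<le> H"
    and A: "\<And>F. finite F \<Longrightarrow> L2_set x F \<le> A"
    and B: "\<And>F. finite F \<Longrightarrow> L2_set y F \<le> B"
    and F: "finite F" and G: "finite G"
  shows "L2_set (\<lambda>k. \<Sum>j\<in>G. h (k - j) * x j * y (k - j)) F \<le> H * A * B"
proof -
  define G' where "G' = (\<lambda>(k, j). k - j) ` (F \<times> G)"
  have fin: "finite G'" using F G by (simp add: G'_def)
  have "L2_set (\<lambda>k. \<Sum>j\<in>G. h (k - j) * x j * y (k - j)) F
      \<le> L2_set (\<lambda>k. \<Sum>i\<in>G'. h i * y i * x (k - i)) F"
  proof (rule L2_set_mono)
    fix k assume k: "k \<in> F"
    have "(\<Sum>j\<in>G. h (k - j) * x j * y (k - j)) = (\<Sum>i\<in>(\<lambda>j. k - j) ` G. h i * y i * x (k - i))"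
      by (subst sum.reindex) (auto simp: inj_on_def mult_ac)
    also have "\<dots> \<le> (\<Sum>i\<in>G'. h i * y i * x (k - i))"
      using k fin nn by (intro sum_mono2) (auto simp: G'_def)
    finally show "(\<Sum>j\<in>G. h (k - j) * x j * y (k - j)) \<le> (\<Sum>i\<in>G'. h i * y i * x (k - i))" .
  qed (use nn in \<open>auto intro!: sum_nonneg\<close>)
  also have "\<dots> \<le> H * B * A" by (rule L2_set_conv_le[OF nn(1,3,2) H B A F fin])
  finally show ?thesis by (simp add: mult_ac)
qed

text \<open>With the decay on the output frequency the convolution need only be bounded, which is
  Cauchy-Schwarz in j; h then supplies the square summability.\<close>

lemma L2_set_weighted_conv_le:
  fixes h x y :: "int \<Rightarrow> real"
  assumes nn: "\<And>k. 0 \<le> h k" "\<And>k. 0 \<le> x k" "\<And>k. 0 \<le> y k"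
    and H: "\<And>F. finite F \<Longrightarrow> L2_set h F \<le> H"
    and A: "\<And>F. finite F \<Longrightarrow> L2_set x F \<le> A"
    and B: "\<And>F. finite F \<Longrightarrow> L2_set y F \<le> B"
    and F: "finite F" and G: "finite G"
  shows "L2_set (\<lambda>k. \<Sum>j\<in>G. h k * x j * y (k - j)) F \<le> H * A * B"
proof -
  have pos: "0 \<le> H" "0 \<le> A" "0 \<le> B" using H[of "{}"] A[of "{}"] B[of "{}"] by auto
  have "L2_set (\<lambda>k. \<Sum>j\<in>G. h k * x j * y (k - j)) F \<le> L2_set (\<lambda>k. (A * B) * h k) F"
  proof (rule L2_set_mono)
    fix k assume k: "k \<in> F"
    have "L2_set (\<lambda>j. y (k - j)) G = L2_set y ((\<lambda>j. k - j) ` G)"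
      by (rule L2_set_reindex) (auto simp: inj_on_def)
    also have "\<dots> \<le> B" by (intro B finite_imageI G)
    finally have y: "L2_set (\<lambda>j. y (k - j)) G \<le> B" .
    have "(\<Sum>j\<in>G. h k * x j * y (k - j)) = h k * (\<Sum>j\<in>G. \<bar>x j\<bar> * \<bar>y (k - j)\<bar>)"
      using nn by (simp add: sum_distrib_left mult_ac)
    also have "\<dots> \<le> h k * (L2_set x G * L2_set (\<lambda>j. y (k - j)) G)"
      using nn by (intro mult_left_mono L2_set_mult_ineq)
    also have "\<dots> \<le> h k * (A * B)"
      using nn pos by (intro mult_left_mono mult_mono A G y) auto
    finally show "(\<Sum>j\<in>G. h k * x j * y (k - j)) \<le> (A * B) * h k" by (simp add: mult_ac)
  qed (use nn in \<open>auto intro!: sum_nonneg\<close>)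
  also have "\<dots> = (A * B) * L2_set h F" using pos by (simp add: L2_set_right_distrib)
  also have "\<dots> \<le> (A * B) * H" using pos by (intro mult_left_mono H F) auto
  finally show ?thesis by (simp add: mult_ac)
qed

text \<open>Truncated in j as well, so that it can also prove the summability of the full
  convolution. Each position of the decaying weight contributes H * A * B, whence the 3.\<close>

lemma twisted_conv_finite:
  assumes H: "\<And>F. finite F \<Longrightarrow> L2_set (bracket (- s)) F \<le> H"
    and w: "\<And>k j. bracket x k * cmod (c k j) \<le>
       K * (bracket (- s) (k - j) + bracket (- s) j + bracket (- s) k) * bracket y j * bracket z (k - j)"
    and a: "hs_bounded y A a" and b: "hs_bounded z B b" and K: "0 \<le> K"
    and F: "finite F" and G: "finite G"
  shows "L2_set (\<lambda>k. bracket x k * (\<Sum>j\<in>G. cmod (c k j * a j * b (k - j)))) F \<le> 3 * K * H * A * B"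
proof -
  define h where "h = bracket (- s)"
  define \<alpha> where "\<alpha> = (\<lambda>k. bracket y k * cmod (a k))"
  define \<beta> where "\<beta> = (\<lambda>k. bracket z k * cmod (b k))"
  have nn: "0 \<le> h k" "0 \<le> \<alpha> k" "0 \<le> \<beta> k" for k by (auto simp: h_def \<alpha>_def \<beta>_def)
  have L: "finite F \<Longrightarrow> L2_set h F \<le> H" "finite F \<Longrightarrow> L2_set \<alpha> F \<le> A"
    "finite F \<Longrightarrow> L2_set \<beta> F \<le> B" for F
    unfolding h_def \<alpha>_def \<beta>_def by (fact H hs_boundedD[OF a] hs_boundedD[OF b])+
  have "L2_set (\<lambda>k. bracket x k * (\<Sum>j\<in>G. cmod (c k j * a j * b (k - j)))) F
      \<le> L2_set (\<lambda>k. K * (((\<Sum>j\<in>G. h (k - j) * \<alpha> j * \<beta> (k - j)) + (\<Sum>j\<in>G. h j * \<alpha> j * \<beta> (k - j)))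
            + (\<Sum>j\<in>G. h k * \<alpha> j * \<beta> (k - j)))) F"
  proof (rule L2_set_mono)
    fix k
    have "bracket x k * (\<Sum>j\<in>G. cmod (c k j * a j * b (k - j)))
        = (\<Sum>j\<in>G. (bracket x k * cmod (c k j)) * (cmod (a j) * cmod (b (k - j))))"
      by (simp add: sum_distrib_left norm_mult mult_ac)
    also have "\<dots> \<le> (\<Sum>j\<in>G. (K * (h (k - j) + h j + h k) * bracket y j * bracket z (k - j))
        * (cmod (a j) * cmod (b (k - j))))"
      unfolding h_def by (intro sum_mono mult_right_mono w) auto
    also have "\<dots> = K * (((\<Sum>j\<in>G. h (k - j) * \<alpha> j * \<beta> (k - j)) + (\<Sum>j\<in>G. h j * \<alpha> j * \<beta> (k - j)))
            + (\<Sum>j\<in>G. h k * \<alpha> j * \<beta> (k - j)))"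
      by (simp add: sum_distrib_left \<alpha>_def \<beta>_def algebra_simps flip: sum.distrib)
    finally show "bracket x k * (\<Sum>j\<in>G. cmod (c k j * a j * b (k - j))) \<le> \<dots>" .
  qed (auto intro!: mult_nonneg_nonneg sum_nonneg)
  also have "\<dots> = K * L2_set (\<lambda>k. ((\<Sum>j\<in>G. h (k - j) * \<alpha> j * \<beta> (k - j)) + (\<Sum>j\<in>G. h j * \<alpha> j * \<beta> (k - j)))
            + (\<Sum>j\<in>G. h k * \<alpha> j * \<beta> (k - j))) F"
    using K by (simp add: L2_set_right_distrib)
  also have "\<dots> \<le> K * ((H * A * B + H * A * B) + H * A * B)"
    by (intro mult_left_mono K order_trans[OF L2_set_triangle_ineq] add_mono
        L2_set_conv_le_swap[OF nn L F G] L2_set_conv_le[OF nn L F G]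
        L2_set_weighted_conv_le[OF nn L F G])
  finally show ?thesis by (simp add: algebra_simps)
qed

lemma twisted_conv_bound:
  assumes H: "\<And>F. finite F \<Longrightarrow> L2_set (bracket (- s)) F \<le> H"
    and w: "\<And>k j. bracket x k * cmod (c k j) \<le>
       K * (bracket (- s) (k - j) + bracket (- s) j + bracket (- s) k) * bracket y j * bracket z (k - j)"
    and a: "hs_bounded y A a" and b: "hs_bounded z B b" and K: "0 \<le> K"
  shows "twisted_summable c a b" and "hs_bounded x (3 * K * H * A * B) (twisted_conv c a b)"
proof -
  have fin: "L2_set (\<lambda>k. bracket x k * (\<Sum>j\<in>G. cmod (c k j * a j * b (k - j)))) F \<le> 3 * K * H * A * B"
    if "finite F" "finite G" for F G by (rule twisted_conv_finite[OF H w a b K that])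
  \<comment> \<open>The single output frequency F = {k} bounds all partial sums in j.\<close>
  have sm: "(\<lambda>j. cmod (c k j * a j * b (k - j))) summable_on UNIV" for k
  proof (intro nonneg_bdd_above_summable_on bdd_aboveI2[where M="3 * K * H * A * B / bracket x k"])
    fix G :: "int set" assume "G \<in> {F. F \<subseteq> UNIV \<and> finite F}"
    then have G: "finite G" by simp
    have "bracket x k * (\<Sum>j\<in>G. cmod (c k j * a j * b (k - j))) \<le> 3 * K * H * A * B"
      using fin[of "{k}" G] G by (simp add: sum_nonneg)
    then show "(\<Sum>j\<in>G. cmod (c k j * a j * b (k - j))) \<le> 3 * K * H * A * B / bracket x k"
      by (simp add: pos_le_divide_eq mult.commute)
  qed auto
  show "twisted_summable c a b"
    unfolding twisted_summable_def using sm by (auto intro: abs_summable_summable)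
  show "hs_bounded x (3 * K * H * A * B) (twisted_conv c a b)"
  proof (rule hs_boundedI)
    fix F :: "int set" assume F: "finite F"
    \<comment> \<open>Only finitely many output frequencies enter the norm, so the truncated bound
      survives the limit in G.\<close>
    have lim: "((\<lambda>G. \<Sum>j\<in>G. cmod (c k j * a j * b (k - j))) \<longlongrightarrow>
        (\<Sum>\<^sub>\<infinity>j. cmod (c k j * a j * b (k - j)))) (finite_subsets_at_top UNIV)" for k
      using infsum_tendsto[OF sm] .
    have "((\<lambda>G. L2_set (\<lambda>k. bracket x k * (\<Sum>j\<in>G. cmod (c k j * a j * b (k - j)))) F) \<longlongrightarrow>
        L2_set (\<lambda>k. bracket x k * (\<Sum>\<^sub>\<infinity>j. cmod (c k j * a j * b (k - j)))) F)
        (finite_subsets_at_top UNIV)"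
      unfolding L2_set_def by (intro tendsto_intros lim)
    then have "L2_set (\<lambda>k. bracket x k * (\<Sum>\<^sub>\<infinity>j. cmod (c k j * a j * b (k - j)))) F \<le> 3 * K * H * A * B"
      by (rule tendsto_upperbound)
         (auto intro!: eventually_finite_subsets_at_top_weakI fin F)
    moreover have "L2_set (\<lambda>k. bracket x k * cmod (twisted_conv c a b k)) F
        \<le> L2_set (\<lambda>k. bracket x k * (\<Sum>\<^sub>\<infinity>j. cmod (c k j * a j * b (k - j)))) F"
      unfolding twisted_conv_def
      by (intro L2_set_mono mult_left_mono norm_infsum_bound sm) auto
    ultimately show "L2_set (\<lambda>k. bracket x k * cmod (twisted_conv c a b k)) F \<le> 3 * K * H * A * B"
      by linarith
  qed
qed

text \<open>The constant is fixed before q and c. Time and \<epsilon> later enter through bounded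
  coefficients only, which makes the resulting estimates uniform in both.\<close>

lemma twisted_conv_bounded_estimate:
  assumes "1 / 2 < s"
  shows "\<exists>C\<ge>1. \<forall>q c D A B a b. \<bar>q\<bar> \<le> s \<longrightarrow> (\<forall>k j. cmod (c k j) \<le> D) \<longrightarrow>
    hs_bounded q A a \<longrightarrow> hs_bounded s B b \<longrightarrow>
    twisted_summable c a b \<and> hs_bounded q (C * D * A * B) (twisted_conv c a b)"
proof -
  obtain H where H: "0 \<le> H" "\<And>F. finite F \<Longrightarrow> L2_set (bracket (- s)) F \<le> H"
    using bracket_L2_bound[OF assms] by blast
  define C where "C = max 1 (3 * 2 powr s * H)"
  show ?thesis
  proof (intro exI[of _ C] conjI allI impI)
    fix q D A B :: real and c :: "int \<Rightarrow> int \<Rightarrow> complex" and a b :: "int \<Rightarrow> complex"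
    assume q: "\<bar>q\<bar> \<le> s" and c: "\<forall>k j. cmod (c k j) \<le> D"
      and ab: "hs_bounded q A a" "hs_bounded s B b"
    have D: "0 \<le> D" using c norm_ge_zero order_trans by blast
    have w: "bracket q k * cmod (c k j) \<le> (D * 2 powr s) *
        (bracket (- s) (k - j) + bracket (- s) j + bracket (- s) k) * bracket q j * bracket s (k - j)" for k j
    proof -
      have "bracket q k * cmod (c k j) \<le> (2 powr s *
        (bracket (- s) (k - j) + bracket (- s) j + bracket (- s) k) * bracket q j * bracket s (k - j)) * D"
        using c q by (intro mult_mono bracket_trilinear) (auto intro!: mult_nonneg_nonneg add_nonneg_nonneg)
      then show ?thesis by (simp only: mult_ac)
    qed
    have K: "0 \<le> D * 2 powr s" using D by simp
    show "twisted_summable c a b" by (rule twisted_conv_bound(1)[OF H(2) w ab K])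
    have *: "hs_bounded q (3 * (D * 2 powr s) * H * A * B) (twisted_conv c a b)"
      by (rule twisted_conv_bound(2)[OF H(2) w ab K])
    have "3 * (D * 2 powr s) * H * A * B = (3 * 2 powr s * H) * (D * A * B)" by simp
    also have "\<dots> \<le> C * (D * A * B)"
      using D hs_bounded_nonneg[OF ab(1)] hs_bounded_nonneg[OF ab(2)]
      by (intro mult_right_mono) (simp_all add: C_def)
    finally have "3 * (D * 2 powr s) * H * A * B \<le> C * D * A * B" by (simp only: mult.assoc)
    then show "hs_bounded q (C * D * A * B) (twisted_conv c a b)" by (rule hs_bounded_mono[OF *])
  qed (simp add: C_def)
qed

text \<open>Growth of c at j is absorbed by the regularity of a, growth at k - j by that of b. The
  two contributions are exchanged by j -> k - j, so the constant is twice the one for bounded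
  coefficients.\<close>

lemma twisted_conv_weighted_estimate:
  assumes "1 / 2 < s"
  shows "\<exists>C\<ge>1. \<forall>\<mu> c D A B a b. \<bar>s - \<mu>\<bar> \<le> s \<longrightarrow>
    (\<forall>k j. cmod (c k j) \<le> D * (bracket \<mu> j + bracket \<mu> (k - j))) \<longrightarrow> 0 \<le> D \<longrightarrow>
    hs_bounded s A a \<longrightarrow> hs_bounded s B b \<longrightarrow>
    twisted_summable c a b \<and> hs_bounded (s - \<mu>) (C * D * A * B) (twisted_conv c a b)"
proof -
  obtain H where H: "0 \<le> H" "\<And>F. finite F \<Longrightarrow> L2_set (bracket (- s)) F \<le> H"
    using bracket_L2_bound[OF assms] by blast
  define C where "C = max 1 (6 * 2 powr s * H)"
  show ?thesis
  proof (intro exI[of _ C] conjI allI impI)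
    fix \<mu> D A B :: real and c :: "int \<Rightarrow> int \<Rightarrow> complex" and a b :: "int \<Rightarrow> complex"
    assume q: "\<bar>s - \<mu>\<bar> \<le> s" and c: "\<forall>k j. cmod (c k j) \<le> D * (bracket \<mu> j + bracket \<mu> (k - j))"
      and D: "0 \<le> D" and ab: "hs_bounded s A a" "hs_bounded s B b"
    have w: "bracket (s - \<mu>) k * cmod (c k j) \<le> (2 * D * 2 powr s) *
        (bracket (- s) (k - j) + bracket (- s) j + bracket (- s) k) * bracket s j * bracket s (k - j)" for k j
    proof -
      define S where "S = bracket (- s) (k - j) + bracket (- s) j + bracket (- s) k"
      have s: "bracket s n = bracket (s - \<mu>) n * bracket \<mu> n" for n
        by (simp flip: bracket_add)
      have "bracket (s - \<mu>) k * bracket \<mu> j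
          \<le> (2 powr s * S * bracket (s - \<mu>) j * bracket s (k - j)) * bracket \<mu> j"
        unfolding S_def by (intro mult_right_mono bracket_trilinear q) simp
      moreover have "bracket (s - \<mu>) k * bracket \<mu> (k - j)
          \<le> (2 powr s * S * bracket (s - \<mu>) (k - j) * bracket s j) * bracket \<mu> (k - j)"
        using bracket_trilinear[OF q, of k "k - j"] unfolding S_def
        by (intro mult_right_mono) (simp_all add: add_ac)
      ultimately have "bracket (s - \<mu>) k * (bracket \<mu> j + bracket \<mu> (k - j))
          \<le> 2 * (2 powr s * S * bracket s j * bracket s (k - j))"
        unfolding s[of j] s[of "k - j"] by (simp only: distrib_left mult_ac)
      then have "D * (bracket (s - \<mu>) k * (bracket \<mu> j + bracket \<mu> (k - j)))
          \<le> D * (2 * (2 powr s * S * bracket s j * bracket s (k - j)))"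
        using D by (rule mult_left_mono)
      moreover have "bracket (s - \<mu>) k * cmod (c k j)
          \<le> bracket (s - \<mu>) k * (D * (bracket \<mu> j + bracket \<mu> (k - j)))"
        using c by (intro mult_left_mono) auto
      ultimately have "bracket (s - \<mu>) k * cmod (c k j)
          \<le> D * (2 * (2 powr s * S * bracket s j * bracket s (k - j)))"
        by (simp only: mult.left_commute)
      then show ?thesis unfolding S_def by (simp only: mult_ac)
    qed
    have K: "0 \<le> 2 * D * 2 powr s" using D by simp
    show "twisted_summable c a b" by (rule twisted_conv_bound(1)[OF H(2) w ab K])
    have *: "hs_bounded (s - \<mu>) (3 * (2 * D * 2 powr s) * H * A * B) (twisted_conv c a b)"
      by (rule twisted_conv_bound(2)[OF H(2) w ab K])
    have "3 * (2 * D * 2 powr s) * H * A * B = (6 * 2 powr s * H) * (D * A * B)" by simp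
    also have "\<dots> \<le> C * (D * A * B)"
      using D hs_bounded_nonneg[OF ab(1)] hs_bounded_nonneg[OF ab(2)]
      by (intro mult_right_mono) (simp_all add: C_def)
    finally have "3 * (2 * D * 2 powr s) * H * A * B \<le> C * D * A * B" by (simp only: mult.assoc)
    then show "hs_bounded (s - \<mu>) (C * D * A * B) (twisted_conv c a b)" by (rule hs_bounded_mono[OF *])
  qed (simp add: C_def)
qed

section \<open>Linearity, symmetry and uniform convergence\<close>

lemma summable_on_minus:
  fixes f g :: "'a \<Rightarrow> complex"
  assumes "f summable_on A" "g summable_on A"
  shows "(\<lambda>x. f x - g x) summable_on A"
  using summable_on_add[OF assms(1) summable_on_uminus[THEN iffD2, OF assms(2)]] by simp

lemma infsum_minus:
  fixes f g :: "'a \<Rightarrow> complex"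
  assumes "f summable_on A" "g summable_on A"
  shows "(\<Sum>\<^sub>\<infinity>x\<in>A. f x - g x) = infsum f A - infsum g A"
  using infsum_add[OF assms(1) summable_on_uminus[THEN iffD2, OF assms(2)]] by (simp add: infsum_uminus)

lemma twisted_conv_add_left:
  "twisted_summable c a b \<Longrightarrow> twisted_summable c a' b \<Longrightarrow>
    twisted_conv c (\<lambda>k. a k + a' k) b k = twisted_conv c a b k + twisted_conv c a' b k"
  unfolding twisted_conv_def twisted_summable_def
  by (simp add: algebra_simps infsum_add)

lemma twisted_conv_diff_left:
  "twisted_summable c a b \<Longrightarrow> twisted_summable c a' b \<Longrightarrow>
    twisted_conv c (\<lambda>k. a k - a' k) b k = twisted_conv c a b k - twisted_conv c a' b k"
  unfolding twisted_conv_def twisted_summable_def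
  by (simp add: algebra_simps infsum_minus)

lemma twisted_conv_scale_left:
  "twisted_conv c (\<lambda>k. z * a k) b k = z * twisted_conv c a b k"
  unfolding twisted_conv_def by (simp add: mult_ac flip: infsum_cmult_right')

lemma twisted_conv_diff_coeff:
  "twisted_summable c a b \<Longrightarrow> twisted_summable d a b \<Longrightarrow>
    twisted_conv (\<lambda>k j. c k j - d k j) a b k = twisted_conv c a b k - twisted_conv d a b k"
  unfolding twisted_conv_def twisted_summable_def
  by (simp add: algebra_simps infsum_minus)

lemma twisted_conv_scale_coeff:
  "twisted_conv (\<lambda>k j. z * c k j) a b k = z * twisted_conv c a b k"
  unfolding twisted_conv_def by (simp add: mult_ac flip: infsum_cmult_right')

lemma twisted_summable_scale_coeff:
  "twisted_summable c a b \<Longrightarrow> twisted_summable (\<lambda>k j. z * c k j) a b"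
  unfolding twisted_summable_def by (simp add: mult.assoc summable_on_cmult_right)

lemma twisted_summable_diff_coeff:
  "twisted_summable c a b \<Longrightarrow> twisted_summable d a b \<Longrightarrow>
    twisted_summable (\<lambda>k j. c k j - d k j) a b"
  unfolding twisted_summable_def by (simp add: left_diff_distrib summable_on_minus)

lemma twisted_conv_commute:
  assumes "\<And>k j. c k (k - j) = c k j"
  shows "twisted_conv c a b = twisted_conv c b a"
proof
  fix k
  have "(\<Sum>\<^sub>\<infinity>j. c k j * a j * b (k - j)) = (\<Sum>\<^sub>\<infinity>j. c k (k - j) * a (k - j) * b (k - (k - j)))"
    by (rule infsum_reindex_bij_betw[symmetric], rule bij_betwI[where g="\<lambda>j. k - j"]) auto
  then show "twisted_conv c a b k = twisted_conv c b a k"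
    by (simp add: twisted_conv_def assms mult_ac)
qed

text \<open>For s <= 1 the pointwise bound \<open>M * bracket (- s) k\<close> on the coefficients is
  not summable, so the Weierstrass test does not apply with it. Cauchy-Schwarz instead controls all
  tails at once by the tail of the squared weights.\<close>

lemma uniform_limit_hs_series:
  fixes f :: "int \<Rightarrow> 'x \<Rightarrow> complex"
  assumes s: "1 / 2 < s" and a: "\<And>x. x \<in> X \<Longrightarrow> hs_bounded s M (a x)"
    and f: "\<And>x k. x \<in> X \<Longrightarrow> cmod (f k x) \<le> D * cmod (a x k)" and D: "0 \<le> D"
  shows "uniform_limit X (\<lambda>F x. \<Sum>k\<in>F. f k x) (\<lambda>x. \<Sum>\<^sub>\<infinity>k. f k x) (finite_subsets_at_top UNIV)"
proof (cases "X = {}")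
  case False
  then have M: "0 \<le> M" using a hs_bounded_nonneg by blast
  show ?thesis
  proof (rule uniform_limitI)
    fix e :: real assume e: "0 < e"
    \<comment> \<open>The 1 guards against D * M = 0, the 2 makes the final inequality
      strict.\<close>
    define d where "d = e / (2 * (D * M + 1))"
    have DM: "0 < D * M + 1" using D M by (simp add: add_nonneg_pos)
    then have d: "0 < d" using e by (simp add: d_def)
    have "D * M * d \<le> (D * M + 1) * d" using d by (intro mult_right_mono) auto
    also have "\<dots> = e / 2" using DM unfolding d_def
      by (metis divide_divide_eq_left mult.commute nonzero_mult_div_cancel_left order_less_irrefl
          times_divide_eq_right)
    finally have dle: "D * M * d < e" using e by linarith
    define S where "S = (\<Sum>\<^sub>\<infinity>k. (bracket (- s) k)\<^sup>2)"
    have "((\<lambda>F. \<Sum>k\<in>F. (bracket (- s) k)\<^sup>2) \<longlongrightarrow> S) (finite_subsets_at_top UNIV)"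
      unfolding S_def by (rule infsum_tendsto[OF bracket_square_summable[OF s]])
    then have "\<forall>\<^sub>F F in finite_subsets_at_top UNIV. S - d\<^sup>2 < (\<Sum>k\<in>F. (bracket (- s) k)\<^sup>2)"
      by (rule order_tendstoD) (use d in simp)
    then obtain F0 where F0: "finite F0" "\<And>F. finite F \<Longrightarrow> F0 \<subseteq> F \<Longrightarrow> S - d\<^sup>2 < (\<Sum>k\<in>F. (bracket (- s) k)\<^sup>2)"
      unfolding eventually_finite_subsets_at_top by auto
    have tail: "L2_set (bracket (- s)) G \<le> d" if F: "finite F" "F0 \<subseteq> F" and G: "finite G" "G \<inter> F = {}" for F G
    proof -
      have "(\<Sum>k\<in>F \<union> G. (bracket (- s) k)\<^sup>2) \<le> S"
        unfolding S_def by (intro finite_sum_le_infsum bracket_square_summable s) (use F G in auto)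
      moreover have "(\<Sum>k\<in>F \<union> G. (bracket (- s) k)\<^sup>2)
          = (\<Sum>k\<in>F. (bracket (- s) k)\<^sup>2) + (\<Sum>k\<in>G. (bracket (- s) k)\<^sup>2)"
        using F G by (intro sum.union_disjoint) auto
      ultimately have "(\<Sum>k\<in>G. (bracket (- s) k)\<^sup>2) \<le> d\<^sup>2" using F0(2)[OF F] by linarith
      then show ?thesis unfolding L2_set_def using d real_le_lsqrt by (simp add: sum_nonneg)
    qed
    have "dist (\<Sum>k\<in>F. f k x) (\<Sum>\<^sub>\<infinity>k. f k x) < e"
      if F: "finite F" "F0 \<subseteq> F" and x: "x \<in> X" for F x
    proof -
      have "(\<lambda>k. D * cmod (a x k)) summable_on UNIV"
        by (intro summable_on_cmult_right hs_bounded_abs_summable[OF s a] x)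
      then have sn: "(\<lambda>k. cmod (f k x)) summable_on UNIV"
        by (rule summable_on_comparison_test) (use f x in auto)
      then have sf: "(\<lambda>k. f k x) summable_on UNIV" by (rule abs_summable_summable)
      have eq: "(\<Sum>\<^sub>\<infinity>k. f k x) - (\<Sum>k\<in>F. f k x) = (\<Sum>\<^sub>\<infinity>k\<in>UNIV - F. f k x)"
        using infsum_Diff[OF sf, of F] F by simp
      have "cmod (\<Sum>\<^sub>\<infinity>k\<in>UNIV - F. f k x) \<le> (\<Sum>\<^sub>\<infinity>k\<in>UNIV - F. cmod (f k x))"
        by (rule norm_infsum_bound) (rule summable_on_subset_banach[OF sn], simp)
      moreover have "(\<Sum>\<^sub>\<infinity>k\<in>UNIV - F. cmod (f k x)) \<le> D * M * d"
      proof (rule infsum_le_finite_sums)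
        show "(\<lambda>k. cmod (f k x)) summable_on (UNIV - F)"
          by (rule summable_on_subset_banach[OF sn]) simp
        fix G :: "int set" assume G: "finite G" "G \<subseteq> UNIV - F"
        have "(\<Sum>k\<in>G. cmod (f k x)) \<le> D * (\<Sum>k\<in>G. cmod (a x k))"
          unfolding sum_distrib_left by (intro sum_mono f x)
        also have "\<dots> \<le> D * (d * M)"
        proof (rule mult_left_mono[OF order_trans D])
          show "(\<Sum>k\<in>G. cmod (a x k)) \<le> L2_set (bracket (- s)) G * M"
            by (rule hs_bounded_sum_le[OF a[OF x] G(1)])
          show "L2_set (bracket (- s)) G * M \<le> d * M"
            using tail[OF F] G M by (intro mult_right_mono) auto
        qed
        finally show "(\<Sum>k\<in>G. cmod (f k x)) \<le> D * M * d" by (simp only: mult_ac)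
      qed
      ultimately have "cmod ((\<Sum>\<^sub>\<infinity>k. f k x) - (\<Sum>k\<in>F. f k x)) < e" unfolding eq using dle by linarith
      then show ?thesis unfolding dist_norm by (subst norm_minus_commute)
    qed
    then show "\<forall>\<^sub>F F in finite_subsets_at_top UNIV. \<forall>x\<in>X. dist (\<Sum>k\<in>F. f k x) (\<Sum>\<^sub>\<infinity>k. f k x) < e"
      unfolding eventually_finite_subsets_at_top using F0(1) by blast
  qed
qed (simp add: uniform_limit_iff)

section \<open>The splitting scheme in the interaction picture\<close>

lemma cis_taylor_0: "cmod (cis x - cis y) \<le> \<bar>x - y\<bar>"
proof -
  have "cmod (exp (\<i> * of_real x) - exp (\<i> * of_real y)) \<le> 1 * cmod (of_real x - of_real y :: complex)"
  proof (rule field_differentiable_bound[OF convex_closed_segment])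
    fix z :: complex assume "z \<in> closed_segment (of_real y) (of_real x)"
    then obtain w where w: "z = of_real w" by (auto simp: closed_segment_of_real)
    show "((\<lambda>z. exp (\<i> * z)) has_field_derivative \<i> * exp (\<i> * z))
        (at z within closed_segment (of_real y) (of_real x))"
      by (auto intro!: derivative_eq_intros)
    show "cmod (\<i> * exp (\<i> * z)) \<le> 1" by (simp add: w norm_mult)
  qed auto
  then show ?thesis by (simp add: cis_conv_exp flip: of_real_diff)
qed

text \<open>The derivative of the remainder is controlled by \<open>cis_taylor_0\<close>, and the
  mean value inequality adds the second factor; the sharp constant 1/2 is given up.\<close>

lemma cis_taylor_1: "cmod (cis x - cis y - (x - y) * (\<i> * cis y)) \<le> (x - y)\<^sup>2"
proof -
  define f where "f z = exp (\<i> * z) - exp (\<i> * of_real y) - (z - of_real y) * (\<i> * exp (\<i> * of_real y))" for z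
  have "cmod (f (of_real x) - f (of_real y)) \<le> \<bar>x - y\<bar> * cmod (of_real x - of_real y :: complex)"
  proof (rule field_differentiable_bound[OF convex_closed_segment])
    fix z :: complex assume z: "z \<in> closed_segment (of_real y) (of_real x)"
    then obtain w where w: "z = of_real w" "w \<in> closed_segment y x" by (auto simp: closed_segment_of_real)
    show "(f has_field_derivative \<i> * exp (\<i> * z) - \<i> * exp (\<i> * of_real y))
        (at z within closed_segment (of_real y) (of_real x))"
      unfolding f_def by (auto intro!: derivative_eq_intros)
    have "cmod (\<i> * exp (\<i> * z) - \<i> * exp (\<i> * of_real y)) = cmod (cis w - cis y)"
      by (simp add: w cis_conv_exp norm_mult flip: right_diff_distrib)
    also have "\<dots> \<le> \<bar>x - y\<bar>"
      using cis_taylor_0[of w y] w(2) by (auto simp: closed_segment_eq_real_ivl split: if_splits)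
    finally show "cmod (\<i> * exp (\<i> * z) - \<i> * exp (\<i> * of_real y)) \<le> \<bar>x - y\<bar>" .
  qed auto
  then show ?thesis
    by (simp add: f_def cis_conv_exp power2_eq_square abs_mult_self_eq flip: of_real_diff)
qed

text \<open>Interpolates between the Lipschitz bound and the trivial bound 2, so that only a
  fractional power of the phase has to be paid for in derivatives.\<close>

lemma cis_diff_powr:
  assumes "0 \<le> \<theta>" "\<theta> \<le> 1"
  shows "cmod (cis x - cis y) \<le> 2 * \<bar>x - y\<bar> powr \<theta>"
proof (cases "\<bar>x - y\<bar> \<le> 1")
  case True
  have "\<bar>x - y\<bar> \<le> \<bar>x - y\<bar> powr \<theta>"
    using powr_mono'[of \<theta> 1 "\<bar>x - y\<bar>"] True assms by (cases "x = y") auto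
  then show ?thesis using cis_taylor_0[of x y] by (smt (verit) powr_ge_zero)
next
  case False
  have "cmod (cis x - cis y) \<le> 2" using norm_triangle_ineq4[of "cis x" "cis y"] by simp
  moreover have "1 \<le> \<bar>x - y\<bar> powr \<theta>" using False assms by (intro ge_one_powr_ge_zero) auto
  ultimately show ?thesis by linarith
qed

text \<open>Regularities: \<open>s\<close> of the exact solution, \<open>\<rho>\<close> of the iterates, \<open>r\<close> of the error estimate, and
  \<open>q\<close> of the local error before the gain from \<open>\<beta>\<close>.\<close>

locale splitting =
  fixes C s q r \<rho> \<theta> \<kappa> :: real and \<phi> :: "int \<Rightarrow> int \<Rightarrow> real" and \<beta> :: "int \<Rightarrow> complex"
  assumes C: "1 \<le> C"
    and exps: "q \<le> s" "r \<le> \<rho>" "\<rho> \<le> s" "0 \<le> \<theta>" "\<theta> \<le> 1" "0 \<le> \<kappa>"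
    and phi_sym: "\<phi> k (k - j) = \<phi> k j"
    and beta_le: "cmod (\<beta> k) \<le> 1"
    and beta_gain: "hs_bounded q A a \<Longrightarrow> hs_bounded r (\<kappa> * A) (\<lambda>k. \<beta> k * a k)"
    and conv_s: "x = s \<or> x = q \<Longrightarrow> (\<And>k j. cmod (c k j) \<le> D) \<Longrightarrow>
      hs_bounded x A a \<Longrightarrow> hs_bounded s B b \<Longrightarrow> hs_bounded x (C * D * A * B) (twisted_conv c a b)"
    and conv_\<rho>: "x = r \<or> x = \<rho> \<Longrightarrow> (\<And>k j. cmod (c k j) \<le> D) \<Longrightarrow>
      hs_bounded x A a \<Longrightarrow> hs_bounded \<rho> B b \<Longrightarrow> hs_bounded x (C * D * A * B) (twisted_conv c a b)"
    and conv_summable: "(\<And>k j. cmod (c k j) \<le> D) \<Longrightarrow>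
      hs_bounded \<rho> A a \<Longrightarrow> hs_bounded \<rho> B b \<Longrightarrow> twisted_summable c a b"
    and conv_phase: "0 \<le> D \<Longrightarrow> (\<And>k j. cmod (c k j) \<le> D * \<bar>\<phi> k j\<bar>) \<Longrightarrow>
      hs_bounded s A a \<Longrightarrow> hs_bounded s B b \<Longrightarrow>
      twisted_summable c a b \<and> hs_bounded q (C * D * A * B) (twisted_conv c a b)"
    and conv_phase2: "0 \<le> D \<Longrightarrow> (\<And>k j. cmod (c k j) \<le> D * (\<phi> k j)\<^sup>2) \<Longrightarrow>
      hs_bounded s A a \<Longrightarrow> hs_bounded s B b \<Longrightarrow> hs_bounded q (C * D * A * B) (twisted_conv c a b)"
    and conv_phase\<theta>: "0 \<le> D \<Longrightarrow> (\<And>k j. cmod (c k j) \<le> D * \<bar>\<phi> k j\<bar> powr \<theta>) \<Longrightarrow>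
      hs_bounded s A a \<Longrightarrow> hs_bounded s B b \<Longrightarrow> hs_bounded \<rho> (C * D * A * B) (twisted_conv c a b)"
begin

definition nl :: "real \<Rightarrow> (int \<Rightarrow> complex) \<Rightarrow> (int \<Rightarrow> complex) \<Rightarrow> int \<Rightarrow> complex" where
  "nl t = twisted_conv (\<lambda>k j. cis (t * \<phi> k j))"

text \<open>Taylor polynomial of the solution of a' = - \<beta> \<open>nl m a a\<close> with time
  frozen at m. By symmetry a'' = 2 \<beta> \<open>nl m a\<close> (\<beta> \<open>nl m a a\<close>),
  hence the coefficient h^2 instead of h^2 / 2.\<close>

definition step :: "real \<Rightarrow> real \<Rightarrow> (int \<Rightarrow> complex) \<Rightarrow> int \<Rightarrow> complex" where
  "step h m a k = a k - h * (\<beta> k * nl m a a k) + h\<^sup>2 * (\<beta> k * nl m a (\<lambda>j. \<beta> j * nl m a a j) k)"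

lemma nl_commute: "nl t a b = nl t b a"
  unfolding nl_def by (rule twisted_conv_commute) (simp add: phi_sym)

lemma nl_bound_s: "x = s \<or> x = q \<Longrightarrow> hs_bounded x A a \<Longrightarrow> hs_bounded s B b \<Longrightarrow>
    hs_bounded x (C * A * B) (nl t a b)"
  unfolding nl_def using conv_s[of x "\<lambda>k j. cis (t * \<phi> k j)" 1 A a B b] by simp

lemma nl_bound_\<rho>: "x = r \<or> x = \<rho> \<Longrightarrow> hs_bounded x A a \<Longrightarrow> hs_bounded \<rho> B b \<Longrightarrow>
    hs_bounded x (C * A * B) (nl t a b)"
  unfolding nl_def using conv_\<rho>[of x "\<lambda>k j. cis (t * \<phi> k j)" 1 A a B b] by simp

lemma nl_summable: "hs_bounded \<rho> A a \<Longrightarrow> hs_bounded \<rho> B b \<Longrightarrow>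
    twisted_summable (\<lambda>k j. cis (t * \<phi> k j)) a b"
  by (rule conv_summable[where D=1]) auto

lemma nl_add_left:
  "hs_bounded \<rho> A a \<Longrightarrow> hs_bounded \<rho> A' a' \<Longrightarrow> hs_bounded \<rho> B b \<Longrightarrow>
    nl t (\<lambda>k. a k + a' k) b k = nl t a b k + nl t a' b k"
  unfolding nl_def by (intro twisted_conv_add_left nl_summable)

lemma nl_diff_left:
  "hs_bounded \<rho> A a \<Longrightarrow> hs_bounded \<rho> A' a' \<Longrightarrow> hs_bounded \<rho> B b \<Longrightarrow>
    nl t (\<lambda>k. a k - a' k) b k = nl t a b k - nl t a' b k"
  unfolding nl_def by (intro twisted_conv_diff_left nl_summable)

lemma nl_scale_left: "nl t (\<lambda>k. z * a k) b k = z * nl t a b k"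
  unfolding nl_def by (rule twisted_conv_scale_left)

text \<open>The cross terms cancel because \<open>nl\<close> is symmetric. The difference is
  isolated in one factor and may then be measured in a weaker norm than the other factor.\<close>

lemma nl_square_diff:
  assumes "hs_bounded \<rho> A a" "hs_bounded \<rho> B b"
  shows "nl t a a k - nl t b b k = nl t (\<lambda>k. a k - b k) (\<lambda>k. a k + b k) k"
proof -
  note ab = hs_bounded_add[OF assms]
  have "nl t (\<lambda>k. a k - b k) (\<lambda>k. a k + b k) k
      = nl t (\<lambda>k. a k + b k) a k - nl t (\<lambda>k. a k + b k) b k"
    by (subst nl_diff_left[OF assms ab]) (simp add: nl_commute)
  also have "\<dots> = nl t a a k - nl t b b k"
    by (simp add: nl_add_left[OF assms assms(1)] nl_add_left[OF assms assms(2)] nl_commute[of t b a])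
  finally show ?thesis by simp
qed

lemma beta_bounded: "hs_bounded x A a \<Longrightarrow> hs_bounded x A (\<lambda>k. \<beta> k * a k)"
  using hs_bounded_multiplier_le[of x A a \<beta> 1] beta_le by simp

text \<open>The sizes of a and b enter only in order \<rho>, while their difference may be measured
  in order r. The quadratic term contributes 2 C N h, the cubic one 3 C^2 N^2 h^2, and h <= 1 merges
  the two.\<close>

lemma step_stable:
  assumes x: "x = r \<or> x = \<rho>" and d: "hs_bounded x X (\<lambda>k. a k - b k)"
    and a: "hs_bounded \<rho> N a" and b: "hs_bounded \<rho> N b" and h: "0 \<le> h" "h \<le> 1"
  shows "hs_bounded x ((1 + (2 * C * N + 3 * C\<^sup>2 * N\<^sup>2) * h) * X) (\<lambda>k. step h m a k - step h m b k)"
proof -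
  define ba where "ba = (\<lambda>j. \<beta> j * nl m a a j)"
  define bb where "bb = (\<lambda>j. \<beta> j * nl m b b j)"
  define bd where "bd = (\<lambda>j. \<beta> j * nl m (\<lambda>k. a k - b k) (\<lambda>k. a k + b k) j)"
  have N: "0 \<le> N" and X: "0 \<le> X" using a d hs_bounded_nonneg by auto
  have ba: "hs_bounded \<rho> (C * N * N) ba" and bb: "hs_bounded \<rho> (C * N * N) bb"
    unfolding ba_def bb_def by (intro beta_bounded nl_bound_\<rho> a b disjI2 refl)+
  have bd: "hs_bounded x (C * X * (N + N)) bd"
    unfolding bd_def by (intro beta_bounded nl_bound_\<rho>[OF x d] hs_bounded_add a b)
  have bd_eq: "bd = (\<lambda>j. ba j - bb j)"
    unfolding bd_def ba_def bb_def by (simp add: nl_square_diff[OF a b, symmetric] right_diff_distrib)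
  have eq2: "nl m a ba k - nl m b bb k = nl m (\<lambda>k. a k - b k) ba k + nl m bd b k" for k
    unfolding bd_eq nl_diff_left[OF a b ba] nl_diff_left[OF ba bb b]
    by (simp add: nl_commute[of m b])
  have ba_k: "\<beta> k * nl m a a k = ba k" and bb_k: "\<beta> k * nl m b b k = bb k" for k
    by (simp_all add: ba_def bb_def)
  have bd_k: "bd k = ba k - bb k" for k by (simp add: bd_eq)
  have eq: "step h m a k - step h m b k = (a k - b k) + (of_real (- h) * bd k
      + of_real (h\<^sup>2) * (\<beta> k * (nl m (\<lambda>k. a k - b k) ba k + nl m bd b k)))" for k
    unfolding eq2[symmetric] bd_k step_def ba_def[symmetric] bb_def[symmetric] ba_k bb_k
    by (simp add: algebra_simps)
  have "hs_bounded x (X + (cmod (of_real (- h)) * (C * X * (N + N))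
      + cmod (of_real (h\<^sup>2)) * (C * X * (C * N * N) + C * (C * X * (N + N)) * N)))
      (\<lambda>k. step h m a k - step h m b k)"
    unfolding eq
    by (intro hs_bounded_add hs_bounded_scale d bd beta_bounded nl_bound_\<rho>[OF x d ba]
        nl_bound_\<rho>[OF x bd b])
  then show ?thesis
  proof (rule hs_bounded_mono)
    have "h\<^sup>2 * (3 * C\<^sup>2 * N\<^sup>2 * X) \<le> h * (3 * C\<^sup>2 * N\<^sup>2 * X)"
      using h X by (intro mult_right_mono) (auto simp: power2_eq_square mult_left_le)
    then show "X + (cmod (of_real (- h)) * (C * X * (N + N))
        + cmod (of_real (h\<^sup>2)) * (C * X * (C * N * N) + C * (C * X * (N + N)) * N))
        \<le> (1 + (2 * C * N + 3 * C\<^sup>2 * N\<^sup>2) * h) * X"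
      using h unfolding norm_of_real by (simp add: power2_eq_square algebra_simps)
  qed
qed

section \<open>Local error of a single step\<close>

context
  fixes W :: "real \<Rightarrow> int \<Rightarrow> complex" and t h M m :: real
  assumes h: "0 < h" "h \<le> 1" and m: "m = t + h / 2"
    and W: "\<And>x. x \<in> {t..t+h} \<Longrightarrow> hs_bounded s M (W x)"
    and cont: "\<And>k. continuous_on {t..t+h} (\<lambda>x. nl x (W x) (W x) k)"
    and eq: "\<And>x k. x \<in> {t..t+h} \<Longrightarrow> W x k = W t k - \<beta> k * integral {t..x} (\<lambda>y. nl y (W y) (W y) k)"
begin

lemma W0: "hs_bounded s M (W t)" and M: "0 \<le> M"
  using W[of t] h hs_bounded_nonneg by auto

lemma abs_time_le: "x \<in> {t..t+h} \<Longrightarrow> \<bar>x - m\<bar> \<le> h"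
  using h m by auto

lemma integrable_nl: "x \<in> {t..t+h} \<Longrightarrow> (\<lambda>y. nl y (W y) (W y) k) integrable_on {t..x}"
  by (rule integrable_continuous_real, rule continuous_on_subset[OF cont]) auto

lemma increment_bound:
  assumes x: "x \<in> {t..t+h}"
  shows "hs_bounded s (h * (C * M * M)) (\<lambda>k. W x k - W t k)"
proof -
  have "hs_bounded s ((x - t) * (C * M * M)) (\<lambda>k. integral {t..x} (\<lambda>y. nl y (W y) (W y) k))"
    using x by (intro hs_bounded_integral nl_bound_s W continuous_on_subset[OF cont]) auto
  then have "hs_bounded s (h * (C * M * M)) (\<lambda>k. integral {t..x} (\<lambda>y. nl y (W y) (W y) k))"
    by (rule hs_bounded_mono) (use x C M in \<open>auto intro!: mult_right_mono\<close>)
  from hs_bounded_uminus[OF beta_bounded[OF this]] show ?thesis by (simp add: eq[OF x])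
qed

text \<open>Separates two sources of error: the change of the solution, which costs no derivatives,
  and the change of the phase, which costs powers of \<phi>.\<close>

lemma frozen_diff:
  assumes x: "x \<in> {t..t+h}"
  shows "nl x (W x) (W x) k - nl m (W t) (W t) k =
    nl x (\<lambda>k. W x k - W t k) (\<lambda>k. W x k + W t k) k
    + twisted_conv (\<lambda>k j. cis (x * \<phi> k j) - cis (m * \<phi> k j)) (W t) (W t) k"
proof -
  note w = hs_bounded_weaken[OF W[OF x] exps(3)] hs_bounded_weaken[OF W0 exps(3)]
  show ?thesis
    unfolding nl_square_diff[OF w, symmetric] twisted_conv_diff_coeff[OF nl_summable[OF w(2) w(2)] nl_summable[OF w(2) w(2)]]
    by (simp add: nl_def)
qed

lemma frozen_diff_bound_q:
  assumes x: "x \<in> {t..t+h}"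
  shows "hs_bounded q (h * (2 * C\<^sup>2 * M ^ 3 + C * M\<^sup>2))
    (\<lambda>k. nl x (W x) (W x) k - nl m (W t) (W t) k)"
proof -
  have "cmod (cis (x * \<phi> k j) - cis (m * \<phi> k j)) \<le> h * \<bar>\<phi> k j\<bar>" for k j
    using cis_taylor_0[of "x * \<phi> k j" "m * \<phi> k j"] mult_right_mono[OF abs_time_le[OF x], of "\<bar>\<phi> k j\<bar>"]
    by (simp add: abs_mult flip: left_diff_distrib)
  then have 1: "hs_bounded q (C * h * M * M) (twisted_conv (\<lambda>k j. cis (x * \<phi> k j) - cis (m * \<phi> k j)) (W t) (W t))"
    using h by (intro conv_phase[THEN conjunct2] W0) auto
  have 2: "hs_bounded q (C * (h * (C * M * M)) * (M + M)) (nl x (\<lambda>k. W x k - W t k) (\<lambda>k. W x k + W t k))"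
    using nl_bound_s[of s, OF _ increment_bound[OF x] hs_bounded_add[OF W[OF x] W0]] exps(1)
    by (auto intro: hs_bounded_weaken)
  show ?thesis
    unfolding frozen_diff[OF x]
    by (rule hs_bounded_mono[OF hs_bounded_add[OF 2 1]])
       (simp add: power2_eq_square power3_eq_cube algebra_simps)
qed

text \<open>Order \<rho> leaves room for the power \<theta> of the phase only, so the phase
  difference is O(h powr \<theta>); the increment of the solution is O(h), which is no worse as h <=
  1.\<close>

lemma frozen_diff_bound_\<rho>:
  assumes x: "x \<in> {t..t+h}"
  shows "hs_bounded \<rho> (h powr \<theta> * (2 * C\<^sup>2 * M ^ 3 + 2 * C * M\<^sup>2))
    (\<lambda>k. nl x (W x) (W x) k - nl m (W t) (W t) k)"
proof -
  have "cmod (cis (x * \<phi> k j) - cis (m * \<phi> k j)) \<le> 2 * h powr \<theta> * \<bar>\<phi> k j\<bar> powr \<theta>" for k j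
  proof -
    have "cmod (cis (x * \<phi> k j) - cis (m * \<phi> k j)) \<le> 2 * (\<bar>x - m\<bar> * \<bar>\<phi> k j\<bar>) powr \<theta>"
      using cis_diff_powr[OF exps(4,5), of "x * \<phi> k j" "m * \<phi> k j"]
      by (simp add: abs_mult flip: left_diff_distrib)
    also have "\<dots> \<le> 2 * (h * \<bar>\<phi> k j\<bar>) powr \<theta>"
      using abs_time_le[OF x] exps by (intro mult_left_mono powr_mono2 mult_right_mono) auto
    finally show ?thesis using h by (simp add: powr_mult)
  qed
  then have 1: "hs_bounded \<rho> (C * (2 * h powr \<theta>) * M * M) (twisted_conv (\<lambda>k j. cis (x * \<phi> k j) - cis (m * \<phi> k j)) (W t) (W t))"
    by (intro conv_phase\<theta> W0) auto
  have 2: "hs_bounded \<rho> (C * (h * (C * M * M)) * (M + M)) (nl x (\<lambda>k. W x k - W t k) (\<lambda>k. W x k + W t k))"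
    using nl_bound_s[of s, OF _ increment_bound[OF x] hs_bounded_add[OF W[OF x] W0]] exps(3)
    by (auto intro: hs_bounded_weaken)
  have "h powr 1 \<le> h powr \<theta>" using h exps by (intro powr_mono') auto
  then have "h * (2 * C\<^sup>2 * M ^ 3) \<le> h powr \<theta> * (2 * C\<^sup>2 * M ^ 3)"
    using h M by (intro mult_right_mono) auto
  then show ?thesis
    unfolding frozen_diff[OF x]
    by (intro hs_bounded_mono[OF hs_bounded_add[OF 2 1]])
       (simp add: power2_eq_square power3_eq_cube algebra_simps)
qed

text \<open>Minus the time derivative of W at t with the phase frozen at m, so that - (x - t)
  \<open>corr\<close> predicts the increment W x - W t.\<close>

definition corr :: "int \<Rightarrow> complex" where
  "corr = (\<lambda>k. \<beta> k * nl m (W t) (W t) k)"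

lemma corr_bound: "hs_bounded s (C * M * M) corr"
  unfolding corr_def by (intro beta_bounded nl_bound_s W0 disjI1 refl)

lemma local_error_eq:
  "W (t + h) k - step h m (W t) k = - (\<beta> k * integral {t..t+h} (\<lambda>x. nl x (W x) (W x) k - nl m (W t) (W t) k))
     - h\<^sup>2 * (\<beta> k * nl m corr (W t) k)"
proof -
  have "integral {t..t+h} (\<lambda>x. nl x (W x) (W x) k - nl m (W t) (W t) k)
      = integral {t..t+h} (\<lambda>x. nl x (W x) (W x) k) - h * nl m (W t) (W t) k"
    using h by (subst integral_diff) (auto intro!: integrable_nl simp: scaleR_conv_of_real)
  then show ?thesis
    using eq[of "t + h" k] h
    unfolding step_def nl_commute[of m corr] corr_def[symmetric]
    by (simp only: right_diff_distrib) simp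
qed

text \<open>Crude on purpose: the second order correction is bounded by itself, without any
  cancellation, since h^2 <= h powr (1 + \<theta>).\<close>

lemma local_error_\<rho>:
  "hs_bounded \<rho> (h powr (1 + \<theta>) * (2 * C\<^sup>2 * M ^ 3 + 2 * C * M\<^sup>2 + C\<^sup>2 * M ^ 3))
    (\<lambda>k. W (t + h) k - step h m (W t) k)"
proof -
  have c: "continuous_on {t..t+h} (\<lambda>x. nl x (W x) (W x) k - nl m (W t) (W t) k)" for k
    by (intro continuous_intros cont)
  have 1: "hs_bounded \<rho> ((t + h - t) * (h powr \<theta> * (2 * C\<^sup>2 * M ^ 3 + 2 * C * M\<^sup>2)))
      (\<lambda>k. - (\<beta> k * integral {t..t+h} (\<lambda>x. nl x (W x) (W x) k - nl m (W t) (W t) k)))"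
    using h by (intro hs_bounded_uminus beta_bounded hs_bounded_integral frozen_diff_bound_\<rho> c) auto
  have 2: "hs_bounded \<rho> (cmod (of_real (h\<^sup>2)) * (C * (C * M * M) * M))
      (\<lambda>k. of_real (h\<^sup>2) * (\<beta> k * nl m corr (W t) k))"
    by (intro hs_bounded_scale beta_bounded hs_bounded_weaken[OF nl_bound_s[OF _ corr_bound W0] exps(3)]) auto
  have "h powr 2 \<le> h powr (1 + \<theta>)" using h exps by (intro powr_mono') auto
  then have "h\<^sup>2 * (C\<^sup>2 * M ^ 3) \<le> h powr (1 + \<theta>) * (C\<^sup>2 * M ^ 3)"
    using h M by (intro mult_right_mono) (auto simp: powr_numeral)
  moreover have "h powr (1 + \<theta>) = h * h powr \<theta>" using h by (simp add: powr_add)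
  moreover have "cmod (of_real (h\<^sup>2)) = h\<^sup>2" by (simp only: norm_of_real) simp
  ultimately show ?thesis
    unfolding local_error_eq
    by (intro hs_bounded_mono[OF hs_bounded_diff[OF 1 2]])
       (simp only:, simp add: power2_eq_square power3_eq_cube algebra_simps)
qed

text \<open>Formally the time derivative at m of \<open>nl x (W t) (W t)\<close> with the solution
  frozen.\<close>

definition slope :: "int \<Rightarrow> complex" where
  "slope = twisted_conv (\<lambda>k j. \<phi> k j * (\<i> * cis (m * \<phi> k j))) (W t) (W t)"

text \<open>The two linear terms leave the integral over the step unchanged up to the correction term
  of the scheme, and turn its integrand into a quantity that is pointwise of size \<open>h\<^sup>2\<close>.\<close>

definition remainder :: "real \<Rightarrow> int \<Rightarrow> complex" where
  "remainder x k = nl x (W x) (W x) k - nl m (W t) (W t) k - (x - m) * slope k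
     + 2 * (x - t) * nl m corr (W t) k"

text \<open>The factor x - m is odd about the midpoint, so the slope term integrates to 0; this is
  where the symmetry of the splitting enters. The factor 2 (x - t) integrates to the h^2 of the
  scheme.\<close>

lemma local_error_remainder:
  "W (t + h) k - step h m (W t) k = - (\<beta> k * integral {t..t+h} (\<lambda>x. remainder x k))"
proof -
  have lin: "((\<lambda>x. complex_of_real (a * (x - b))) has_integral
      complex_of_real (a * ((t + h - b)\<^sup>2 / 2 - (t - b)\<^sup>2 / 2))) {t..t+h}" for a b
  proof -
    have "((\<lambda>x. a * (x - b)) has_integral (a * ((t + h - b)\<^sup>2 / 2) - a * ((t - b)\<^sup>2 / 2))) {t..t+h}"
      using h by (intro fundamental_theorem_of_calculus[where f="\<lambda>x. a * ((x - b)\<^sup>2 / 2)"])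
        (auto intro!: derivative_eq_intros simp flip: has_real_derivative_iff_has_vector_derivative)
    from has_integral_of_real[OF this] show ?thesis by (simp only: right_diff_distrib)
  qed
  have "((\<lambda>x. (nl x (W x) (W x) k - nl m (W t) (W t) k) - complex_of_real (1 * (x - m)) * slope k
      + complex_of_real (2 * (x - t)) * nl m corr (W t) k) has_integral
      integral {t..t+h} (\<lambda>x. nl x (W x) (W x) k - nl m (W t) (W t) k)
      - complex_of_real (1 * ((t + h - m)\<^sup>2 / 2 - (t - m)\<^sup>2 / 2)) * slope k
      + complex_of_real (2 * ((t + h - t)\<^sup>2 / 2 - (t - t)\<^sup>2 / 2)) * nl m corr (W t) k) {t..t+h}"
    using h by (intro has_integral_add has_integral_diff has_integral_mult_left lin integrable_integral
        integrable_diff integrable_nl) auto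
  moreover have "(\<lambda>x. (nl x (W x) (W x) k - nl m (W t) (W t) k) - complex_of_real (1 * (x - m)) * slope k
      + complex_of_real (2 * (x - t)) * nl m corr (W t) k) = (\<lambda>x. remainder x k)"
    by (simp add: remainder_def)
  moreover have "1 * ((t + h - m)\<^sup>2 / 2 - (t - m)\<^sup>2 / 2) = 0" "2 * ((t + h - t)\<^sup>2 / 2 - (t - t)\<^sup>2 / 2) = h\<^sup>2"
    by (simp_all add: m power2_eq_square algebra_simps)
  ultimately have "((\<lambda>x. remainder x k) has_integral
      integral {t..t+h} (\<lambda>x. nl x (W x) (W x) k - nl m (W t) (W t) k)
      - complex_of_real 0 * slope k + complex_of_real (h\<^sup>2) * nl m corr (W t) k) {t..t+h}"
    by (simp only:)
  then have "integral {t..t+h} (\<lambda>x. remainder x k)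
     = integral {t..t+h} (\<lambda>x. nl x (W x) (W x) k - nl m (W t) (W t) k) + h\<^sup>2 * nl m corr (W t) k"
    by (intro integral_unique) simp
  then show ?thesis unfolding local_error_eq by (simp add: algebra_simps)
qed

lemma continuous_remainder: "continuous_on {t..t+h} (\<lambda>x. remainder x k)"
  unfolding remainder_def by (intro continuous_intros cont)

lemma defect_bound:
  assumes x: "x \<in> {t..t+h}"
  shows "hs_bounded q (h * (h * (2 * C\<^sup>2 * M ^ 3 + C * M\<^sup>2)))
    (\<lambda>k. (W x k - W t k) + (x - t) * corr k)"
proof -
  have "integral {t..x} (\<lambda>y. nl y (W y) (W y) k - nl m (W t) (W t) k)
      = integral {t..x} (\<lambda>y. nl y (W y) (W y) k) - (x - t) * nl m (W t) (W t) k" for k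
    using x by (subst integral_diff) (auto intro!: integrable_nl simp: scaleR_conv_of_real)
  then have "(\<lambda>k. (W x k - W t k) + (x - t) * corr k)
      = (\<lambda>k. - (\<beta> k * integral {t..x} (\<lambda>y. nl y (W y) (W y) k - nl m (W t) (W t) k)))"
    unfolding eq[OF x] corr_def by (simp add: right_diff_distrib mult.left_commute del: of_real_diff)
  moreover have "hs_bounded q ((x - t) * (h * (2 * C\<^sup>2 * M ^ 3 + C * M\<^sup>2)))
      (\<lambda>k. - (\<beta> k * integral {t..x} (\<lambda>y. nl y (W y) (W y) k - nl m (W t) (W t) k)))"
    using x by (intro hs_bounded_uminus beta_bounded hs_bounded_integral frozen_diff_bound_q
        continuous_intros continuous_on_subset[OF cont]) auto
  ultimately show ?thesis
    using x h C M by (auto elim!: hs_bounded_mono intro!: mult_right_mono)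
qed

text \<open>Expands \<open>nl x\<close> at W t + d. In the term linear in d the increment is
  replaced by its prediction plus the defect, and the prediction is moved from time x to m at the
  cost of the last summand. Every summand is now quadratic in h: second order phase remainder,
  defect, squared increment, and (x - t) times a phase difference.\<close>

lemma remainder_eq:
  assumes x: "x \<in> {t..t+h}"
  defines "d \<equiv> (\<lambda>k. W x k - W t k)"
  shows "remainder x k =
    twisted_conv (\<lambda>k j. cis (x * \<phi> k j) - cis (m * \<phi> k j) - of_real (x - m) * (\<phi> k j * (\<i> * cis (m * \<phi> k j)))) (W t) (W t) k
    + 2 * nl x (\<lambda>k. d k + (x - t) * corr k) (W t) k + nl x d d k
    - of_real (2 * (x - t)) * twisted_conv (\<lambda>k j. cis (x * \<phi> k j) - cis (m * \<phi> k j)) corr (W t) k"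
proof -
  note w = hs_bounded_weaken[OF W0 exps(3)] and c = hs_bounded_weaken[OF corr_bound exps(3)]
  have d: "hs_bounded \<rho> (h * (C * M * M)) d"
    unfolding d_def using hs_bounded_weaken[OF increment_bound[OF x] exps(3)] .
  note cx = hs_bounded_scale[OF c, of "of_real (x - t)"]
  \<comment> \<open>The coefficient is not bounded here, so summability has to come from
    \<open>conv_phase\<close> with D = 1.\<close>
  have sl: "twisted_summable (\<lambda>k j. \<phi> k j * (\<i> * cis (m * \<phi> k j))) (W t) (W t)"
    using conv_phase[of 1, OF _ _ W0 W0] by (simp add: norm_mult)
  have Wd: "W x = (\<lambda>k. W t k + d k)" by (simp add: d_def)
  have 1: "nl x (W x) (W x) k = nl x (W t) (W t) k + 2 * nl x d (W t) k + nl x d d k"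
    unfolding Wd nl_add_left[OF w d hs_bounded_add[OF w d]] nl_commute[of x "W t" "\<lambda>k. W t k + d k"]
      nl_commute[of x d "\<lambda>k. W t k + d k"] nl_add_left[OF w d w] nl_add_left[OF w d d]
      nl_commute[of x "W t" d] by simp
  have 2: "nl x (\<lambda>k. d k + of_real (x - t) * corr k) (W t) k = nl x d (W t) k + of_real (x - t) * nl x corr (W t) k"
    unfolding nl_add_left[OF d cx w] nl_scale_left ..
  have 3: "twisted_conv (\<lambda>k j. cis (x * \<phi> k j) - cis (m * \<phi> k j)) corr (W t) k
      = nl x corr (W t) k - nl m corr (W t) k"
    unfolding nl_def by (intro twisted_conv_diff_coeff nl_summable[OF c w])
  have 4: "twisted_conv (\<lambda>k j. cis (x * \<phi> k j) - cis (m * \<phi> k j) - of_real (x - m) * (\<phi> k j * (\<i> * cis (m * \<phi> k j)))) (W t) (W t) k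
      = nl x (W t) (W t) k - nl m (W t) (W t) k - of_real (x - m) * slope k"
    unfolding nl_def slope_def twisted_conv_scale_coeff[symmetric]
    by (simp only: twisted_conv_diff_coeff twisted_summable_diff_coeff nl_summable[OF w w]
        twisted_summable_scale_coeff[OF sl])
  show ?thesis unfolding remainder_def 1 2 3 4 by (simp add: algebra_simps)
qed

text \<open>The four summands contribute C M^2, then 2 C^2 M^3 + 4 C^3 M^4, then C^3 M^4, then 2 C^2
  M^3, each times h^2.\<close>

lemma remainder_bound:
  assumes x: "x \<in> {t..t+h}"
  shows "hs_bounded q (h\<^sup>2 * (C * M\<^sup>2 + 4 * C\<^sup>2 * M ^ 3 + 5 * C ^ 3 * M ^ 4)) (remainder x)"
proof -
  define d where "d = (\<lambda>k. W x k - W t k)"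
  have ht: "\<bar>x - m\<bar> \<le> h" by (rule abs_time_le[OF x])
  have "(x - m)\<^sup>2 \<le> h\<^sup>2" using ht h by (metis abs_le_square_iff abs_of_pos)
  then have "cmod (cis (x * \<phi> k j) - cis (m * \<phi> k j) - of_real (x - m) * (\<phi> k j * (\<i> * cis (m * \<phi> k j))))
      \<le> h\<^sup>2 * (\<phi> k j)\<^sup>2" for k j
    using cis_taylor_1[of "x * \<phi> k j" "m * \<phi> k j"] mult_right_mono[of "(x - m)\<^sup>2" "h\<^sup>2" "(\<phi> k j)\<^sup>2"]
    by (simp add: power_mult_distrib mult_ac flip: left_diff_distrib of_real_diff)
  then have 1: "hs_bounded q (C * h\<^sup>2 * M * M) (twisted_conv (\<lambda>k j. cis (x * \<phi> k j) - cis (m * \<phi> k j)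
      - of_real (x - m) * (\<phi> k j * (\<i> * cis (m * \<phi> k j)))) (W t) (W t))"
    by (intro conv_phase2 W0) auto
  have 2: "hs_bounded q (cmod 2 * (C * (h * (h * (2 * C\<^sup>2 * M ^ 3 + C * M\<^sup>2))) * M))
      (\<lambda>k. 2 * nl x (\<lambda>k. (W x k - W t k) + (x - t) * corr k) (W t) k)"
    by (intro hs_bounded_scale nl_bound_s[OF _ defect_bound[OF x] W0]) auto
  have 3: "hs_bounded q (C * (h * (C * M * M)) * (h * (C * M * M))) (nl x d d)"
    unfolding d_def using nl_bound_s[of s, OF _ increment_bound[OF x] increment_bound[OF x]] exps(1)
    by (auto intro: hs_bounded_weaken)
  have "cmod (cis (x * \<phi> k j) - cis (m * \<phi> k j)) \<le> h * \<bar>\<phi> k j\<bar>" for k j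
    using cis_taylor_0[of "x * \<phi> k j" "m * \<phi> k j"] mult_right_mono[OF ht, of "\<bar>\<phi> k j\<bar>"]
    by (simp add: abs_mult flip: left_diff_distrib)
  then have "hs_bounded q (C * h * (C * M * M) * M)
      (twisted_conv (\<lambda>k j. cis (x * \<phi> k j) - cis (m * \<phi> k j)) corr (W t))"
    using h by (intro conv_phase[THEN conjunct2] corr_bound W0) auto
  then have "hs_bounded q (cmod (of_real (2 * (x - t))) * (C * h * (C * M * M) * M))
      (\<lambda>k. of_real (2 * (x - t)) * twisted_conv (\<lambda>k j. cis (x * \<phi> k j) - cis (m * \<phi> k j)) corr (W t) k)"
    by (rule hs_bounded_scale)
  then have 4: "hs_bounded q ((2 * h) * (C * h * (C * M * M) * M))
      (\<lambda>k. of_real (2 * (x - t)) * twisted_conv (\<lambda>k j. cis (x * \<phi> k j) - cis (m * \<phi> k j)) corr (W t) k)"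
  proof (rule hs_bounded_mono, intro mult_right_mono)
    show "cmod (of_real (2 * (x - t))) \<le> 2 * h" using x by (simp only: norm_of_real) auto
  qed (use h C M in auto)
  have "hs_bounded q (C * h\<^sup>2 * M * M + cmod 2 * (C * (h * (h * (2 * C\<^sup>2 * M ^ 3 + C * M\<^sup>2))) * M)
      + C * (h * (C * M * M)) * (h * (C * M * M)) + (2 * h) * (C * h * (C * M * M) * M)) (remainder x)"
    unfolding remainder_eq[OF x, abs_def] d_def[symmetric]
    by (intro hs_bounded_diff[OF hs_bounded_add[OF hs_bounded_add[OF 1 2] 3] 4])
  then show ?thesis
    by (rule hs_bounded_mono) (simp add: power2_eq_square power3_eq_cube power4_eq_xxxx algebra_simps)
qed

text \<open>Integration over the step supplies the third factor h, and \<beta>, acting after the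
  integral, passes from order q to r with the factor \<kappa>.\<close>

lemma local_error_r:
  "hs_bounded r (h ^ 3 * \<kappa> * (C * M\<^sup>2 + 4 * C\<^sup>2 * M ^ 3 + 5 * C ^ 3 * M ^ 4))
    (\<lambda>k. W (t + h) k - step h m (W t) k)"
proof -
  have "hs_bounded r (\<kappa> * ((t + h - t) * (h\<^sup>2 * (C * M\<^sup>2 + 4 * C\<^sup>2 * M ^ 3 + 5 * C ^ 3 * M ^ 4))))
    (\<lambda>k. - (\<beta> k * integral {t..t+h} (\<lambda>x. remainder x k)))"
    using h by (intro hs_bounded_uminus beta_gain hs_bounded_integral remainder_bound continuous_remainder) auto
  then show ?thesis
    unfolding local_error_remainder
    by (rule hs_bounded_mono) (simp add: power2_eq_square power3_eq_cube)
qed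

end

section \<open>Stability constants and accumulation of the local errors\<close>

text \<open>\<open>coarse_const\<close> and \<open>fine_const\<close> belong to the local errors in the norms of order \<open>\<rho>\<close> and \<open>r\<close>.\<close>

definition stab_const :: "real \<Rightarrow> real" where
  "stab_const M = 2 * C * (M + 1) + 3 * C\<^sup>2 * (M + 1)\<^sup>2"

definition coarse_const :: "real \<Rightarrow> real" where
  "coarse_const M = 2 * C\<^sup>2 * M ^ 3 + 2 * C * M\<^sup>2 + C\<^sup>2 * M ^ 3"

definition fine_const :: "real \<Rightarrow> real" where
  "fine_const M = C * M\<^sup>2 + 4 * C\<^sup>2 * M ^ 3 + 5 * C ^ 3 * M ^ 4"

text \<open>Local error plus propagated error, with 1 + L h <= exp (L h). Here L is the constant of
  \<open>step_stable\<close> for N = M + 1: the exact solution has size at most M, and the iterates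
  will be within distance 1 of it.\<close>

lemma error_step:
  assumes x: "x = r \<or> x = \<rho>" and loc: "hs_bounded x d (\<lambda>k. w' k - step h m w k)"
    and X: "hs_bounded x X (\<lambda>k. w k - z k)"
    and w: "hs_bounded \<rho> (M + 1) w" and z: "hs_bounded \<rho> (M + 1) z" and h: "0 \<le> h" "h \<le> 1"
    and le: "X \<le> real n * d * exp (stab_const M * (real n * h))"
  shows "hs_bounded x (real (Suc n) * d * exp (stab_const M * (real (Suc n) * h)))
    (\<lambda>k. w' k - step h m z k)"
proof -
  let ?L = "stab_const M"
  have d: "0 \<le> d" and M: "0 \<le> M + 1" using loc w hs_bounded_nonneg by blast+
  have L: "0 \<le> ?L" using C M by (auto simp: stab_const_def intro!: add_nonneg_nonneg)
  have "hs_bounded x (d + (1 + ?L * h) * X)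
      (\<lambda>k. (w' k - step h m w k) + (step h m w k - step h m z k))"
    unfolding stab_const_def by (intro hs_bounded_add loc step_stable x X w z h)
  then have "hs_bounded x (d + (1 + ?L * h) * X) (\<lambda>k. w' k - step h m z k)" by simp
  moreover have "d + (1 + ?L * h) * X \<le> real (Suc n) * d * exp (?L * (real (Suc n) * h))"
  proof -
    have "(1 + ?L * h) * X \<le> exp (?L * h) * (real n * d * exp (?L * (real n * h)))"
      using le hs_bounded_nonneg[OF X] exp_ge_add_one_self[of "?L * h"] by (intro mult_mono) auto
    also have "\<dots> = real n * d * exp (?L * (real (Suc n) * h))"
      by (simp add: algebra_simps flip: exp_add)
    finally have "(1 + ?L * h) * X \<le> real n * d * exp (?L * (real (Suc n) * h))" .
    moreover have "d * 1 \<le> d * exp (?L * (real (Suc n) * h))"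
      using d L h by (intro mult_left_mono) auto
    ultimately show ?thesis by (simp add: algebra_simps)
  qed
  ultimately show ?thesis by (rule hs_bounded_mono)
qed

lemma error_accumulation:
  assumes "0 < h" "real n * h \<le> T" "0 \<le> L" "0 \<le> d"
  shows "real n * (h * d) * exp (L * (real n * h)) \<le> T * exp (L * T) * d"
proof -
  have "real n * (h * d) * exp (L * (real n * h)) = (real n * h) * exp (L * (real n * h)) * d"
    by simp
  also have "\<dots> \<le> T * exp (L * T) * d"
    using assms by (intro mult_right_mono mult_mono) (auto intro: mult_left_mono order_trans[rotated])
  finally show ?thesis .
qed

text \<open>Two inductions on n. The one in order \<rho> carries its own bootstrap: by
  \<open>small\<close> the error is at most 1, so the iterate has size at most M + 1, which licenses
  stability for the next step. The one in order r then takes this size bound for granted and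
  accumulates the sharper local error.\<close>

theorem global_error:
  fixes W :: "real \<Rightarrow> int \<Rightarrow> complex" and Z :: "nat \<Rightarrow> int \<Rightarrow> complex"
  assumes h: "0 < h" "h \<le> 1"
    and W: "\<And>x. x \<in> {0..T} \<Longrightarrow> hs_bounded s M (W x)"
    and cont: "\<And>k. continuous_on {0..T} (\<lambda>x. nl x (W x) (W x) k)"
    and eq: "\<And>x k. x \<in> {0..T} \<Longrightarrow> W x k = W 0 k - \<beta> k * integral {0..x} (\<lambda>y. nl y (W y) (W y) k)"
    and Z0: "Z 0 = W 0" and Z: "\<And>n. Z (Suc n) = step h (real n * h + h / 2) (Z n)"
    and small: "T * exp (stab_const M * T) * (h powr \<theta> * coarse_const M) \<le> 1"
    and n: "real n * h \<le> T"
  shows "hs_bounded r (h\<^sup>2 * \<kappa> * (T * exp (stab_const M * T) * fine_const M)) (\<lambda>k. W (real n * h) k - Z n k)"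
proof -
  have T: "0 \<le> T" using n h by (meson less_imp_le mult_nonneg_nonneg of_nat_0_le_iff order_trans)
  have M: "0 \<le> M" using W[of 0] T hs_bounded_nonneg by auto
  have L: "0 \<le> stab_const M" using C M by (simp add: stab_const_def)
  have W\<rho>: "hs_bounded \<rho> (M + 1) (W x)" if "x \<in> {0..T}" for x
    using hs_bounded_mono[OF hs_bounded_weaken[OF W[OF that] exps(3)], of "M + 1"] by simp
  have local: "hs_bounded \<rho> (h * (h powr \<theta> * coarse_const M))
        (\<lambda>k. W (real (Suc n) * h) k - step h (real n * h + h / 2) (W (real n * h)) k)"
      "hs_bounded r (h * (h\<^sup>2 * \<kappa> * fine_const M))
        (\<lambda>k. W (real (Suc n) * h) k - step h (real n * h + h / 2) (W (real n * h)) k)"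
    if n: "real (Suc n) * h \<le> T" for n
  proof -
    define t where "t = real n * h"
    have th: "real (Suc n) * h = t + h" by (simp add: t_def algebra_simps)
    have t: "0 \<le> t" "t + h \<le> T" using n h th by (auto simp: t_def)
    have c: "continuous_on {t..t+h} (\<lambda>x. nl x (W x) (W x) k)" for k
      by (rule continuous_on_subset[OF cont]) (use t in auto)
    \<comment> \<open>Subtracting the integral equation at t from that at x restarts it at the grid
      point, the form in which the one-step estimates ask for it.\<close>
    have e: "W x k = W t k - \<beta> k * integral {t..x} (\<lambda>y. nl y (W y) (W y) k)" if x: "x \<in> {t..t+h}" for x k
    proof -
      have "(\<lambda>y. nl y (W y) (W y) k) integrable_on {0..x}"
        by (rule integrable_continuous_real, rule continuous_on_subset[OF cont]) (use t x in auto)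
      then have comb: "integral {0..t} (\<lambda>y. nl y (W y) (W y) k) + integral {t..x} (\<lambda>y. nl y (W y) (W y) k)
          = integral {0..x} (\<lambda>y. nl y (W y) (W y) k)"
        using t x by (intro Henstock_Kurzweil_Integration.integral_combine) auto
      have "x \<in> {0..T}" "t \<in> {0..T}" using t x h by auto
      then show ?thesis by (simp only: eq[of x] eq[of t] flip: comb) (simp add: algebra_simps)
    qed
    have w: "\<And>x. x \<in> {t..t+h} \<Longrightarrow> hs_bounded s M (W x)" using W t by auto
    show "hs_bounded \<rho> (h * (h powr \<theta> * coarse_const M))
        (\<lambda>k. W (real (Suc n) * h) k - step h (real n * h + h / 2) (W (real n * h)) k)"
      using local_error_\<rho>[OF h refl w c e] h unfolding th t_def[symmetric] coarse_const_def
      by (simp add: powr_add mult.assoc)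
    show "hs_bounded r (h * (h\<^sup>2 * \<kappa> * fine_const M))
        (\<lambda>k. W (real (Suc n) * h) k - step h (real n * h + h / 2) (W (real n * h)) k)"
      using local_error_r[OF h refl w c e] unfolding th t_def[symmetric] fine_const_def
      by (simp add: power2_eq_square power3_eq_cube mult.assoc)
  qed
  have fc: "0 \<le> fine_const M" "0 \<le> coarse_const M"
    using C M by (auto simp: fine_const_def coarse_const_def)
  have Zbound: "hs_bounded \<rho> (M + 1) (Z n)"
    if n: "real n * h \<le> T"
      and e: "hs_bounded \<rho> (real n * (h * (h powr \<theta> * coarse_const M)) * exp (stab_const M * (real n * h)))
        (\<lambda>k. W (real n * h) k - Z n k)" for n
  proof -
    have "hs_bounded \<rho> 1 (\<lambda>k. W (real n * h) k - Z n k)"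
      using fc h by (intro hs_bounded_mono[OF e] order_trans[OF error_accumulation[OF h(1) n L] small]) auto
    moreover have "hs_bounded \<rho> M (W (real n * h))"
      using hs_bounded_weaken[OF W exps(3)] n h by auto
    ultimately have "hs_bounded \<rho> (M + 1) (\<lambda>k. W (real n * h) k - (W (real n * h) k - Z n k))"
      by (intro hs_bounded_diff)
    then show ?thesis by simp
  qed
  have prev: "real n * h \<le> T" if "real (Suc n) * h \<le> T" for n
    using that h by (simp add: algebra_simps)
  have coarse: "hs_bounded \<rho> (real n * (h * (h powr \<theta> * coarse_const M)) * exp (stab_const M * (real n * h)))
        (\<lambda>k. W (real n * h) k - Z n k)" if "real n * h \<le> T" for n
    using that
  proof (induction n)
    case 0
    show ?case using hs_bounded_zero by (simp add: Z0)
  next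
    case (Suc n)
    note n = prev[OF Suc.prems] and IH = Suc.IH[OF prev[OF Suc.prems]]
    have "real n * h \<in> {0..T}" using n h by auto
    then show ?case
      unfolding Z using h
      by (intro error_step[OF _ local(1)[OF Suc.prems] IH W\<rho> Zbound[OF n IH]]) auto
  qed
  have "hs_bounded r (real n * (h * (h\<^sup>2 * \<kappa> * fine_const M)) * exp (stab_const M * (real n * h)))
        (\<lambda>k. W (real n * h) k - Z n k)" if "real n * h \<le> T" for n
    using that
  proof (induction n)
    case 0
    show ?case using hs_bounded_zero by (simp add: Z0)
  next
    case (Suc n)
    note n = prev[OF Suc.prems] and IH = Suc.IH[OF prev[OF Suc.prems]]
    have "real n * h \<in> {0..T}" using n h by auto
    then show ?case
      unfolding Z using h
      by (intro error_step[OF _ local(2)[OF Suc.prems] IH W\<rho> Zbound[OF n coarse[OF n]]]) auto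
  qed
  from this[OF n] show "hs_bounded r (h\<^sup>2 * \<kappa> * (T * exp (stab_const M * T) * fine_const M)) (\<lambda>k. W (real n * h) k - Z n k)"
    using error_accumulation[OF h(1) n L, of "h\<^sup>2 * \<kappa> * fine_const M"] fc exps(6)
    by (auto elim!: hs_bounded_mono simp: mult_ac)
qed

end

section \<open>Fourier series on the torus\<close>

definition trig_series :: "(int \<Rightarrow> complex) \<Rightarrow> real \<Rightarrow> complex" where
  "trig_series a x = (\<Sum>\<^sub>\<infinity>k. a k * cis (of_int k * x))"

lemma fourier_multiplier_eq: "fourier_multiplier m f = trig_series (\<lambda>k. m k * fourier_coeff f k)"
  by (simp add: fourier_multiplier_def trig_series_def fun_eq_iff)

lemma uniform_limit_trig_series:
  assumes "(\<lambda>k. cmod (a k)) summable_on UNIV"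
  shows "uniform_limit UNIV (\<lambda>F x. \<Sum>k\<in>F. a k * cis (of_int k * x)) (trig_series a)
    (finite_subsets_at_top UNIV)"
  unfolding trig_series_def[abs_def]
  by (rule Weierstrass_m_test_general[OF _ assms]) (simp add: norm_mult)

lemma continuous_on_trig_series:
  assumes "(\<lambda>k. cmod (a k)) summable_on UNIV"
  shows "continuous_on A (trig_series a)"
proof -
  have "continuous_on UNIV (trig_series a)"
    by (rule uniform_limit_theorem[OF _ uniform_limit_trig_series[OF assms]])
       (auto intro!: always_eventually continuous_intros)
  then show ?thesis by (rule continuous_on_subset) simp
qed

lemma trig_series_periodic: "trig_series a (x + 2 * pi) = trig_series a x"
proof -
  have "cis (of_int k * (x + 2 * pi)) = cis (of_int k * x)" for k :: int
  proof -
    have "cis (of_int k * (x + 2 * pi)) = cis (of_int k * x) * cis (2 * pi * of_int k)"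
      by (simp add: cis_mult algebra_simps)
    then show ?thesis using cis_multiple_2pi[of "of_int k"] by simp
  qed
  then show ?thesis by (simp add: trig_series_def)
qed

lemma trig_series_diff:
  assumes "(\<lambda>k. cmod (a k)) summable_on UNIV" "(\<lambda>k. cmod (b k)) summable_on UNIV"
  shows "trig_series (\<lambda>k. a k - b k) x = trig_series a x - trig_series b x"
proof -
  have "(\<lambda>k. c k * cis (of_int k * x)) summable_on UNIV"
    if "(\<lambda>k. cmod (c k)) summable_on UNIV" for c :: "int \<Rightarrow> complex"
    using that by (rule_tac abs_summable_summable) (simp add: norm_mult)
  from infsum_minus[OF this[OF assms(1)] this[OF assms(2)]] show ?thesis
    by (simp add: trig_series_def left_diff_distrib)
qed

lemma trig_series_scale: "trig_series (\<lambda>k. z * a k) x = z * trig_series a x"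
  by (simp add: trig_series_def mult.assoc infsum_cmult_right')

text \<open>Summability in the complex numbers is absolute and \<open>cis\<close> has modulus 1, so
  the series diverges at every x simultaneously and \<open>infsum\<close> takes its default
  value.\<close>

lemma trig_series_not_summable:
  assumes "\<not> (\<lambda>k. cmod (a k)) summable_on UNIV"
  shows "trig_series a x = 0"
proof -
  have "\<not> (\<lambda>k. a k * cis (of_int k * x)) summable_on UNIV"
    using assms summable_on_iff_abs_summable_on_complex[of "\<lambda>k. a k * cis (of_int k * x)" UNIV]
    by (simp add: norm_mult)
  then show ?thesis by (simp add: trig_series_def infsum_not_exists)
qed

lemma fourier_coeff_continuous:
  assumes "continuous_on {-pi..pi} f"
  shows "fourier_coeff f k = integral {-pi..pi} (\<lambda>x. f x * cis (- (of_int k * x))) / (2 * pi)"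
  unfolding fourier_coeff_def
  by (subst lebesgue_integral_eq_integral)
     (auto intro!: continuous_imp_integrable_real continuous_intros assms)

text \<open>Orthogonality of the characters for a single function;
  \<open>fourier_coeff_trig_series_times\<close> supplies the other frequencies by shifting the
  index.\<close>

lemma fourier_coeff_one: "fourier_coeff (\<lambda>x. 1) k = (if k = 0 then 1 else 0)"
proof (cases "k = 0")
  case False
  have "((\<lambda>x. cis (- (of_int k * x))) has_integral
     (\<i> / of_int k * cis (- (of_int k * pi)) - \<i> / of_int k * cis (- (of_int k * - pi)))) {-pi..pi}"
  proof (rule fundamental_theorem_of_calculus)
    fix x :: real
    have "((\<lambda>z. \<i> / of_int k * exp (- (\<i> * of_int k * z))) has_field_derivative
        exp (- (\<i> * of_int k * of_real x))) (at (of_real x))"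
      using False by (auto intro!: derivative_eq_intros simp: field_simps)
    from has_vector_derivative_real_field[OF this]
    show "((\<lambda>x. \<i> / of_int k * cis (- (of_int k * x))) has_vector_derivative cis (- (of_int k * x)))
        (at x within {-pi..pi})"
      by (simp add: cis_conv_exp mult_ac)
  qed simp
  moreover have "cis (- (of_int k * pi)) = cis (- (of_int k * - pi))"
  proof -
    have "cis (of_int k * pi) = cis (- (of_int k * pi)) * cis (2 * pi * of_int k)"
      by (simp add: cis_mult algebra_simps)
    then show ?thesis using cis_multiple_2pi[of "of_int k"] by simp
  qed
  ultimately have "((\<lambda>x. cis (- (of_int k * x))) has_integral 0) {-pi..pi}" by simp
  then show ?thesis using False
    by (simp add: fourier_coeff_continuous integral_unique)
qed (simp add: fourier_coeff_continuous scaleR_conv_of_real)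

text \<open>Multiplying by a character shifts the Fourier index, and uniform convergence permits
  termwise integration. With g = 1 this recovers the coefficients of a series, with g a series it is
  the convolution theorem.\<close>

lemma fourier_coeff_trig_series_times:
  assumes a: "(\<lambda>k. cmod (a k)) summable_on UNIV" and g: "continuous_on {-pi..pi} g"
  shows "fourier_coeff (\<lambda>x. trig_series a x * g x) k = (\<Sum>\<^sub>\<infinity>j. a j * fourier_coeff g (k - j))"
proof -
  have "bounded (g ` {-pi..pi})"
    by (intro compact_imp_bounded compact_continuous_image g compact_Icc)
  then obtain B where "\<forall>y\<in>g ` {-pi..pi}. cmod y \<le> B" unfolding bounded_iff by blast
  then have B: "\<And>x. x \<in> {-pi..pi} \<Longrightarrow> cmod (g x) \<le> B" by blast
  define f where "f j x = a j * (g x * cis (- (of_int (k - j) * x)))" for j x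
  have "uniform_limit {-pi..pi} (\<lambda>F x. \<Sum>j\<in>F. f j x) (\<lambda>x. \<Sum>\<^sub>\<infinity>j. f j x) (finite_subsets_at_top UNIV)"
  proof (rule Weierstrass_m_test_general)
    show "(\<lambda>j. cmod (a j) * B) summable_on UNIV" by (rule summable_on_cmult_left[OF a])
  qed (auto simp: f_def norm_mult intro!: mult_left_mono B)
  then obtain I J where I: "\<And>F. ((\<lambda>x. \<Sum>j\<in>F. f j x) has_integral I F) {-pi..pi}"
    and J: "((\<lambda>x. \<Sum>\<^sub>\<infinity>j. f j x) has_integral J) {-pi..pi}"
    and lim: "(I \<longlongrightarrow> J) (finite_subsets_at_top UNIV)"
  proof (rule uniform_limit_integral)
    show "continuous_on {- pi..pi} (\<lambda>x. \<Sum>j\<in>F. f j x)" for F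
      unfolding f_def by (intro continuous_intros g)
  qed auto
  have fi: "(f j has_integral a j * (2 * pi * fourier_coeff g (k - j))) {-pi..pi}" for j
  proof -
    have "(\<lambda>x. g x * cis (- (of_int (k - j) * x))) integrable_on {-pi..pi}"
      by (intro integrable_continuous_real continuous_intros g)
    from has_integral_mult_right[OF integrable_integral[OF this], of "a j"] show ?thesis
      unfolding f_def by (simp add: fourier_coeff_continuous[OF g])
  qed
  have "I F = 2 * pi * (\<Sum>j\<in>F. a j * fourier_coeff g (k - j))" if "finite F" for F
    using has_integral_unique[OF I[of F] has_integral_sum[OF that fi]]
    by (simp add: sum_distrib_left mult_ac)
  then have "((\<lambda>F. 2 * pi * (\<Sum>j\<in>F. a j * fourier_coeff g (k - j))) \<longlongrightarrow> J) (finite_subsets_at_top UNIV)"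
    using lim by (auto elim!: Lim_transform_eventually intro!: eventually_finite_subsets_at_top_weakI)
  then have "((\<lambda>F. (2 * pi * (\<Sum>j\<in>F. a j * fourier_coeff g (k - j))) / (2 * pi)) \<longlongrightarrow> J / (2 * pi))
      (finite_subsets_at_top UNIV)"
    by (intro tendsto_divide) auto
  then have "((\<lambda>j. a j * fourier_coeff g (k - j)) has_sum (J / (2 * pi))) UNIV"
    by (simp add: has_sum_def)
  then have "(\<Sum>\<^sub>\<infinity>j. a j * fourier_coeff g (k - j)) = J / (2 * pi)" by (rule infsumI)
  moreover have "(\<Sum>\<^sub>\<infinity>j. f j x) = trig_series a x * g x * cis (- (of_int k * x))" for x
  proof -
    have "f j x = a j * cis (of_int j * x) * (g x * cis (- (of_int k * x)))" for j
    proof -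
      have "cis (- (of_int (k - j) * x)) = cis (of_int j * x) * cis (- (of_int k * x))"
        by (simp add: cis_mult algebra_simps)
      then show ?thesis by (simp add: f_def)
    qed
    then have "(\<Sum>\<^sub>\<infinity>j. f j x) = trig_series a x * (g x * cis (- (of_int k * x)))"
      by (simp only: trig_series_def infsum_cmult_left')
    then show ?thesis by (simp only: mult.assoc)
  qed
  moreover have "continuous_on {-pi..pi} (\<lambda>x. trig_series a x * g x)"
    by (intro continuous_intros continuous_on_trig_series a g)
  ultimately show ?thesis
    using J by (simp add: fourier_coeff_continuous integral_unique)
qed

lemma fourier_coeff_trig_series:
  assumes "(\<lambda>k. cmod (a k)) summable_on UNIV"
  shows "fourier_coeff (trig_series a) = a"
proof
  fix k
  have "fourier_coeff (trig_series a) k = (\<Sum>\<^sub>\<infinity>j. a j * (if k - j = 0 then 1 else 0))"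
    using fourier_coeff_trig_series_times[OF assms, of "\<lambda>x. 1" k] by (simp add: fourier_coeff_one)
  also have "\<dots> = a k" by (subst infsum_cong_neutral[where T="{k}" and g="\<lambda>j. a j"]) auto
  finally show "fourier_coeff (trig_series a) k = a k" .
qed

lemma fourier_coeff_trig_series_mult:
  assumes "(\<lambda>k. cmod (a k)) summable_on UNIV" "(\<lambda>k. cmod (b k)) summable_on UNIV"
  shows "fourier_coeff (\<lambda>x. trig_series a x * trig_series b x) = twisted_conv (\<lambda>k j. 1) a b"
  by (simp add: fun_eq_iff twisted_conv_def continuous_on_trig_series[OF assms(2)]
      fourier_coeff_trig_series_times[OF assms(1)] fourier_coeff_trig_series[OF assms(2)])

section \<open>Almost everywhere equality, Sobolev norms and coefficients\<close>

abbreviation torus :: "real measure" where "torus \<equiv> lebesgue_on {-pi..pi}"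

lemma measurable_continuous_torus [measurable]:
  "continuous_on {-pi..pi} f \<Longrightarrow> f \<in> borel_measurable torus"
  by (intro continuous_imp_measurable_on_sets_lebesgue) auto

lemma measurable_character [measurable]: "(\<lambda>x. cis (- (of_int k * x))) \<in> borel_measurable torus"
  by (intro measurable_continuous_torus continuous_intros)

lemma fourier_coeff_cong_AE:
  assumes "f \<in> borel_measurable torus" "g \<in> borel_measurable torus" "AE x in torus. f x = g x"
  shows "fourier_coeff f = fourier_coeff g"
proof -
  have "(LINT x|torus. f x * cis (- (of_int k * x))) = (LINT x|torus. g x * cis (- (of_int k * x)))" for k :: int
    using assms by (intro integral_cong_AE borel_measurable_times measurable_character) auto
  then show ?thesis by (simp add: fourier_coeff_def fun_eq_iff)
qed

lemma trig_series_coeff_AE: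
  assumes f: "f \<in> borel_measurable torus" and ae: "AE x in torus. f x = trig_series a x"
    and a: "(\<lambda>k. cmod (a k)) summable_on UNIV"
  shows "fourier_coeff f = a"
  using fourier_coeff_cong_AE[OF f _ ae] fourier_coeff_trig_series[OF a]
  by (simp add: measurable_continuous_torus continuous_on_trig_series[OF a])

lemma sobolev_measurable: "f \<in> sobolev s \<Longrightarrow> f \<in> borel_measurable torus"
  by (simp add: sobolev_def)

lemma sobolev_integrable:
  assumes "f \<in> sobolev s"
  shows "integrable torus f"
proof (rule Bochner_Integration.integrable_bound)
  show "integrable torus (\<lambda>x. 1 + (cmod (f x))\<^sup>2)"
    using assms by (auto simp: sobolev_def)
  have "cmod (f x) \<le> 1 + (cmod (f x))\<^sup>2" for x
    using zero_le_power2[of "cmod (f x) - 1/2"] by (simp add: power2_eq_square algebra_simps)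
  then show "AE x in torus. norm (f x) \<le> norm (1 + (cmod (f x))\<^sup>2)" by simp
qed (use assms in \<open>simp add: sobolev_def\<close>)

lemma fourier_coeff_diff:
  assumes "integrable torus f" "integrable torus g"
  shows "fourier_coeff (\<lambda>x. f x - g x) k = fourier_coeff f k - fourier_coeff g k"
proof -
  have "integrable torus (\<lambda>x. h x * cis (- (of_int k * x)))" if "integrable torus h" for h
    using that borel_measurable_integrable[OF that]
    by (rule_tac Bochner_Integration.integrable_bound[OF that])
       (auto simp: norm_mult intro!: borel_measurable_times measurable_character)
  from Bochner_Integration.integral_diff[OF this[OF assms(1)] this[OF assms(2)]]
  show ?thesis by (simp add: fourier_coeff_def left_diff_distrib diff_divide_distrib)
qed

text \<open>Together with \<open>summable_hs_bounded\<close> this identifies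
  \<open>hs_bounded\<close> with summability plus a bound on the norm.\<close>

lemma hs_bounded_summable:
  assumes "hs_bounded s M a"
  shows "(\<lambda>k. (1 + (of_int k)\<^sup>2) powr s * (cmod (a k))\<^sup>2) summable_on UNIV"
    and "sqrt (\<Sum>\<^sub>\<infinity>k. (1 + (of_int k)\<^sup>2) powr s * (cmod (a k))\<^sup>2) \<le> M"
proof -
  have M: "0 \<le> M" using assms by (rule hs_bounded_nonneg)
  have b: "(\<Sum>k\<in>F. (1 + (of_int k)\<^sup>2) powr s * (cmod (a k))\<^sup>2) \<le> M\<^sup>2" if "finite F" for F
  proof -
    have "(L2_set (\<lambda>k. bracket s k * cmod (a k)) F)\<^sup>2 \<le> M\<^sup>2"
      by (intro power_mono hs_boundedD assms that) auto
    then show ?thesis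
      by (simp add: L2_set_def sum_nonneg power_mult_distrib bracket_square)
  qed
  show s: "(\<lambda>k. (1 + (of_int k)\<^sup>2) powr s * (cmod (a k))\<^sup>2) summable_on UNIV"
    by (intro nonneg_bdd_above_summable_on bdd_aboveI2[where M="M\<^sup>2"]) (auto intro: b)
  have "(\<Sum>\<^sub>\<infinity>k. (1 + (of_int k)\<^sup>2) powr s * (cmod (a k))\<^sup>2) \<le> M\<^sup>2"
    by (rule infsum_le_finite_sums[OF s b])
  then show "sqrt (\<Sum>\<^sub>\<infinity>k. (1 + (of_int k)\<^sup>2) powr s * (cmod (a k))\<^sup>2) \<le> M"
    using M real_sqrt_le_mono by fastforce
qed

lemma summable_hs_bounded:
  assumes "(\<lambda>k. (1 + (of_int k)\<^sup>2) powr s * (cmod (a k))\<^sup>2) summable_on UNIV"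
  shows "hs_bounded s (sqrt (\<Sum>\<^sub>\<infinity>k. (1 + (of_int k)\<^sup>2) powr s * (cmod (a k))\<^sup>2)) a"
  using L2_set_le_sqrt_infsum[of "\<lambda>k. bracket s k * cmod (a k)"] assms
  by (intro hs_boundedI) (simp add: power_mult_distrib bracket_square)

lemma sobolev_hs_bounded: "f \<in> sobolev s \<Longrightarrow> hs_bounded s (sobolev_norm s f) (fourier_coeff f)"
  unfolding sobolev_norm_def by (rule summable_hs_bounded) (simp add: sobolev_def)

lemma sobolev_norm_le: "hs_bounded s M (fourier_coeff f) \<Longrightarrow> sobolev_norm s f \<le> M"
  unfolding sobolev_norm_def by (rule hs_bounded_summable)

lemma sobolev_diff_hs_bounded:
  assumes "f \<in> sobolev s" "g \<in> sobolev s"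
  shows "hs_bounded s (sobolev_norm s (\<lambda>x. f x - g x)) (\<lambda>k. fourier_coeff f k - fourier_coeff g k)"
proof -
  have eq: "fourier_coeff (\<lambda>x. f x - g x) = (\<lambda>k. fourier_coeff f k - fourier_coeff g k)"
    using assms by (auto simp: fourier_coeff_diff sobolev_integrable)
  \<comment> \<open>The crude triangle bound provides summability of the difference; only then does
    \<open>sobolev_norm\<close> of the difference denote its true norm.\<close>
  have "hs_bounded s (sobolev_norm s f + sobolev_norm s g) (fourier_coeff (\<lambda>x. f x - g x))"
    unfolding eq using assms by (intro hs_bounded_diff sobolev_hs_bounded)
  from summable_hs_bounded[OF hs_bounded_summable(1)[OF this]]
  show ?thesis unfolding sobolev_norm_def eq .
qed

text \<open>Membership also asks for square integrability of the function itself, which is inherited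
  from the continuous series equal to it almost everywhere.\<close>

lemma sobolev_trig_seriesI:
  assumes per: "\<And>x. f (x + 2 * pi) = f x" and meas: "f \<in> borel_measurable torus"
    and ae: "AE x in torus. f x = trig_series a x"
    and a: "(\<lambda>k. cmod (a k)) summable_on UNIV" and M: "hs_bounded s M a"
  shows "f \<in> sobolev s" and "sobolev_norm s f \<le> M"
proof -
  have fa: "fourier_coeff f = a"
    by (rule trig_series_coeff_AE[OF meas ae a])
  have "integrable torus (\<lambda>x. (cmod (trig_series a x))\<^sup>2)"
    by (intro continuous_imp_integrable_real continuous_intros continuous_on_trig_series a)
  moreover have "(\<lambda>x. (cmod (f x))\<^sup>2) \<in> borel_measurable torus" using meas by simp
  ultimately have "integrable torus (\<lambda>x. (cmod (f x))\<^sup>2)"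
    using ae by (subst integrable_cong_AE[where g="\<lambda>x. (cmod (trig_series a x))\<^sup>2"])
      (auto simp: borel_measurable_integrable)
  then show "f \<in> sobolev s"
    using per meas hs_bounded_summable(1)[OF M] by (simp add: sobolev_def fa)
  show "sobolev_norm s f \<le> M" by (rule sobolev_norm_le) (simp add: fa M)
qed

text \<open>Reverse triangle inequality. It makes the norms bounded on [0, T], without which the
  real \<open>SUP\<close> would bound nothing.\<close>

lemma sobolev_norm_continuous:
  assumes "sobolev_continuous_on I s u"
  shows "continuous_on I (\<lambda>t. sobolev_norm s (u t))"
  unfolding continuous_on_def
proof
  fix t assume t: "t \<in> I"
  have us: "t' \<in> I \<Longrightarrow> u t' \<in> sobolev s" for t'
    using assms by (simp add: sobolev_continuous_on_def)
  have lim: "((\<lambda>t'. sobolev_norm s (\<lambda>x. u t' x - u t x)) \<longlongrightarrow> 0) (at t within I)"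
    using assms t by (simp add: sobolev_continuous_on_def)
  have "((\<lambda>t'. sobolev_norm s (u t') - sobolev_norm s (u t)) \<longlongrightarrow> 0) (at t within I)"
  proof (rule Lim_null_comparison[OF _ lim])
    have "\<bar>sobolev_norm s (u t') - sobolev_norm s (u t)\<bar> \<le> sobolev_norm s (\<lambda>x. u t' x - u t x)"
      if t': "t' \<in> I" for t'
    proof -
      note d = sobolev_diff_hs_bounded[OF us[OF t'] us[OF t]]
      have "sobolev_norm s (u t') \<le> sobolev_norm s (\<lambda>x. u t' x - u t x) + sobolev_norm s (u t)"
        using hs_bounded_add[OF d sobolev_hs_bounded[OF us[OF t]]] by (intro sobolev_norm_le) simp
      moreover have "sobolev_norm s (u t) \<le> sobolev_norm s (u t') + sobolev_norm s (\<lambda>x. u t' x - u t x)"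
        using hs_bounded_diff[OF sobolev_hs_bounded[OF us[OF t']] d] by (intro sobolev_norm_le) simp
      ultimately show ?thesis by linarith
    qed
    then show "\<forall>\<^sub>F t' in at t within I. norm (sobolev_norm s (u t') - sobolev_norm s (u t))
        \<le> sobolev_norm s (\<lambda>x. u t' x - u t x)"
      by (auto simp: eventually_at_filter)
  qed
  then show "((\<lambda>t. sobolev_norm s (u t)) \<longlongrightarrow> sobolev_norm s (u t)) (at t within I)"
    by (rule LIM_zero_cancel)
qed

lemma fourier_coeff_continuous_on:
  assumes u: "sobolev_continuous_on I s u" and s: "0 \<le> s"
  shows "continuous_on I (\<lambda>t. fourier_coeff (u t) k)"
  unfolding continuous_on_def
proof
  fix t assume t: "t \<in> I"
  have lim: "((\<lambda>t'. sobolev_norm s (\<lambda>x. u t' x - u t x)) \<longlongrightarrow> 0) (at t within I)"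
    using u t by (simp add: sobolev_continuous_on_def)
  have "((\<lambda>t'. fourier_coeff (u t') k - fourier_coeff (u t) k) \<longlongrightarrow> 0) (at t within I)"
  proof (rule Lim_null_comparison[OF _ lim])
    show "\<forall>\<^sub>F t' in at t within I. cmod (fourier_coeff (u t') k - fourier_coeff (u t) k)
        \<le> sobolev_norm s (\<lambda>x. u t' x - u t x)"
      using u t hs_bounded_coeff_le[OF sobolev_diff_hs_bounded s]
      by (auto simp: eventually_at_filter sobolev_continuous_on_def)
  qed
  then show "((\<lambda>t. fourier_coeff (u t) k) \<longlongrightarrow> fourier_coeff (u t) k) (at t within I)"
    by (rule LIM_zero_cancel)
qed

abbreviation conv :: "(int \<Rightarrow> complex) \<Rightarrow> (int \<Rightarrow> complex) \<Rightarrow> int \<Rightarrow> complex" where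
  "conv \<equiv> twisted_conv (\<lambda>k j. 1)"

lemma conv_hs_bounded:
  assumes "1 / 2 < s" "hs_bounded s A a" "hs_bounded s B b"
  shows "\<exists>C. hs_bounded s C (conv a b)"
  using twisted_conv_bounded_estimate[OF assms(1)] assms
  by (metis (no_types, lifting) abs_of_nonneg less_eq_real_def norm_one order_refl
      order_less_trans zero_less_divide_1_iff zero_less_numeral)

section \<open>Symbols of the linear operators\<close>

locale bbm =
  fixes P :: "complex poly" and \<epsilon> :: real
  assumes Re_P: "\<And>x::real. Re (poly P (\<i> * of_real x)) = 0" and \<epsilon>: "0 < \<epsilon>"
begin

text \<open>The a_k of the interaction picture: the symbol of the linear part is purely imaginary,
  as Re P vanishes on the imaginary axis.\<close>

definition freq :: "int \<Rightarrow> real" where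
  "freq k = Im (poly P (\<i> * of_int k)) / (1 + \<epsilon> * (of_int k)\<^sup>2)"

definition lsym :: "int \<Rightarrow> complex" where
  "lsym k = \<i> * of_int k / (1 + of_real \<epsilon> * (of_int k)\<^sup>2)"

lemma exp_L_eq: "exp_L P \<epsilon> t f = trig_series (\<lambda>k. cis (t * freq k) * fourier_coeff f k)"
proof -
  have "exp (of_real t * poly P (\<i> * of_int k) / (1 + of_real \<epsilon> * (of_int k)\<^sup>2)) = cis (t * freq k)" for k
  proof -
    have "Re (poly P (\<i> * of_int k)) = 0" using Re_P[of "of_int k"] by simp
    then have "poly P (\<i> * of_int k) = \<i> * of_real (Im (poly P (\<i> * of_int k)))"
      by (simp add: complex_eq_iff)
    then have "of_real t * poly P (\<i> * of_int k) / (1 + of_real \<epsilon> * (of_int k)\<^sup>2) = \<i> * of_real (t * freq k)"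
      by (simp add: freq_def)
    then show ?thesis by (simp add: cis_conv_exp)
  qed
  then show ?thesis by (simp add: exp_L_def fourier_multiplier_eq)
qed

lemma L_eps_eq: "L_eps \<epsilon> f = trig_series (\<lambda>k. lsym k * fourier_coeff f k)"
  by (simp add: L_eps_def fourier_multiplier_eq lsym_def)

lemma denominator_ge_1: "1 \<le> 1 + \<epsilon> * (of_int k)\<^sup>2"
  using \<epsilon> by simp

lemma norm_lsym: "cmod (lsym k) = \<bar>of_int k\<bar> / (1 + \<epsilon> * (of_int k)\<^sup>2)"
proof -
  have "lsym k = \<i> * (of_real (of_int k / (1 + \<epsilon> * (of_int k)\<^sup>2)))" by (simp add: lsym_def)
  then have "cmod (lsym k) = \<bar>of_int k / (1 + \<epsilon> * (of_int k)\<^sup>2)\<bar>"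
    by (simp only: norm_mult norm_ii norm_of_real mult_1)
  then show ?thesis using denominator_ge_1[of k] by simp
qed

text \<open>Integrality gives |k| <= k^2, so the denominator dominates the numerator for every
  positive \<epsilon>.\<close>

lemma eps_lsym_le_1: "cmod (\<epsilon> * lsym k) \<le> 1"
proof -
  have "\<bar>k\<bar> * 1 \<le> \<bar>k\<bar> * \<bar>k\<bar>" using mult_left_mono[of 1 "\<bar>k\<bar>" "\<bar>k\<bar>"] by (cases "k = 0") auto
  then have "of_int \<bar>k\<bar> \<le> (of_int (k\<^sup>2) :: real)"
    by (simp only: of_int_le_iff) (simp add: power2_eq_square abs_mult_self_eq)
  then have "\<bar>of_int k\<bar> \<le> (of_int k :: real)\<^sup>2" by simp
  then have "\<epsilon> * \<bar>of_int k\<bar> \<le> \<epsilon> * (of_int k)\<^sup>2" using \<epsilon> by (intro mult_left_mono) auto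
  then have "\<epsilon> * \<bar>of_int k\<bar> / (1 + \<epsilon> * (of_int k)\<^sup>2) \<le> 1"
    using denominator_ge_1[of k] by (subst pos_divide_le_eq) auto
  then show ?thesis using \<epsilon> by (simp add: norm_mult norm_lsym)
qed

lemma lsym_le: "cmod (lsym k) \<le> 1 / \<epsilon>"
  using eps_lsym_le_1[of k] \<epsilon> by (simp add: norm_mult field_simps)

definition phase :: "int \<Rightarrow> int \<Rightarrow> real" where
  "phase k j = freq k - freq j - freq (k - j)"

text \<open>The phase is a difference of single-frequency terms, so twisting by it amounts to
  conjugating the plain convolution with the free flow. This links products in physical space to the
  interaction picture.\<close>

lemma twisted_conv_gauge:
  "twisted_conv (\<lambda>k j. cis (t * phase k j)) a b k
    = cis (t * freq k) * conv (\<lambda>j. cis (- t * freq j) * a j) (\<lambda>j. cis (- t * freq j) * b j) k"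
proof -
  have "cis (t * phase k j) = cis (t * freq k) * cis (- t * freq j) * cis (- t * freq (k - j))" for j
    by (simp add: cis_mult phase_def algebra_simps)
  then show ?thesis by (simp add: twisted_conv_def mult_ac flip: infsum_cmult_right')
qed

end

section \<open>Mild solutions and splitting iterates in Fourier space\<close>

context bbm
begin

text \<open>All intermediate functions are absolutely convergent series: the multipliers are bounded
  by 1 or 1/\<epsilon>, and products stay in order s > 1/2. The bound B may depend badly on
  \<epsilon>; only its existence matters here.\<close>

lemma strang_step_series:
  fixes \<tau> :: real
  assumes s: "1 / 2 < s" and w: "w \<in> borel_measurable torus"
    and z: "AE x in torus. w x = trig_series z x" "hs_bounded s A z"
  defines "v \<equiv> (\<lambda>k. cis (- \<tau> / 2 * freq k) * z k)"
  defines "z' \<equiv> (\<lambda>k. cis (- \<tau> * freq k) * z k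
      - \<tau> * (cis (- \<tau> / 2 * freq k) * ((\<epsilon> * lsym k) * conv v v k))
      + \<tau>\<^sup>2 * (cis (- \<tau> / 2 * freq k) * ((\<epsilon> * lsym k) * conv v (\<lambda>j. (\<epsilon> * lsym j) * conv v v j) k)))"
  shows "strang_step P \<epsilon> \<tau> w = trig_series z'" and "\<exists>B. hs_bounded s B z'"
proof -
  have sm: "(\<lambda>k. cmod (a k)) summable_on UNIV" if "\<exists>B. hs_bounded s B a" for a
    using hs_bounded_abs_summable[OF s] that by blast
  have mult: "\<exists>B. hs_bounded s B (\<lambda>k. m k * a k)" if "\<exists>B. hs_bounded s B a" "\<And>k. cmod (m k) \<le> D" for a m D
    using hs_bounded_multiplier_le that by blast
  have conv: "\<exists>B. hs_bounded s B (conv a b)" if "\<exists>B. hs_bounded s B a" "\<exists>B. hs_bounded s B b" for a b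
    using conv_hs_bounded[OF s] that by blast
  have fw: "fourier_coeff w = z"
    by (rule trig_series_coeff_AE[OF w z(1) hs_bounded_abs_summable[OF s z(2)]])
  have z': "\<exists>B. hs_bounded s B z" using z by blast
  have v: "\<exists>B. hs_bounded s B v" unfolding v_def by (rule mult[where D=1, OF z']) simp
  define b where "b = (\<lambda>k. lsym k * conv v v k)"
  have b: "\<exists>B. hs_bounded s B b" unfolding b_def by (rule mult[OF conv[OF v v] lsym_le])
  define c where "c = (\<lambda>k. lsym k * conv v b k)"
  have c: "\<exists>B. hs_bounded s B c" unfolding c_def by (rule mult[OF conv[OF v b] lsym_le])
  have ev: "exp_L P \<epsilon> (- \<tau> / 2) w = trig_series v"
    unfolding exp_L_eq fw v_def ..
  have eb: "L_eps \<epsilon> (\<lambda>y. (trig_series v y)\<^sup>2) = trig_series b"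
    unfolding L_eps_eq b_def power2_eq_square by (simp add: fourier_coeff_trig_series_mult sm v)
  have ec: "L_eps \<epsilon> (\<lambda>y. trig_series v y * trig_series b y) = trig_series c"
    unfolding L_eps_eq c_def by (simp add: fourier_coeff_trig_series_mult sm v b)
  define z1 where "z1 = (\<lambda>k. cis (- \<tau> * freq k) * z k)"
  define z2 where "z2 = (\<lambda>k. cis (- \<tau> / 2 * freq k) * b k)"
  define z3 where "z3 = (\<lambda>k. cis (- \<tau> / 2 * freq k) * c k)"
  have zs: "\<exists>B. hs_bounded s B z1" "\<exists>B. hs_bounded s B z2" "\<exists>B. hs_bounded s B z3"
    unfolding z1_def z2_def z3_def
    by (rule mult[where D=1, OF z'], simp, rule mult[where D=1, OF b], simp, rule mult[where D=1, OF c], simp)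
  have sc: "\<exists>B. hs_bounded s B (\<lambda>k. x * a k)" if "\<exists>B. hs_bounded s B a" for a x
    by (rule mult[OF that order_refl])
  \<comment> \<open>Grouped as z1 - (x - y), so that differences and scaling suffice.\<close>
  have lin: "trig_series (\<lambda>k. z1 k - (of_real (\<tau> * \<epsilon>) * z2 k - of_real (\<tau>\<^sup>2 * \<epsilon>\<^sup>2) * z3 k)) x
      = trig_series z1 x - (of_real (\<tau> * \<epsilon>) * trig_series z2 x - of_real (\<tau>\<^sup>2 * \<epsilon>\<^sup>2) * trig_series z3 x)" for x
  proof -
    have "\<exists>B. hs_bounded s B (\<lambda>k. of_real (\<tau> * \<epsilon>) * z2 k - of_real (\<tau>\<^sup>2 * \<epsilon>\<^sup>2) * z3 k)"
      using sc[OF zs(2)] sc[OF zs(3)] hs_bounded_diff by blast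
    then show ?thesis
      by (simp only: trig_series_diff trig_series_scale sm sc zs)
  qed
  \<comment> \<open>The scheme has \<epsilon>^2 in front, the interaction picture one \<epsilon>
    with each symbol; the inner one is pulled out of the convolution.\<close>
  have cs: "conv v (\<lambda>j. (\<epsilon> * lsym j) * conv v v j) k = \<epsilon> * conv v b k" for k
  proof -
    have "conv v (\<lambda>j. \<epsilon> * b j) k = \<epsilon> * conv v b k"
      by (subst (1 2) twisted_conv_commute[of "\<lambda>k j. 1" v]) (simp_all add: twisted_conv_scale_left)
    then show ?thesis by (simp add: b_def mult.assoc)
  qed
  have z'_eq: "z' = (\<lambda>k. z1 k - (of_real (\<tau> * \<epsilon>) * z2 k - of_real (\<tau>\<^sup>2 * \<epsilon>\<^sup>2) * z3 k))"
    unfolding z'_def z1_def z2_def z3_def c_def cs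
    by (simp add: b_def fun_eq_iff power2_eq_square algebra_simps)
  have e1: "exp_L P \<epsilon> (- \<tau>) w = trig_series z1" unfolding exp_L_eq fw z1_def ..
  have e2: "exp_L P \<epsilon> (- \<tau> / 2) (trig_series b) = trig_series z2"
    unfolding exp_L_eq fourier_coeff_trig_series[OF sm[OF b]] z2_def ..
  have e3: "exp_L P \<epsilon> (- \<tau> / 2) (trig_series c) = trig_series z3"
    unfolding exp_L_eq fourier_coeff_trig_series[OF sm[OF c]] z3_def ..
  show "strang_step P \<epsilon> \<tau> w = trig_series z'"
    unfolding strang_step_def Let_def ev eb ec e1 e2 e3 z'_eq by (simp only: fun_eq_iff lin) simp
  show "\<exists>B. hs_bounded s B z'"
    unfolding z'_eq using sc[OF zs(2)] sc[OF zs(3)] zs(1) hs_bounded_diff by blast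
qed

section \<open>Fourier coefficients of a mild solution\<close>

context
  fixes T s M :: real and u :: "real \<Rightarrow> real \<Rightarrow> complex" and U :: "real \<Rightarrow> int \<Rightarrow> complex"
  assumes T: "0 < T" and s: "1 / 2 < s" and mild: "mild_solution P \<epsilon> T u"
    and u: "sobolev_continuous_on {0..T} s u"
    and M: "\<forall>t\<in>{0..T}. sobolev_norm s (u t) \<le> M"
    and U: "\<And>t. U t = fourier_coeff (u t)"
begin

lemma u_measurable: "t \<in> {0..T} \<Longrightarrow> u t \<in> borel_measurable torus"
  using u by (auto simp: sobolev_continuous_on_def intro: sobolev_measurable)

lemma U_bounded: "t \<in> {0..T} \<Longrightarrow> hs_bounded s M (U t)"
  unfolding U using u M
  by (intro hs_bounded_mono[OF sobolev_hs_bounded]) (auto simp: sobolev_continuous_on_def)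

lemma U_summable: "t \<in> {0..T} \<Longrightarrow> (\<lambda>k. cmod (U t k)) summable_on UNIV"
  by (rule hs_bounded_abs_summable[OF s U_bounded])

lemma mild_at:
  "t \<in> {0..T} \<Longrightarrow> AE x in torus. u t x = exp_L P \<epsilon> (- t) (u 0) x - \<epsilon> * L_eps \<epsilon> (\<lambda>y.
    integral {0..t} (\<lambda>x. exp_L P \<epsilon> (- (t - x)) (\<lambda>z. (u x z)\<^sup>2) y)) x"
  using mild unfolding mild_solution_def by blast

text \<open>The mild formula displays \<open>u t\<close> as an absolutely convergent Fourier series: the series
  of the integral term, if it is not absolutely convergent, is the junk value \<open>0\<close>.
  Completeness of the trigonometric system is therefore not needed.\<close>

lemma u_eq_trig_series:
  assumes t: "t \<in> {0..T}"
  shows "AE x in torus. u t x = trig_series (U t) x"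
proof -
  define c1 where "c1 = (\<lambda>k. cis (- t * freq k) * U 0 k)"
  define c2 where "c2 = (\<lambda>k. lsym k * fourier_coeff (\<lambda>y.
    integral {0..t} (\<lambda>x. exp_L P \<epsilon> (- (t - x)) (\<lambda>z. (u x z)\<^sup>2) y)) k)"
  have ae: "AE x in torus. u t x = trig_series c1 x - \<epsilon> * trig_series c2 x"
    using mild_at[OF t] unfolding exp_L_eq[of "- t"] L_eps_eq c1_def c2_def U .
  have c1: "(\<lambda>k. cmod (c1 k)) summable_on UNIV"
    unfolding c1_def using U_summable[of 0] T by (simp add: norm_mult)
  obtain a where a: "(\<lambda>k. cmod (a k)) summable_on UNIV"
    and eq: "\<And>x. trig_series c1 x - \<epsilon> * trig_series c2 x = trig_series a x"
  proof (cases "(\<lambda>k. cmod (c2 k)) summable_on UNIV")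
    case True
    then have c2: "(\<lambda>k. cmod (\<epsilon> * c2 k)) summable_on UNIV"
      by (simp add: norm_mult summable_on_cmult_right)
    have "(\<lambda>k. cmod (c1 k) + cmod (\<epsilon> * c2 k)) summable_on UNIV"
      by (intro summable_on_add c1 c2)
    then have "(\<lambda>k. cmod (c1 k - \<epsilon> * c2 k)) summable_on UNIV"
      by (rule summable_on_comparison_test) (auto intro: norm_triangle_ineq4)
    then show ?thesis
      by (rule that) (simp add: trig_series_diff[OF c1 c2] trig_series_scale)
  next
    case False
    show ?thesis by (rule that[OF c1]) (simp add: trig_series_not_summable[OF False])
  qed
  have "AE x in torus. u t x = trig_series a x" using ae by (simp only: eq)
  then show ?thesis
    using trig_series_coeff_AE[OF u_measurable[OF t] _ a] by (simp add: U)
qed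

lemma fourier_coeff_square:
  assumes t: "t \<in> {0..T}"
  shows "fourier_coeff (\<lambda>x. (u t x)\<^sup>2) = conv (U t) (U t)"
proof -
  have "fourier_coeff (\<lambda>x. (u t x)\<^sup>2) = fourier_coeff (\<lambda>x. trig_series (U t) x * trig_series (U t) x)"
    using u_eq_trig_series[OF t] u_measurable[OF t]
    by (intro fourier_coeff_cong_AE borel_measurable_power measurable_continuous_torus[OF continuous_on_mult]
        continuous_on_trig_series U_summable t) (auto simp: power2_eq_square)
  then show ?thesis
    unfolding fourier_coeff_trig_series_mult[OF U_summable[OF t] U_summable[OF t]] .
qed

lemma continuous_conv: "continuous_on {0..T} (\<lambda>t. conv (U t) (U t) k)"
proof -
  have M0: "0 \<le> M" using U_bounded[of 0] T hs_bounded_nonneg by auto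
  have c: "continuous_on {0..T} (\<lambda>t. U t k)" for k
    unfolding U using fourier_coeff_continuous_on[OF u] s by simp
  have "uniform_limit {0..T} (\<lambda>F t. \<Sum>j\<in>F. 1 * U t j * U t (k - j))
      (\<lambda>t. \<Sum>\<^sub>\<infinity>j. 1 * U t j * U t (k - j)) (finite_subsets_at_top UNIV)"
  proof (rule uniform_limit_hs_series[OF s U_bounded, where D=M])
    fix t j assume t: "t \<in> {0..T}"
    have "cmod (U t (k - j)) \<le> M" using hs_bounded_coeff_le[OF U_bounded[OF t]] s by simp
    then show "cmod (1 * U t j * U t (k - j)) \<le> M * cmod (U t j)"
      using mult_left_mono[of "cmod (U t (k - j))" M "cmod (U t j)"] by (simp add: norm_mult mult.commute)
  qed (use M0 in auto)
  then have "continuous_on {0..T} (\<lambda>t. \<Sum>\<^sub>\<infinity>j. 1 * U t j * U t (k - j))"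
    by (rule uniform_limit_theorem[rotated]) (auto intro!: always_eventually continuous_intros c)
  then show ?thesis by (simp add: twisted_conv_def)
qed

lemma conv_U_bounded: "\<exists>C. \<forall>t\<in>{0..T}. hs_bounded s C (conv (U t) (U t))"
proof -
  obtain C where C: "\<forall>q c D A B a b. \<bar>q\<bar> \<le> s \<longrightarrow> (\<forall>k j. cmod (c k j) \<le> D) \<longrightarrow>
    hs_bounded q A a \<longrightarrow> hs_bounded s B b \<longrightarrow>
    twisted_summable c a b \<and> hs_bounded q (C * D * A * B) (twisted_conv c a b)"
    using twisted_conv_bounded_estimate[OF s] by blast
  have "hs_bounded s (C * 1 * M * M) (conv (U t) (U t))" if "t \<in> {0..T}" for t
    using C[rule_format, of s "\<lambda>k j. 1" 1 M "U t" M "U t"] U_bounded[OF that] s by simp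
  then show ?thesis by blast
qed

text \<open>Duhamel's formula mode by mode. The time integral, taken pointwise in space, turns out
  to be the absolutely convergent series with coefficients G, after which coefficients can be read
  off the almost everywhere identity.\<close>

lemma mild_coeff:
  assumes t: "t \<in> {0..T}"
  shows "U t k = cis (- t * freq k) * U 0 k
    - \<epsilon> * (lsym k * integral {0..t} (\<lambda>x. cis (- (t - x) * freq k) * conv (U x) (U x) k))"
proof -
  define g where "g x k = cis (- (t - x) * freq k) * conv (U x) (U x) k" for x k
  define G where "G k = integral {0..t} (\<lambda>x. g x k)" for k
  obtain C where C: "\<forall>t\<in>{0..T}. hs_bounded s C (conv (U t) (U t))"
    using conv_U_bounded by blast
  have gb: "hs_bounded s (1 * C) (g x)" if "x \<in> {0..t}" for x
    unfolding g_def using C that t by (intro hs_bounded_multiplier_le) auto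
  have gc: "continuous_on {0..t} (\<lambda>x. g x k)" for k
    unfolding g_def using t by (intro continuous_intros continuous_on_subset[OF continuous_conv]) auto
  have G: "hs_bounded s ((t - 0) * (1 * C)) G"
    unfolding G_def[abs_def] using t by (intro hs_bounded_integral gb gc) auto
  have inner: "integral {0..t} (\<lambda>x. exp_L P \<epsilon> (- (t - x)) (\<lambda>z. (u x z)\<^sup>2) y) = trig_series G y" for y
  proof -
    have "integral {0..t} (\<lambda>x. exp_L P \<epsilon> (- (t - x)) (\<lambda>z. (u x z)\<^sup>2) y)
        = integral {0..t} (\<lambda>x. \<Sum>\<^sub>\<infinity>k. g x k * cis (of_int k * y))"
      using t by (intro Henstock_Kurzweil_Integration.integral_cong)
        (simp add: exp_L_eq fourier_coeff_square trig_series_def g_def)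
    moreover have "uniform_limit {0..t} (\<lambda>F x. \<Sum>k\<in>F. g x k * cis (of_int k * y))
        (\<lambda>x. \<Sum>\<^sub>\<infinity>k. g x k * cis (of_int k * y)) (finite_subsets_at_top UNIV)"
      by (rule uniform_limit_hs_series[OF s gb, where D=1]) (auto simp: norm_mult)
    then obtain I J where I: "\<And>F. ((\<lambda>x. \<Sum>k\<in>F. g x k * cis (of_int k * y)) has_integral I F) {0..t}"
      and J: "((\<lambda>x. \<Sum>\<^sub>\<infinity>k. g x k * cis (of_int k * y)) has_integral J) {0..t}"
      and lim: "(I \<longlongrightarrow> J) (finite_subsets_at_top UNIV)"
      by (rule uniform_limit_integral) (auto intro!: continuous_intros gc)
    have gi: "((\<lambda>x. g x k * cis (of_int k * y)) has_integral G k * cis (of_int k * y)) {0..t}" for k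
      unfolding G_def
      by (intro has_integral_mult_left integrable_integral integrable_continuous_real gc)
    have "I F = (\<Sum>k\<in>F. G k * cis (of_int k * y))" if "finite F" for F
      by (rule has_integral_unique[OF I[of F] has_integral_sum[OF that gi]])
    then have "((\<lambda>F. \<Sum>k\<in>F. G k * cis (of_int k * y)) \<longlongrightarrow> J) (finite_subsets_at_top UNIV)"
      using lim by (auto elim!: Lim_transform_eventually intro!: eventually_finite_subsets_at_top_weakI)
    then have "trig_series G y = J"
      unfolding trig_series_def by (intro infsumI) (simp add: has_sum_def)
    ultimately show ?thesis using J by (simp add: integral_unique)
  qed
  have Gs: "(\<lambda>k. cmod (G k)) summable_on UNIV" by (rule hs_bounded_abs_summable[OF s G])
  have ls: "hs_bounded s (1 / \<epsilon> * ((t - 0) * (1 * C))) (\<lambda>k. lsym k * G k)"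
    by (rule hs_bounded_multiplier_le[OF G lsym_le])
  define c1 where "c1 = (\<lambda>k. cis (- t * freq k) * U 0 k)"
  have c1: "(\<lambda>k. cmod (c1 k)) summable_on UNIV"
    unfolding c1_def using U_summable[of 0] T by (simp add: norm_mult)
  have c2: "(\<lambda>k. cmod (\<epsilon> * (lsym k * G k))) summable_on UNIV"
    by (rule hs_bounded_abs_summable[OF s hs_bounded_scale[OF ls]])
  have "(\<lambda>k. cmod (c1 k) + cmod (\<epsilon> * (lsym k * G k))) summable_on UNIV"
    by (intro summable_on_add c1 c2)
  then have c: "(\<lambda>k. cmod (c1 k - \<epsilon> * (lsym k * G k))) summable_on UNIV"
    by (rule summable_on_comparison_test) (auto intro: norm_triangle_ineq4)
  have "AE x in torus. u t x = trig_series c1 x - \<epsilon> * trig_series (\<lambda>k. lsym k * G k) x"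
    using mild_at[OF t]
    unfolding inner L_eps_eq fourier_coeff_trig_series[OF Gs] exp_L_eq[of "- t"] c1_def U .
  then have "AE x in torus. u t x = trig_series (\<lambda>k. c1 k - \<epsilon> * (lsym k * G k)) x"
    by (simp only: trig_series_diff[OF c1 c2] trig_series_scale)
  from trig_series_coeff_AE[OF u_measurable[OF t] this c]
  show ?thesis by (simp add: U[of t] c1_def G_def g_def)
qed

end

end

section \<open>Convergence\<close>

lemma abs_power_le_bracket: "\<bar>of_int k\<bar> ^ i \<le> bracket (real i) k"
proof (induction i)
  case (Suc i)
  have "\<bar>of_int k :: real\<bar> \<le> bracket 1 k"
    by (simp add: bracket_def powr_half_sqrt real_le_rsqrt)
  then have "\<bar>of_int k\<bar> * \<bar>of_int k\<bar> ^ i \<le> bracket 1 k * bracket (real i) k"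
    using Suc by (intro mult_mono) auto
  then show ?case using bracket_add[of 1 "real i" k] by simp
qed simp

lemma poly_growth:
  assumes "degree P \<le> l"
  shows "cmod (poly P (\<i> * of_int k)) \<le> (\<Sum>i\<le>degree P. cmod (coeff P i)) * bracket (real l) k"
proof -
  have "cmod (poly P (\<i> * of_int k)) \<le> (\<Sum>i\<le>degree P. cmod (coeff P i) * \<bar>of_int k\<bar> ^ i)"
    unfolding poly_altdef by (rule sum_norm_le) (simp add: norm_mult norm_power)
  also have "\<dots> \<le> (\<Sum>i\<le>degree P. cmod (coeff P i) * bracket (real l) k)"
    using assms by (intro sum_mono mult_left_mono order_trans[OF abs_power_le_bracket] bracket_mono) auto
  finally show ?thesis by (simp add: sum_distrib_right)
qed

lemma square_sum_le: "(x + y)\<^sup>2 \<le> 2 * (x\<^sup>2 + (y :: real)\<^sup>2)"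
  using zero_le_power2[of "x - y"] by (simp add: power2_eq_square algebra_simps)

lemma powr_sum_le:
  fixes x y \<theta> :: real
  assumes "0 \<le> x" "0 \<le> y" "0 \<le> \<theta>"
  shows "(x + y) powr \<theta> \<le> 2 powr \<theta> * (x powr \<theta> + y powr \<theta>)"
proof -
  have "(x + y) powr \<theta> \<le> (2 * max x y) powr \<theta>" using assms by (intro powr_mono2) auto
  also have "\<dots> = 2 powr \<theta> * max x y powr \<theta>" by (rule powr_mult)
  also have "\<dots> \<le> 2 powr \<theta> * (x powr \<theta> + y powr \<theta>)"
    by (intro mult_left_mono) (simp_all add: max_def)
  finally show ?thesis .
qed

lemma powr_le_one_plus:
  fixes y \<sigma> :: real
  assumes "0 < y" "0 \<le> \<sigma>" "\<sigma> \<le> 1"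
  shows "y powr \<sigma> \<le> 1 + y"
proof (cases "y \<le> 1")
  case True
  then have "y powr \<sigma> \<le> 1" using assms by (simp add: powr_le1)
  then show ?thesis using assms by simp
next
  case False
  then have "y powr \<sigma> \<le> y powr 1" using assms by (intro powr_mono) auto
  then show ?thesis using assms by simp
qed

context bbm
begin

text \<open>The multiplier \<open>\<epsilon> \<L>\<^sub>\<epsilon>\<close> trades \<open>2\<sigma> - 1\<close> derivatives for the factor \<open>\<epsilon>\<^bsup>1-\<sigma>\<^esup>\<close>,
  by \<open>y\<^bsup>\<sigma>\<^esup> \<le> 1 + y\<close> for \<open>y = \<epsilon>k\<^sup>2\<close>.\<close>

lemma eps_lsym_gain:
  assumes \<sigma>: "0 \<le> \<sigma>" "\<sigma> \<le> 1"
  shows "cmod (\<epsilon> * lsym k) \<le> 2 * \<epsilon> powr (1 - \<sigma>) * bracket (1 - 2 * \<sigma>) k"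
proof (cases "k = 0")
  case True
  then show ?thesis by (simp add: lsym_def)
next
  case False
  define y where "y = \<epsilon> * (of_int k)\<^sup>2"
  have k: "1 \<le> (of_int k :: real)\<^sup>2"
  proof -
    have "1 \<le> \<bar>of_int k :: real\<bar>" using False by linarith
    then show ?thesis by (metis abs_power2 one_le_power power_abs)
  qed
  have y: "0 < y" unfolding y_def using \<epsilon> k by (intro mult_pos_pos) auto
  define X where "X = (of_int k :: real)\<^sup>2"
  have X: "1 \<le> X" "0 < X" using k by (auto simp: X_def)
  have absk: "\<bar>of_int k :: real\<bar> = X powr (1 / 2)"
    by (simp add: X_def powr_half_sqrt)
  have "1 / (1 + y) \<le> y powr (- \<sigma>)"
    using powr_le_one_plus[OF y \<sigma>] y by (simp add: powr_minus field_simps)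
  then have "\<epsilon> * \<bar>of_int k\<bar> * (1 / (1 + y)) \<le> \<epsilon> * \<bar>of_int k\<bar> * y powr (- \<sigma>)"
    using \<epsilon> by (intro mult_left_mono) auto
  moreover have "cmod (\<epsilon> * lsym k) = \<epsilon> * \<bar>of_int k\<bar> * (1 / (1 + y))"
    using \<epsilon> by (simp add: norm_mult norm_lsym y_def)
  moreover have "\<epsilon> * \<bar>of_int k\<bar> * y powr (- \<sigma>) = \<epsilon> powr (1 - \<sigma>) * X powr ((1 - 2 * \<sigma>) / 2)"
  proof -
    have "y powr (- \<sigma>) = \<epsilon> powr (- \<sigma>) * X powr (- \<sigma>)"
      using \<epsilon> X by (simp add: y_def X_def powr_mult)
    moreover have "\<epsilon> powr (1 - \<sigma>) = \<epsilon> * \<epsilon> powr (- \<sigma>)"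
      using \<epsilon> powr_add[of \<epsilon> 1 "- \<sigma>"] by simp
    moreover have "X powr ((1 - 2 * \<sigma>) / 2) = X powr (1 / 2) * X powr (- \<sigma>)"
      by (simp add: diff_divide_distrib flip: powr_add)
    ultimately show ?thesis by (simp add: absk)
  qed
  moreover have "\<epsilon> powr (1 - \<sigma>) * X powr ((1 - 2 * \<sigma>) / 2) \<le> \<epsilon> powr (1 - \<sigma>) * (2 * bracket (1 - 2 * \<sigma>) k)"
  proof (rule mult_left_mono, cases "0 \<le> 1 - 2 * \<sigma>")
    case True
    then have "X powr ((1 - 2 * \<sigma>) / 2) \<le> bracket (1 - 2 * \<sigma>) k"
      unfolding bracket_def X_def by (intro powr_mono2) auto
    then show "X powr ((1 - 2 * \<sigma>) / 2) \<le> 2 * bracket (1 - 2 * \<sigma>) k"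
      using bracket_nonneg[of "1 - 2 * \<sigma>" k] by linarith
  next
    case False
    \<comment> \<open>For a negative exponent X >= 1 gives X >= (1 + X) / 2, at the cost of the
      factor 2^(\<sigma> - 1/2) <= 2.\<close>
    have "X powr ((1 - 2 * \<sigma>) / 2) \<le> ((1 + X) / 2) powr ((1 - 2 * \<sigma>) / 2)"
      using False X by (intro powr_mono2') auto
    also have "\<dots> = (1 + X) powr ((1 - 2 * \<sigma>) / 2) * 2 powr (- ((1 - 2 * \<sigma>) / 2))"
      using X by (simp add: powr_divide powr_minus_divide)
    also have "2 powr (- ((1 - 2 * \<sigma>) / 2)) \<le> 2 powr (1 :: real)"
      using \<sigma> by (intro powr_mono) auto
    finally show "X powr ((1 - 2 * \<sigma>) / 2) \<le> 2 * bracket (1 - 2 * \<sigma>) k"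
      using X by (simp add: bracket_def X_def mult.commute)
  qed simp
  ultimately have "cmod (\<epsilon> * lsym k) \<le> \<epsilon> powr (1 - \<sigma>) * (2 * bracket (1 - 2 * \<sigma>) k)" by linarith
  then show ?thesis by (simp only: mult_ac)
qed

text \<open>The denominators are at least 1, so \<open>freq\<close> grows no faster than P whatever
  \<epsilon> is. The summand 2 powr l pays for the output frequency, the 1 for the two input
  frequencies.\<close>

lemma phase_growth:
  assumes "degree P \<le> l"
  shows "\<bar>phase k j\<bar> \<le> (\<Sum>i\<le>degree P. cmod (coeff P i)) * (2 powr l + 1)
    * (bracket l j + bracket l (k - j))"
proof -
  let ?Q = "\<Sum>i\<le>degree P. cmod (coeff P i)"
  have f: "\<bar>freq n\<bar> \<le> ?Q * bracket l n" for n
  proof -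
    have "\<bar>freq n\<bar> \<le> \<bar>Im (poly P (\<i> * of_int n))\<bar> / 1"
      unfolding freq_def abs_divide using denominator_ge_1[of n] by (intro divide_left_mono) auto
    also have "\<dots> \<le> cmod (poly P (\<i> * of_int n))" using abs_Im_le_cmod by simp
    also have "\<dots> \<le> ?Q * bracket l n" by (rule poly_growth[OF assms])
    finally show ?thesis .
  qed
  have Q: "0 \<le> ?Q" by (simp add: sum_nonneg)
  have "?Q * bracket l k \<le> ?Q * (2 powr l * (bracket l j + bracket l (k - j)))"
    by (intro mult_left_mono bracket_quasi_triangle Q) simp
  then show ?thesis using f[of k] f[of j] f[of "k - j"] by (simp add: phase_def algebra_simps)
qed

end

text \<open>C is quantified before \<epsilon>, since the phase bounds are uniform in it; \<epsilon>
  survives only in the gain \<kappa>.\<close>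

lemma splitting_bbm:
  fixes P :: "complex poly" and l :: nat and \<sigma> r :: real
  assumes deg: "degree P = l" "1 \<le> l" and Re_P: "\<And>x::real. Re (poly P (\<i> * of_real x)) = 0"
    and \<sigma>: "0 \<le> \<sigma>" "\<sigma> \<le> 1" and r: "0 \<le> r"
  defines "s \<equiv> r + 1 + 2 * real l - 2 * \<sigma>"
  shows "\<exists>C\<ge>1. \<forall>\<epsilon>>0. splitting C s (r + 1 - 2 * \<sigma>) r (s - 1 / 4) (1 / (4 * real l))
    (2 * \<epsilon> powr (1 - \<sigma>)) (bbm.phase P \<epsilon>) (\<lambda>k. of_real \<epsilon> * bbm.lsym \<epsilon> k)"
proof -
  define q where "q = r + 1 - 2 * \<sigma>"
  define \<rho> where "\<rho> = s - 1 / 4"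
  define \<theta> where "\<theta> = 1 / (4 * real l)"
  have l1: "1 \<le> real l" using deg by simp
  \<comment> \<open>Everything rests on s >= 1, a consequence of l >= 1, \<sigma> <= 1 and r >= 0;
    \<open>\<bar>q\<bar> \<le> s\<close> holds although q may reach -1.\<close>
  have s: "1 / 2 < s" "1 / 2 < \<rho>" "\<bar>s\<bar> \<le> s" "\<bar>q\<bar> \<le> s" "\<bar>r\<bar> \<le> \<rho>" "\<bar>\<rho>\<bar> \<le> \<rho>" "q \<le> s" "\<rho> \<le> s"
    "s - 2 * real l = q" "\<bar>s - real l\<bar> \<le> s" "\<bar>\<rho>\<bar> \<le> s" "q \<le> s - real l"
    using l1 \<sigma> r by (auto simp: s_def q_def \<rho>_def)
  have th: "0 \<le> \<theta>" "\<theta> \<le> 1" "real l * \<theta> = 1 / 4" using l1 by (auto simp: \<theta>_def field_simps)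
  define D where "D = (\<Sum>i\<le>degree P. cmod (coeff P i)) * (2 powr l + 1)"
  have D: "0 \<le> D" by (simp add: D_def sum_nonneg)
  obtain Cs where Cs: "1 \<le> Cs" "\<forall>q c D A B a b. \<bar>q\<bar> \<le> s \<longrightarrow> (\<forall>k j. cmod (c k j) \<le> D) \<longrightarrow>
    hs_bounded q A a \<longrightarrow> hs_bounded s B b \<longrightarrow>
    twisted_summable c a b \<and> hs_bounded q (Cs * D * A * B) (twisted_conv c a b)"
    using twisted_conv_bounded_estimate[OF s(1)] by blast
  obtain Cr where Cr: "1 \<le> Cr" "\<forall>q c D A B a b. \<bar>q\<bar> \<le> \<rho> \<longrightarrow> (\<forall>k j. cmod (c k j) \<le> D) \<longrightarrow>
    hs_bounded q A a \<longrightarrow> hs_bounded \<rho> B b \<longrightarrow>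
    twisted_summable c a b \<and> hs_bounded q (Cr * D * A * B) (twisted_conv c a b)"
    using twisted_conv_bounded_estimate[OF s(2)] by blast
  obtain Cw where Cw: "1 \<le> Cw" "\<forall>\<mu> c D A B a b. \<bar>s - \<mu>\<bar> \<le> s \<longrightarrow>
    (\<forall>k j. cmod (c k j) \<le> D * (bracket \<mu> j + bracket \<mu> (k - j))) \<longrightarrow> 0 \<le> D \<longrightarrow>
    hs_bounded s A a \<longrightarrow> hs_bounded s B b \<longrightarrow>
    twisted_summable c a b \<and> hs_bounded (s - \<mu>) (Cw * D * A * B) (twisted_conv c a b)"
    using twisted_conv_weighted_estimate[OF s(1)] by blast
  define D' where "D' = (2 * D) powr \<theta>"
  define C where "C = Cs + Cr + Cw * D + Cw * (2 * D\<^sup>2) + Cw * D'"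
  have D': "0 \<le> D'" by (simp add: D'_def)
  have nn: "0 \<le> Cw * D" "0 \<le> Cw * (2 * D\<^sup>2)" "0 \<le> Cw * D'" using Cw(1) D D' by auto
  have C: "1 \<le> C" "Cs \<le> C" "Cr \<le> C" "Cw * D \<le> C" "Cw * (2 * D\<^sup>2) \<le> C" "Cw * D' \<le> C"
    unfolding C_def using Cs(1) Cr(1) nn by linarith+
  have up: "hs_bounded x (C' * E * A * B) f \<Longrightarrow> C' \<le> C \<Longrightarrow> 0 \<le> E \<Longrightarrow> 0 \<le> A \<Longrightarrow> 0 \<le> B
      \<Longrightarrow> hs_bounded x (C * E * A * B) f" for x C' E A B f
    by (erule hs_bounded_mono) (intro mult_right_mono)
  \<comment> \<open>E is the variable size of the coefficient and stays visible; F is the fixed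
    growth constant of a power of the phase and is absorbed into C.\<close>
  have wt: "twisted_summable c a b \<and> hs_bounded (s - \<mu>) (C * E * A * B) (twisted_conv c a b)"
    if "\<bar>s - \<mu>\<bar> \<le> s" "\<And>k j. cmod (c k j) \<le> E * (F * (bracket \<mu> j + bracket \<mu> (k - j)))"
      "0 \<le> E" "0 \<le> F" "Cw * F \<le> C" "hs_bounded s A a" "hs_bounded s B b" for \<mu> c E F A B a b
  proof -
    have "twisted_summable c a b \<and> hs_bounded (s - \<mu>) (Cw * (E * F) * A * B) (twisted_conv c a b)"
      using that by (intro Cw(2)[rule_format]) (auto simp: mult.assoc)
    moreover have "Cw * (E * F) * A * B = Cw * F * E * A * B" by simp
    ultimately show ?thesis
      using up[OF _ that(5,3) hs_bounded_nonneg[OF that(6)] hs_bounded_nonneg[OF that(7)]] by metis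
  qed
  have nonneg_D: "0 \<le> E" if "\<And>k j. cmod (c k j) \<le> E" for E and c :: "int \<Rightarrow> int \<Rightarrow> complex"
    using that[of 0 0] norm_ge_zero order_trans by blast
  show ?thesis
  proof (intro exI[of _ C] conjI C(1) allI impI)
    fix \<epsilon> :: real assume \<epsilon>: "0 < \<epsilon>"
    interpret bbm P \<epsilon> by unfold_locales (fact Re_P \<epsilon>)+
    have ph: "\<bar>phase k j\<bar> \<le> D * (bracket l j + bracket l (k - j))" for k j
      unfolding D_def by (rule phase_growth) (simp add: deg)
    have ph2: "(phase k j)\<^sup>2 \<le> 2 * D\<^sup>2 * (bracket (2 * l) j + bracket (2 * l) (k - j))" for k j
    proof -
      have "(phase k j)\<^sup>2 \<le> (D * (bracket l j + bracket l (k - j)))\<^sup>2"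
        using power_mono[OF ph[of k j], of 2] by simp
      also have "\<dots> \<le> D\<^sup>2 * (2 * ((bracket l j)\<^sup>2 + (bracket l (k - j))\<^sup>2))"
        unfolding power_mult_distrib by (intro mult_left_mono square_sum_le) simp
      also have "\<dots> = 2 * D\<^sup>2 * (bracket (2 * l) j + bracket (2 * l) (k - j))"
        using bracket_add[of "real l" "real l"] by (simp add: power2_eq_square)
      finally show ?thesis .
    qed
    have ph\<theta>: "\<bar>phase k j\<bar> powr \<theta> \<le> D' * (bracket (1 / 4) j + bracket (1 / 4) (k - j))" for k j
    proof -
      have "\<bar>phase k j\<bar> powr \<theta> \<le> (D * (bracket l j + bracket l (k - j))) powr \<theta>"
        using ph th by (intro powr_mono2) auto
      also have "\<dots> = D powr \<theta> * (bracket l j + bracket l (k - j)) powr \<theta>"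
        by (rule powr_mult)
      also have "\<dots> \<le> D powr \<theta> * (2 powr \<theta> * (bracket l j powr \<theta> + bracket l (k - j) powr \<theta>))"
        using th by (intro mult_left_mono powr_sum_le) auto
      also have "\<dots> = D' * (bracket (1 / 4) j + bracket (1 / 4) (k - j))"
      proof -
        have "real l / 2 * \<theta> = 1 / 4 / 2" unfolding times_divide_eq_left th(3) ..
        then have "bracket l n powr \<theta> = bracket (1 / 4) n" for n
          unfolding bracket_def powr_powr by (simp only:)
        then show ?thesis by (simp add: D'_def powr_mult)
      qed
      finally show ?thesis .
    qed
    show "splitting C s (r + 1 - 2 * \<sigma>) r (s - 1 / 4) (1 / (4 * real l))
      (2 * \<epsilon> powr (1 - \<sigma>)) phase (\<lambda>k. of_real \<epsilon> * lsym k)"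
      unfolding q_def[symmetric] \<rho>_def[symmetric] \<theta>_def[symmetric]
    proof
      show "1 \<le> C" "q \<le> s" "r \<le> \<rho>" "\<rho> \<le> s" "0 \<le> \<theta>" "\<theta> \<le> 1" "0 \<le> 2 * \<epsilon> powr (1 - \<sigma>)"
        using C s th by auto
      show "phase k (k - j) = phase k j" for k j by (simp add: phase_def)
      show "cmod (of_real \<epsilon> * lsym k) \<le> 1" for k by (rule eps_lsym_le_1)
    next
      fix A a assume "hs_bounded q A a"
      from hs_bounded_multiplier[OF this eps_lsym_gain[OF \<sigma>]]
      show "hs_bounded r (2 * \<epsilon> powr (1 - \<sigma>) * A) (\<lambda>k. of_real \<epsilon> * lsym k * a k)"
        by (simp add: q_def)
    next
      fix x E A B :: real and c :: "int \<Rightarrow> int \<Rightarrow> complex" and a b :: "int \<Rightarrow> complex"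
      assume x: "x = s \<or> x = q" and c: "\<And>k j. cmod (c k j) \<le> E"
        and a: "hs_bounded x A a" and b: "hs_bounded s B b"
      have "\<bar>x\<bar> \<le> s" using x s by auto
      then show "hs_bounded x (C * E * A * B) (twisted_conv c a b)"
        using Cs(2) a b c
        by (intro up[of _ Cs] C nonneg_D[OF c] hs_bounded_nonneg[OF a] hs_bounded_nonneg[OF b]) blast
    next
      fix x E A B :: real and c :: "int \<Rightarrow> int \<Rightarrow> complex" and a b :: "int \<Rightarrow> complex"
      assume x: "x = r \<or> x = \<rho>" and c: "\<And>k j. cmod (c k j) \<le> E"
        and a: "hs_bounded x A a" and b: "hs_bounded \<rho> B b"
      have "\<bar>x\<bar> \<le> \<rho>" using x s by auto
      then show "hs_bounded x (C * E * A * B) (twisted_conv c a b)"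
        using Cr(2) a b c
        by (intro up[of _ Cr] C nonneg_D[OF c] hs_bounded_nonneg[OF a] hs_bounded_nonneg[OF b]) blast
    next
      fix E A B :: real and c :: "int \<Rightarrow> int \<Rightarrow> complex" and a b :: "int \<Rightarrow> complex"
      assume c: "\<And>k j. cmod (c k j) \<le> E" and a: "hs_bounded \<rho> A a" and b: "hs_bounded \<rho> B b"
      then show "twisted_summable c a b" using Cr(2) s(6) by blast
    next
      fix E A B :: real and c :: "int \<Rightarrow> int \<Rightarrow> complex" and a b :: "int \<Rightarrow> complex"
      assume E: "0 \<le> E" and c: "\<And>k j. cmod (c k j) \<le> E * \<bar>phase k j\<bar>"
        and ab: "hs_bounded s A a" "hs_bounded s B b"
      have "cmod (c k j) \<le> E * (D * (bracket l j + bracket l (k - j)))" for k j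
        using c[of k j] mult_left_mono[OF ph E] order_trans by blast
      \<comment> \<open>One power of the phase costs l derivatives only, and order s - l is weakened
        to q = s - 2 l.\<close>
      from wt[OF s(10) this E D C(4) ab]
      show "twisted_summable c a b \<and> hs_bounded q (C * E * A * B) (twisted_conv c a b)"
        using s(12) hs_bounded_weaken by blast
    next
      fix E A B :: real and c :: "int \<Rightarrow> int \<Rightarrow> complex" and a b :: "int \<Rightarrow> complex"
      assume E: "0 \<le> E" and c: "\<And>k j. cmod (c k j) \<le> E * (phase k j)\<^sup>2"
        and ab: "hs_bounded s A a" "hs_bounded s B b"
      have "cmod (c k j) \<le> E * (2 * D\<^sup>2 * (bracket (2 * l) j + bracket (2 * l) (k - j)))" for k j
        using c[of k j] mult_left_mono[OF ph2 E] order_trans by blast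
      from wt[OF _ this E _ C(5) ab] show "hs_bounded q (C * E * A * B) (twisted_conv c a b)"
        using s by simp
    next
      fix E A B :: real and c :: "int \<Rightarrow> int \<Rightarrow> complex" and a b :: "int \<Rightarrow> complex"
      assume E: "0 \<le> E" and c: "\<And>k j. cmod (c k j) \<le> E * \<bar>phase k j\<bar> powr \<theta>"
        and ab: "hs_bounded s A a" "hs_bounded s B b"
      have "cmod (c k j) \<le> E * (D' * (bracket (1 / 4) j + bracket (1 / 4) (k - j)))" for k j
        using c[of k j] mult_left_mono[OF ph\<theta> E] order_trans by blast
      from wt[OF _ this E D' C(6) ab] show "hs_bounded \<rho> (C * E * A * B) (twisted_conv c a b)"
        using s by (simp add: \<rho>_def)
    qed
  qed
qed

context bbm
begin

text \<open>The almost everywhere clause is for the initial value, a mere representative; from the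
  first step on each iterate is itself a series.\<close>

lemma strang_series:
  fixes \<tau> :: real
  assumes s: "1 / 2 < s" and w: "w \<in> borel_measurable torus" "\<And>x. w (x + 2 * pi) = w x"
    and ae: "AE x in torus. w x = trig_series (fourier_coeff w) x" and A: "hs_bounded s A (fourier_coeff w)"
  shows "strang P \<epsilon> \<tau> w n \<in> borel_measurable torus \<and>
    (\<forall>x. strang P \<epsilon> \<tau> w n (x + 2 * pi) = strang P \<epsilon> \<tau> w n x) \<and>
    (AE x in torus. strang P \<epsilon> \<tau> w n x = trig_series (fourier_coeff (strang P \<epsilon> \<tau> w n)) x) \<and>
    (\<exists>A. hs_bounded s A (fourier_coeff (strang P \<epsilon> \<tau> w n)))"
proof (induction n)
  case 0
  show ?case using w ae A by auto
next
  case (Suc n)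
  then obtain A where IH: "strang P \<epsilon> \<tau> w n \<in> borel_measurable torus"
    "AE x in torus. strang P \<epsilon> \<tau> w n x = trig_series (fourier_coeff (strang P \<epsilon> \<tau> w n)) x"
    "hs_bounded s A (fourier_coeff (strang P \<epsilon> \<tau> w n))"
    by blast
  from strang_step_series[OF s IH, of \<tau>] obtain z B where
    z: "strang P \<epsilon> \<tau> w (Suc n) = trig_series z" "hs_bounded s B z"
    by auto
  note sm = hs_bounded_abs_summable[OF s z(2)]
  have "fourier_coeff (strang P \<epsilon> \<tau> w (Suc n)) = z"
    unfolding z(1) by (rule fourier_coeff_trig_series[OF sm])
  moreover have "trig_series z \<in> borel_measurable torus"
    by (intro measurable_continuous_torus continuous_on_trig_series sm)
  ultimately show ?case using z by (simp only: trig_series_periodic) auto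
qed

text \<open>Z n undoes the free flow up to time n \<tau>. The half steps of the scheme carry it to
  the midpoint m, which is why the nonlinearity appears frozen at that time.\<close>

lemma strang_interaction_step:
  fixes \<tau> m :: real and Z :: "nat \<Rightarrow> int \<Rightarrow> complex" and \<beta> :: "int \<Rightarrow> complex"
    and N :: "real \<Rightarrow> (int \<Rightarrow> complex) \<Rightarrow> (int \<Rightarrow> complex) \<Rightarrow> int \<Rightarrow> complex"
  assumes s: "1 / 2 < s" and w: "w \<in> borel_measurable torus" "\<And>x. w (x + 2 * pi) = w x"
    and ae: "AE x in torus. w x = trig_series (fourier_coeff w) x" and A: "hs_bounded s A (fourier_coeff w)"
  defines "Z \<equiv> \<lambda>n k. cis (real n * \<tau> * freq k) * fourier_coeff (strang P \<epsilon> \<tau> w n) k"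
    and "\<beta> \<equiv> \<lambda>k. of_real \<epsilon> * lsym k"
    and "N \<equiv> \<lambda>t. twisted_conv (\<lambda>k j. cis (t * phase k j))"
  assumes m: "m = real n * \<tau> + \<tau> / 2"
  shows "Z (Suc n) k = Z n k - \<tau> * (\<beta> k * N m (Z n) (Z n) k)
    + \<tau>\<^sup>2 * (\<beta> k * N m (Z n) (\<lambda>j. \<beta> j * N m (Z n) (Z n) j) k)"
proof -
  define z where "z = fourier_coeff (strang P \<epsilon> \<tau> w n)"
  define v where "v = (\<lambda>k. cis (- \<tau> / 2 * freq k) * z k)"
  obtain A where IH: "strang P \<epsilon> \<tau> w n \<in> borel_measurable torus"
    "AE x in torus. strang P \<epsilon> \<tau> w n x = trig_series z x" "hs_bounded s A z"
    using strang_series[OF s w ae A, of \<tau> n] unfolding z_def by blast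
  note st = strang_step_series[OF s IH, of \<tau>, folded v_def]
  have next_coeff: "fourier_coeff (strang P \<epsilon> \<tau> w (Suc n)) k = cis (- \<tau> * freq k) * z k
      - \<tau> * (cis (- \<tau> / 2 * freq k) * (\<beta> k * conv v v k))
      + \<tau>\<^sup>2 * (cis (- \<tau> / 2 * freq k) * (\<beta> k * conv v (\<lambda>j. \<beta> j * conv v v j) k))" for k
  proof -
    obtain B where "hs_bounded s B (\<lambda>k. cis (- \<tau> * freq k) * z k
      - \<tau> * (cis (- \<tau> / 2 * freq k) * (\<beta> k * conv v v k))
      + \<tau>\<^sup>2 * (cis (- \<tau> / 2 * freq k) * (\<beta> k * conv v (\<lambda>j. \<beta> j * conv v v j) k)))"
      using st(2) unfolding \<beta>_def by blast
    from fourier_coeff_trig_series[OF hs_bounded_abs_summable[OF s this]] show ?thesis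
      unfolding strang.simps st(1) \<beta>_def by (rule fun_cong)
  qed
  \<comment> \<open>The time shifts add up to - m + n \<tau> = - \<tau> / 2.\<close>
  have vm: "cis (- m * freq k) * Z n k = v k" for k
  proof -
    have "cis (- m * freq k) * cis (real n * \<tau> * freq k) = cis (- \<tau> / 2 * freq k)"
      by (simp add: cis_mult m algebra_simps)
    then show ?thesis unfolding Z_def z_def[symmetric] v_def by (simp only: mult.assoc[symmetric])
  qed
  have N1: "N m (Z n) (Z n) k = cis (m * freq k) * conv v v k" for k
    unfolding N_def twisted_conv_gauge vm ..
  have N2: "N m (Z n) (\<lambda>j. \<beta> j * N m (Z n) (Z n) j) k = cis (m * freq k) * conv v (\<lambda>j. \<beta> j * conv v v j) k" for k
  proof -
    have "cis (- m * freq j) * (\<beta> j * (cis (m * freq j) * conv v v j)) = \<beta> j * conv v v j" for j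
    proof -
      have "cis (- m * freq j) * cis (m * freq j) = 1" by (simp add: cis_mult)
      then show ?thesis by (metis mult.assoc mult.left_commute mult_1)
    qed
    then show ?thesis unfolding N1 unfolding N_def twisted_conv_gauge vm by (simp only:)
  qed
  have c1: "cis (real (Suc n) * \<tau> * freq k) * cis (- \<tau> * freq k) = cis (real n * \<tau> * freq k)"
    and c2: "cis (real (Suc n) * \<tau> * freq k) * cis (- \<tau> / 2 * freq k) = cis (m * freq k)"
    by (simp_all add: cis_mult m algebra_simps)
  have "Z (Suc n) k = (cis (real (Suc n) * \<tau> * freq k) * cis (- \<tau> * freq k)) * z k
      - \<tau> * (\<beta> k * ((cis (real (Suc n) * \<tau> * freq k) * cis (- \<tau> / 2 * freq k)) * conv v v k))
      + \<tau>\<^sup>2 * (\<beta> k * ((cis (real (Suc n) * \<tau> * freq k) * cis (- \<tau> / 2 * freq k)) * conv v (\<lambda>j. \<beta> j * conv v v j) k))"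
    unfolding Z_def next_coeff by (simp only: distrib_left right_diff_distrib mult_ac)
  then show ?thesis unfolding c1 c2 N2 unfolding N1 by (simp only: Z_def z_def)
qed

end

theorem theorem7:
  fixes P :: "complex poly" and l :: nat and T \<sigma> r :: real
  assumes "degree P = l" and "l \<ge> 1"
    and "\<And>x::real. Re (poly P (\<i> * of_real x)) = 0"
    and "T > 0"
    and "0 \<le> \<sigma>" and "\<sigma> \<le> 1" and "r \<ge> 0"
    and "r + 1 - 2 * \<sigma> + 2 * real l > 1 / 2"
  shows "\<exists>K :: real \<Rightarrow> real. (\<forall>M\<ge>0. K M > 0) \<and>
    (\<forall>(\<epsilon>::real) (u :: real \<Rightarrow> real \<Rightarrow> complex).
       0 < \<epsilon> \<longrightarrow> \<epsilon> \<le> 1 \<longrightarrow>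
       mild_solution P \<epsilon> T u \<longrightarrow>
       sobolev_continuous_on {0..T} (r + 1 + 2 * real l - 2 * \<sigma>) u \<longrightarrow>
       (\<exists>\<tau>0>0. \<forall>(\<tau>::real) (n::nat). 0 < \<tau> \<longrightarrow> \<tau> \<le> \<tau>0 \<longrightarrow> real n * \<tau> \<le> T \<longrightarrow>
          (\<lambda>x. u (real n * \<tau>) x - strang P \<epsilon> \<tau> (u 0) n x) \<in> sobolev r \<and>
          sobolev_norm r (\<lambda>x. u (real n * \<tau>) x - strang P \<epsilon> \<tau> (u 0) n x)
            \<le> \<tau>\<^sup>2 * \<epsilon> powr (1 - \<sigma>)
                * K (SUP t\<in>{0..T}. sobolev_norm (r + 1 + 2 * real l - 2 * \<sigma>) (u t))))"
proof -
  define s where "s = r + 1 + 2 * real l - 2 * \<sigma>"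
  define \<rho> where "\<rho> = s - 1 / 4"
  define \<theta> where "\<theta> = 1 / (4 * real l)"
  have exps: "1 / 2 < s" "1 / 2 < \<rho>" "\<rho> \<le> s" "0 < \<theta>"
    using assms by (auto simp: s_def \<rho>_def \<theta>_def)
  obtain C where C1: "1 \<le> C" and C: "\<And>\<epsilon>. 0 < \<epsilon> \<Longrightarrow> splitting C s (r + 1 - 2 * \<sigma>) r \<rho> \<theta>
      (2 * \<epsilon> powr (1 - \<sigma>)) (bbm.phase P \<epsilon>) (\<lambda>k. of_real \<epsilon> * bbm.lsym \<epsilon> k)"
    using splitting_bbm[OF assms(1,2,3,5,6,7)] unfolding s_def \<rho>_def \<theta>_def by blast
  \<comment> \<open>The constants depend on C only, but their definitions unfold inside an instance;
    \<epsilon> = 1 serves, because K must be chosen before \<epsilon>.\<close>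
  interpret S1: splitting C s "r + 1 - 2 * \<sigma>" r \<rho> \<theta> "2 * 1 powr (1 - \<sigma>)" "bbm.phase P 1"
      "\<lambda>k. of_real 1 * bbm.lsym 1 k"
    by (rule C) simp
  define L where "L = splitting.stab_const C"
  define F where "F = splitting.fine_const C"
  define G where "G = splitting.coarse_const C"
  \<comment> \<open>The 2 is the factor in \<kappa> = 2 \<epsilon> powr (1 - \<sigma>), the final 1
    makes K positive even at M = 0.\<close>
  define K where "K M = 2 * (T * exp (L M * T) * F M) + 1" for M
  have FG: "0 \<le> F M" "0 \<le> G M" if "0 \<le> M" for M
    using that C1 by (auto simp: F_def G_def S1.fine_const_def S1.coarse_const_def)
  show ?thesis
    unfolding s_def[symmetric]
  proof (intro exI[of _ K] conjI allI impI)
    fix M :: real assume "0 \<le> M"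
    then show "0 < K M" using FG assms(4) by (simp add: K_def add_nonneg_pos)
  next
    fix \<epsilon> :: real and u :: "real \<Rightarrow> real \<Rightarrow> complex"
    assume \<epsilon>: "0 < \<epsilon>" "\<epsilon> \<le> 1" and mild: "mild_solution P \<epsilon> T u" and u: "sobolev_continuous_on {0..T} s u"
    interpret bbm P \<epsilon> by unfold_locales (fact assms(3) \<epsilon>)+
    interpret S: splitting C s "r + 1 - 2 * \<sigma>" r \<rho> \<theta> "2 * \<epsilon> powr (1 - \<sigma>)" phase
        "\<lambda>k. of_real \<epsilon> * lsym k"
      by (rule C[OF \<epsilon>(1)])
    define M where "M = (SUP t\<in>{0..T}. sobolev_norm s (u t))"
    define U where "U t = fourier_coeff (u t)" for t
    have "bdd_above ((\<lambda>t. sobolev_norm s (u t)) ` {0..T})"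
      using compact_imp_bounded[OF compact_continuous_image[OF sobolev_norm_continuous[OF u]]]
      by (auto intro: bounded_imp_bdd_above)
    then have uM: "\<forall>t\<in>{0..T}. sobolev_norm s (u t) \<le> M"
      unfolding M_def by (auto intro: cSUP_upper)
    note sol = assms(4) exps(1) mild u uM U_def
    have T0: "0 \<in> {0..T}" using assms(4) by simp
    have M: "0 \<le> M" using U_bounded[OF sol T0] hs_bounded_nonneg by blast
    define W where "W t k = cis (t * freq k) * U t k" for t k
    have Wb: "hs_bounded s M (W t)" if "t \<in> {0..T}" for t
      using hs_bounded_multiplier_le[OF U_bounded[OF sol that], of "\<lambda>k. cis (t * freq k)" 1]
      by (simp add: W_def[abs_def])
    have nl: "S.nl t (W t) (W t) k = cis (t * freq k) * conv (U t) (U t) k" for t k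
    proof -
      have "cis (- t * freq k) * W t k = U t k" for k
      proof -
        have "cis (- t * freq k) * cis (t * freq k) = 1" by (simp add: cis_mult)
        then show ?thesis by (simp add: W_def flip: mult.assoc)
      qed
      then show ?thesis unfolding S.nl_def twisted_conv_gauge by simp
    qed
    have Wc: "continuous_on {0..T} (\<lambda>t. S.nl t (W t) (W t) k)" for k
      unfolding nl by (intro continuous_intros continuous_conv[OF sol])
    \<comment> \<open>Multiplying Duhamel's formula by \<open>cis (t * freq k)\<close> removes the
      linear part.\<close>
    have We: "W t k = W 0 k - of_real \<epsilon> * lsym k * integral {0..t} (\<lambda>x. S.nl x (W x) (W x) k)"
      if t: "t \<in> {0..T}" for t k
    proof -
      have "cis (t * freq k) * integral {0..t} (\<lambda>x. cis (- (t - x) * freq k) * conv (U x) (U x) k)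
          = integral {0..t} (\<lambda>x. S.nl x (W x) (W x) k)"
      proof -
        have "cis (t * freq k) * (cis (- (t - x) * freq k) * conv (U x) (U x) k) = S.nl x (W x) (W x) k" for x
          unfolding nl mult.assoc[symmetric] by (simp add: cis_mult algebra_simps)
        then show ?thesis by (simp flip: integral_mult_right)
      qed
      moreover have "cis (t * freq k) * cis (- t * freq k) = 1" by (simp add: cis_mult)
      moreover have "W t k = (cis (t * freq k) * cis (- t * freq k)) * U 0 k - of_real \<epsilon> * lsym k *
          (cis (t * freq k) * integral {0..t} (\<lambda>x. cis (- (t - x) * freq k) * conv (U x) (U x) k))"
        unfolding W_def mild_coeff[OF sol t, of k] by (simp only: right_diff_distrib mult_ac)
      ultimately show ?thesis by (simp add: W_def)
    qed
    \<comment> \<open>The smallness condition of \<open>global_error\<close> follows from a * \<tau>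
      powr \<theta> <= 1; the added 1 keeps a positive, so that \<tau>0 can be solved for.\<close>
    define a where "a = T * exp (L M * T) * G M + 1"
    have a: "0 < a" "T * exp (L M * T) * G M \<le> a" using FG[OF M] assms(4) by (auto simp: a_def add_nonneg_pos)
    define \<tau>0 where "\<tau>0 = min 1 ((1 / a) powr (1 / \<theta>))"
    show "\<exists>\<tau>0>0. \<forall>(\<tau>::real) (n::nat). 0 < \<tau> \<longrightarrow> \<tau> \<le> \<tau>0 \<longrightarrow> real n * \<tau> \<le> T \<longrightarrow>
          (\<lambda>x. u (real n * \<tau>) x - strang P \<epsilon> \<tau> (u 0) n x) \<in> sobolev r \<and>
          sobolev_norm r (\<lambda>x. u (real n * \<tau>) x - strang P \<epsilon> \<tau> (u 0) n x)
            \<le> \<tau>\<^sup>2 * \<epsilon> powr (1 - \<sigma>) * K (SUP t\<in>{0..T}. sobolev_norm s (u t))"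
      unfolding M_def[symmetric]
    proof (intro exI[of _ \<tau>0] conjI[of "0 < \<tau>0"] allI impI)
      show "0 < \<tau>0" using a by (simp add: \<tau>0_def)
      fix \<tau> :: real and n :: nat
      assume \<tau>: "0 < \<tau>" "\<tau> \<le> \<tau>0" and n: "real n * \<tau> \<le> T"
      have \<tau>1: "\<tau> \<le> 1" using \<tau> by (simp add: \<tau>0_def)
      have "\<tau> powr \<theta> \<le> ((1 / a) powr (1 / \<theta>)) powr \<theta>"
        using \<tau> exps by (intro powr_mono2) (auto simp: \<tau>0_def)
      also have "\<dots> = 1 / a" using exps a by (simp add: powr_powr)
      finally have "(T * exp (L M * T) * G M) * \<tau> powr \<theta> \<le> a * (1 / a)"
        using a FG[OF M] assms(4) by (intro mult_mono) auto
      then have small: "T * exp (L M * T) * (\<tau> powr \<theta> * G M) \<le> 1" using a by (simp add: mult_ac)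
      have u0: "u 0 \<in> borel_measurable torus" "\<And>x. u 0 (x + 2 * pi) = u 0 x"
        "AE x in torus. u 0 x = trig_series (fourier_coeff (u 0)) x" "hs_bounded \<rho> M (fourier_coeff (u 0))"
        using u_measurable[OF sol T0] u T0 u_eq_trig_series[OF sol T0]
          hs_bounded_weaken[OF U_bounded[OF sol T0] exps(3)]
        by (auto simp: sobolev_continuous_on_def sobolev_def U_def)
      define Z where "Z n k = cis (real n * \<tau> * freq k) * fourier_coeff (strang P \<epsilon> \<tau> (u 0) n) k" for n k
      have Z0: "Z 0 = W 0" by (simp add: Z_def[abs_def] W_def[abs_def] U_def fun_eq_iff)
      have Zs: "Z (Suc n) = S.step \<tau> (real n * \<tau> + \<tau> / 2) (Z n)" for n
        using strang_interaction_step[OF exps(2) u0 refl, of n \<tau>]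
        by (simp add: fun_eq_iff S.step_def S.nl_def Z_def[abs_def])
      have err: "hs_bounded r (\<tau>\<^sup>2 * (2 * \<epsilon> powr (1 - \<sigma>)) * (T * exp (L M * T) * F M))
          (\<lambda>k. W (real n * \<tau>) k - Z n k)"
        using S.global_error[OF \<tau>(1) \<tau>1 Wb Wc We Z0 Zs small[unfolded L_def G_def] n]
        by (simp add: L_def F_def)
      define t where "t = real n * \<tau>"
      have t: "t \<in> {0..T}" using n \<tau> by (simp add: t_def)
      define z where "z = fourier_coeff (strang P \<epsilon> \<tau> (u 0) n)"
      have "cis (- t * freq k) * (W t k - Z n k) = U t k - z k" for k
      proof -
        have "W t k - Z n k = cis (t * freq k) * (U t k - z k)"
          by (simp add: W_def Z_def z_def t_def right_diff_distrib)
        moreover have "cis (- t * freq k) * cis (t * freq k) = 1" by (simp add: cis_mult)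
        ultimately show ?thesis by (simp flip: mult.assoc)
      qed
      \<comment> \<open>Leaving the interaction picture multiplies each mode by a unimodular factor,
        so the error norm is unchanged.\<close>
      then have "hs_bounded r (1 * (\<tau>\<^sup>2 * (2 * \<epsilon> powr (1 - \<sigma>)) * (T * exp (L M * T) * F M))) (\<lambda>k. U t k - z k)"
        using hs_bounded_multiplier_le[OF err[folded t_def], of "\<lambda>k. cis (- t * freq k)" 1] by simp
      then have diff: "hs_bounded r (\<tau>\<^sup>2 * \<epsilon> powr (1 - \<sigma>) * K M) (\<lambda>k. U t k - z k)"
        by (rule hs_bounded_mono) (simp add: K_def algebra_simps)
      obtain B where st: "strang P \<epsilon> \<tau> (u 0) n \<in> borel_measurable torus"
          "\<And>x. strang P \<epsilon> \<tau> (u 0) n (x + 2 * pi) = strang P \<epsilon> \<tau> (u 0) n x"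
          "AE x in torus. strang P \<epsilon> \<tau> (u 0) n x = trig_series z x" "hs_bounded \<rho> B z"
        using strang_series[OF exps(2) u0, of \<tau> n] unfolding z_def by blast
      note sm = hs_bounded_abs_summable[OF exps(2)]
      note Ur = hs_bounded_weaken[OF U_bounded[OF sol t] exps(3)]
      have ae: "AE x in torus. u t x - strang P \<epsilon> \<tau> (u 0) n x = trig_series (\<lambda>k. U t k - z k) x"
        using u_eq_trig_series[OF sol t] st(3) by eventually_elim (simp add: trig_series_diff sm[OF Ur] sm[OF st(4)])
      have per: "u t (x + 2 * pi) - strang P \<epsilon> \<tau> (u 0) n (x + 2 * pi) = u t x - strang P \<epsilon> \<tau> (u 0) n x" for x
        using u t st(2) by (simp add: sobolev_continuous_on_def sobolev_def)
      have meas: "(\<lambda>x. u t x - strang P \<epsilon> \<tau> (u 0) n x) \<in> borel_measurable torus"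
        by (intro borel_measurable_diff u_measurable[OF sol t] st)
      note concl = sobolev_trig_seriesI[OF per meas ae sm[OF hs_bounded_diff[OF Ur st(4)]] diff]
      show "(\<lambda>x. u (real n * \<tau>) x - strang P \<epsilon> \<tau> (u 0) n x) \<in> sobolev r \<and>
        sobolev_norm r (\<lambda>x. u (real n * \<tau>) x - strang P \<epsilon> \<tau> (u 0) n x)
            \<le> \<tau>\<^sup>2 * \<epsilon> powr (1 - \<sigma>) * K M"
        using concl by (simp only: t_def)
    qed
  qed
qed

end
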